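(* Let $E$ and $F$ be sc-Banach spaces, let $U$ be a relatively open subset of a partial quadrant $C$ in $E$, and let $k\ge 0$ be an integer. Assume that $f:U\to F$ is an $\mathrm{sc}^0$-map such that for every $0\le l\le k$ and every $m\ge 0$ the induced map $f:U_{m+l}\to F_m$ is of class $C^{l+1}$. Then $f$ is $\mathrm{sc}^{k+1}$.
   Context: $\mathbb N_0=\{0,1,2,\dots\}$. An sc-structure on a Banach space $E$ is a nested sequence $E=E_0\supset E_1\supset\cdots$ of Banach spaces such that every inclusion $E_{m+1}\to E_m$ is compact and $E_\infty:=\bigcap_m E_m$ is dense in every $E_m$; $E$ is then an sc-Banach space. Finite-dimensional spaces carry the constant structure. $|\cdot|_m$ is the norm of $E_m$. $E\oplus F$ has levels $E_m\oplus F_m$; $E^k$ is $E_k$ with levels $(E^k)_m=E_{k+m}$. A linear map $T:E\to F$ is an sc-operator if it maps $E_m$ continuously into $F_m$ for all $m$; a linear sc-isomorphism is a bijective sc-operator whose inverse is an sc-operator. A partial quadrant in $E$ is a closed subset $C\subset E$ for which there are an sc-Banach space $W$, an integer $k\ge 0$ and a linear sc-isomorphism $T:E\to\mathbb R^k\oplus W$ with $T(C)=[0,\infty)^k\oplus W$. A relatively open $U\subset C$ has levels $U_m=U\cap E_m$ (with the topology of $E_m$); $U^k$ is $U_k$ with levels $U_{k+m}$; its tangent is $TU=U^1\oplus E$, a relatively open subset of the partial quadrant $C^1\oplus E$ of $E^1\oplus E$. A map $f:U\to V$ between relatively open subsets of partial quadrants in sc-Banach spaces $E$ and $F$ is $\mathrm{sc}^0$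 if $f(U_m)\subset V_m$ and $f:U_m\to V_m$ is continuous for all $m$. An $\mathrm{sc}^0$-map $f$ is $\mathrm{sc}^1$ if for every $x\in U_1$ there is a bounded linear operator $Df(x):E_0\to F_0$ such that (1) $\lim_{|h|_1\to0}\frac1{|h|_1}|f(x+h)-f(x)-Df(x)h|_0=0$, where $h\in E_1$ and $x+h\in C$; (2) the tangent map $Tf:TU\to TV$, $(x,h)\mapsto(f(x),Df(x)h)$, is $\mathrm{sc}^0$. Inductively, $f$ is $\mathrm{sc}^{k+1}$ if it is $\mathrm{sc}^1$ and $Tf$ is $\mathrm{sc}^k$; $f$ is sc-smooth ($\mathrm{sc}^\infty$) if it is $\mathrm{sc}^k$ for all $k$. *)

theory Defs
  imports "HOL-Analysis.Analysis" "HOL-Library.Function_Algebras"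
begin

instantiation "fun" :: (type, real_vector) real_vector
begin

definition "scaleR c f = (\<lambda>x. c *\<^sub>R f x)"

instance
  by intro_classes
    (auto simp: scaleR_fun_def fun_eq_iff scaleR_add_right scaleR_add_left)

end

lemma scaleR_fun_apply [simp]: "(c *\<^sub>R f) x = c *\<^sub>R f x"
  by (simp add: scaleR_fun_def)


section \<open>Normed spaces on subspaces of a real vector space\<close>

text \<open>The levels of an sc-Banach space are different Banach spaces with nested underlying
  sets, so a normed space is a set of points of an ambient real vector space together with a norm,
  whose values outside that set are irrelevant.\<close>

record 'a nspace =
  pts :: "'a set"
  nrm :: "'a \<Rightarrow> real"

definition normed :: "'a::real_vector nspace \<Rightarrow> bool" where
  "normed X \<longleftrightarrow> subspace (pts X) \<and>
     (\<forall>x\<in>pts X. 0 \<le> nrm X x \<and> (nrm X x = 0 \<longleftrightarrow> x = 0)) \<and>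
     (\<forall>x\<in>pts X. \<forall>c. nrm X (c *\<^sub>R x) = \<bar>c\<bar> * nrm X x) \<and>
     (\<forall>x\<in>pts X. \<forall>y\<in>pts X. nrm X (x + y) \<le> nrm X x + nrm X y)"

text \<open>The locale \<open>Metric_space\<close> requires the distance to be symmetric and nonnegative
  on the whole type, whence the case distinction.\<close>

definition ndist :: "'a::real_vector nspace \<Rightarrow> 'a \<Rightarrow> 'a \<Rightarrow> real" where
  "ndist X x y = (if x \<in> pts X \<and> y \<in> pts X then nrm X (x - y) else 0)"

definition ntop :: "'a::real_vector nspace \<Rightarrow> 'a topology" where
  "ntop X = Metric_space.mtopology (pts X) (ndist X)"

definition banach_space :: "'a::real_vector nspace \<Rightarrow> bool" where
  "banach_space X \<longleftrightarrow> normed X \<and> Metric_space.mcomplete (pts X) (ndist X)"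

definition direct_sum :: "'a nspace \<Rightarrow> 'b nspace \<Rightarrow> ('a \<times> 'b) nspace" where
  "direct_sum X Y = \<lparr>pts = pts X \<times> pts Y, nrm = (\<lambda>(x, y). nrm X x + nrm Y y)\<rparr>"

definition linear_op :: "'a::real_vector nspace \<Rightarrow> 'b::real_vector nspace \<Rightarrow> ('a \<Rightarrow> 'b) \<Rightarrow> bool" where
  "linear_op X Y A \<longleftrightarrow> A ` pts X \<subseteq> pts Y \<and>
     (\<forall>x\<in>pts X. \<forall>y\<in>pts X. A (x + y) = A x + A y) \<and>
     (\<forall>x\<in>pts X. \<forall>c. A (c *\<^sub>R x) = c *\<^sub>R A x)"

definition bounded_op :: "'a::real_vector nspace \<Rightarrow> 'b::real_vector nspace \<Rightarrow> ('a \<Rightarrow> 'b) \<Rightarrow> bool" where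
  "bounded_op X Y A \<longleftrightarrow> linear_op X Y A \<and> (\<exists>B. \<forall>x\<in>pts X. nrm Y (A x) \<le> B * nrm X x)"

text \<open>The space of bounded operators with the operator norm; operators are extended by zero
  outside of \<open>pts X\<close>, so that equal operators are equal functions.\<close>

definition op_space :: "'a::real_vector nspace \<Rightarrow> 'b::real_vector nspace \<Rightarrow> ('a \<Rightarrow> 'b) nspace" where
  "op_space X Y = \<lparr>pts = {A. bounded_op X Y A \<and> (\<forall>x. x \<notin> pts X \<longrightarrow> A x = 0)},
     nrm = (\<lambda>A. SUP x\<in>{x \<in> pts X. nrm X x \<le> 1}. nrm Y (A x))\<rparr>"

text \<open>\<open>A\<close> is a derivative of \<open>f\<close> at \<open>x\<close>, where the increments are measured in \<open>X\<close>, the values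
  in \<open>Y\<close>, and only increments \<open>h\<close> with \<open>x + h \<in> S\<close> are admitted.\<close>

definition has_fderiv :: "'a::real_vector nspace \<Rightarrow> 'b::real_vector nspace \<Rightarrow> 'a set
    \<Rightarrow> ('a \<Rightarrow> 'b) \<Rightarrow> 'a \<Rightarrow> ('a \<Rightarrow> 'b) \<Rightarrow> bool" where
  "has_fderiv X Y S f x A \<longleftrightarrow>
     (\<forall>\<epsilon>>0. \<exists>\<delta>>0. \<forall>h\<in>pts X. 0 < nrm X h \<and> nrm X h < \<delta> \<and> x + h \<in> S \<longrightarrow>
        nrm Y (f (x + h) - f x - A h) / nrm X h < \<epsilon>)"

text \<open>Transport of a normed space along an injective linear map \<open>e\<close> with left inverse \<open>p\<close>.\<close>

definition push :: "('a \<Rightarrow> 'b) \<Rightarrow> ('b \<Rightarrow> 'a) \<Rightarrow> 'a nspace \<Rightarrow> 'b nspace" where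
  "push e p X = \<lparr>pts = e ` pts X, nrm = (\<lambda>v. nrm X (p v))\<rparr>"


section \<open>Maps of class $C^k$\<close>

text \<open>A map from \<open>U \<subseteq> X\<close> to \<open>Y\<close> is of class $C^{k+1}$ if it has a derivative at every point of
  \<open>U\<close> and the derivative, a map from \<open>U\<close> to \<open>op_space X Y\<close>, is of class $C^k$. As \<open>U\<close> may
  be a relatively open subset of a partial quadrant, difference quotients are taken inside \<open>U\<close>.

  This recursion changes the type of the target. It is therefore carried out for targets
  inside a type of the form \<open>(nat \<Rightarrow> 'a) \<Rightarrow> 'b\<close>, which is isomorphic to
  \<open>'a \<Rightarrow> (nat \<Rightarrow> 'a) \<Rightarrow> 'b\<close> by uncurrying; a point \<open>y\<close> is encoded by the constant function.
  The lemmas \<open>C_class_0\<close> and \<open>C_class_Suc\<close> below state the recursion without the encoding.\<close>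

definition uncur :: "('a \<Rightarrow> (nat \<Rightarrow> 'a) \<Rightarrow> 'b) \<Rightarrow> (nat \<Rightarrow> 'a) \<Rightarrow> 'b" where
  "uncur A s = A (s 0) (\<lambda>n. s (Suc n))"

definition cur :: "((nat \<Rightarrow> 'a) \<Rightarrow> 'b) \<Rightarrow> 'a \<Rightarrow> (nat \<Rightarrow> 'a) \<Rightarrow> 'b" where
  "cur B h s = B (case_nat h s)"

definition cst :: "'b \<Rightarrow> (nat \<Rightarrow> 'a) \<Rightarrow> 'b" where
  "cst y s = y"

definition uncst :: "((nat \<Rightarrow> 'a::zero) \<Rightarrow> 'b) \<Rightarrow> 'b" where
  "uncst B = B (\<lambda>_. 0)"

primrec C_class_enc :: "nat \<Rightarrow> 'a::real_vector nspace \<Rightarrow> 'a set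
    \<Rightarrow> ((nat \<Rightarrow> 'a) \<Rightarrow> 'b::real_vector) nspace \<Rightarrow> ('a \<Rightarrow> (nat \<Rightarrow> 'a) \<Rightarrow> 'b) \<Rightarrow> bool" where
  "C_class_enc 0 X U Y f \<longleftrightarrow> continuous_map (subtopology (ntop X) U) (ntop Y) f"
| "C_class_enc (Suc k) X U Y f \<longleftrightarrow> f ` U \<subseteq> pts Y \<and>
     (\<exists>D. (\<forall>x\<in>U. D x \<in> pts (op_space X Y) \<and> has_fderiv X Y U f x (D x)) \<and>
          C_class_enc k X U (push uncur cur (op_space X Y)) (uncur \<circ> D))"

definition C_class :: "nat \<Rightarrow> 'a::real_vector nspace \<Rightarrow> 'a set \<Rightarrow> 'b::real_vector nspace
    \<Rightarrow> ('a \<Rightarrow> 'b) \<Rightarrow> bool" where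
  "C_class k X U Y f \<longleftrightarrow> C_class_enc k X U (push cst uncst Y) (cst \<circ> f)"


section \<open>Sc-Banach spaces and partial quadrants\<close>

type_synonym 'a scspace = "nat \<Rightarrow> 'a nspace"

definition sc_banach :: "'a::real_vector scspace \<Rightarrow> bool" where
  "sc_banach E \<longleftrightarrow> (\<forall>m. banach_space (E m)) \<and>
     (\<forall>m. pts (E (Suc m)) \<subseteq> pts (E m)) \<and>
     (\<forall>m B. B \<subseteq> pts (E (Suc m)) \<and> (\<exists>c. \<forall>x\<in>B. nrm (E (Suc m)) x \<le> c)
        \<longrightarrow> compactin (ntop (E m)) (ntop (E m) closure_of B)) \<and>
     (\<forall>m. ntop (E m) closure_of (\<Inter>j. pts (E j)) = pts (E m))"

definition sc_sum :: "'a scspace \<Rightarrow> 'b scspace \<Rightarrow> ('a \<times> 'b) scspace" where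
  "sc_sum E F m = direct_sum (E m) (F m)"

definition sc_operator :: "'a::real_vector scspace \<Rightarrow> 'b::real_vector scspace \<Rightarrow> ('a \<Rightarrow> 'b) \<Rightarrow> bool" where
  "sc_operator E F T \<longleftrightarrow> linear_op (E 0) (F 0) T \<and> (\<forall>m. continuous_map (ntop (E m)) (ntop (F m)) T)"

definition sc_iso :: "'a::real_vector scspace \<Rightarrow> 'b::real_vector scspace \<Rightarrow> ('a \<Rightarrow> 'b) \<Rightarrow> bool" where
  "sc_iso E F T \<longleftrightarrow> sc_operator E F T \<and> bij_betw T (pts (E 0)) (pts (F 0)) \<and>
     sc_operator F E (the_inv_into (pts (E 0)) T)"

definition euclid :: "nat \<Rightarrow> (nat \<Rightarrow> real) scspace" where
  "euclid n m = \<lparr>pts = {a. \<forall>i\<ge>n. a i = 0}, nrm = (\<lambda>a. L2_set a {..<n})\<rparr>"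

text \<open>The type \<open>'w\<close> hosts the complement \<open>W\<close>; it is a parameter because one cannot
  quantify over types inside a definition.\<close>

definition partial_quadrant :: "'w::real_vector itself \<Rightarrow> 'a::real_vector scspace \<Rightarrow> 'a set \<Rightarrow> bool" where
  "partial_quadrant _ E C \<longleftrightarrow> closedin (ntop (E 0)) C \<and>
     (\<exists>(W :: 'w scspace) n T. sc_banach W \<and> sc_iso E (sc_sum (euclid n) W) T \<and>
        T ` C = {a \<in> pts (euclid n 0). \<forall>i<n. 0 \<le> a i} \<times> pts (W 0))"


section \<open>Maps of class sc$^k$\<close>

text \<open>For a subset \<open>U\<close> of \<open>E 0\<close>, the level \<open>U\<^sub>m\<close> is the space
  \<open>subtopology (ntop (E m)) U\<close>, whose underlying set is \<open>pts (E m) \<inter> U\<close>.\<close>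

definition sc0 :: "'a::real_vector scspace \<Rightarrow> 'a set \<Rightarrow> 'b::real_vector scspace \<Rightarrow> 'b set
    \<Rightarrow> ('a \<Rightarrow> 'b) \<Rightarrow> bool" where
  "sc0 E U F V f \<longleftrightarrow>
     (\<forall>m. continuous_map (subtopology (ntop (E m)) U) (subtopology (ntop (F m)) V) f)"

definition tangent_space :: "'a scspace \<Rightarrow> ('a \<times> 'a) scspace" where
  "tangent_space E = sc_sum (\<lambda>m. E (Suc m)) E"

definition tangent_set :: "'a scspace \<Rightarrow> 'a set \<Rightarrow> ('a \<times> 'a) set" where
  "tangent_set E U = (U \<inter> pts (E 1)) \<times> pts (E 0)"

definition tangent_map :: "('a \<Rightarrow> 'b) \<Rightarrow> ('a \<Rightarrow> 'a \<Rightarrow> 'b) \<Rightarrow> 'a \<times> 'a \<Rightarrow> 'b \<times> 'b" where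
  "tangent_map f D = (\<lambda>(x, h). (f x, D x h))"

text \<open>The increments \<open>h\<close> in the difference quotient satisfy \<open>x + h \<in> U\<close>, the domain of \<open>f\<close>.
  If \<open>U\<close> is relatively open in a partial quadrant \<open>C\<close>, this is the same as requiring \<open>x + h \<in> C\<close>
  for a map \<open>f\<close> whose values outside of \<open>U\<close> are arbitrary; see \<open>has_fderiv_quadrant\<close> below.\<close>

definition sc_derivative :: "'a::real_vector scspace \<Rightarrow> 'a set \<Rightarrow> 'b::real_vector scspace
    \<Rightarrow> ('a \<Rightarrow> 'b) \<Rightarrow> ('a \<Rightarrow> 'a \<Rightarrow> 'b) \<Rightarrow> bool" where
  "sc_derivative E U F f D \<longleftrightarrow>
     (\<forall>x\<in>U \<inter> pts (E 1). bounded_op (E 0) (F 0) (D x) \<and> has_fderiv (E 1) (F 0) U f x (D x))"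

text \<open>A map is sc$^{k+1}$ if it is sc$^1$ and its tangent map is sc$^k$. This recursion changes
  the types of domain and target from \<open>'a\<close> to \<open>'a \<times> 'a\<close>. It is therefore carried out for
  types of the form \<open>nat \<Rightarrow> 'a\<close>, where pairs are encoded by interleaving and a point \<open>x\<close>
  by the sequence \<open>x, 0, 0, \<dots>\<close>. The lemmas \<open>sc_class_0\<close> and \<open>sc_class_Suc\<close> below state the
  recursion without the encoding.\<close>

definition join :: "(nat \<Rightarrow> 'a) \<times> (nat \<Rightarrow> 'a) \<Rightarrow> nat \<Rightarrow> 'a" where
  "join v n = (if even n then fst v (n div 2) else snd v (n div 2))"

definition unjoin :: "(nat \<Rightarrow> 'a) \<Rightarrow> (nat \<Rightarrow> 'a) \<times> (nat \<Rightarrow> 'a)" where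
  "unjoin s = (\<lambda>n. s (2 * n), \<lambda>n. s (2 * n + 1))"

definition leaf :: "'a::zero \<Rightarrow> nat \<Rightarrow> 'a" where
  "leaf x n = (if n = 0 then x else 0)"

definition unleaf :: "(nat \<Rightarrow> 'a) \<Rightarrow> 'a" where
  "unleaf s = s 0"

primrec sc_class_enc :: "nat \<Rightarrow> (nat \<Rightarrow> 'a::real_vector) scspace \<Rightarrow> (nat \<Rightarrow> 'a) set
    \<Rightarrow> (nat \<Rightarrow> 'b::real_vector) scspace \<Rightarrow> (nat \<Rightarrow> 'b) set \<Rightarrow> ((nat \<Rightarrow> 'a) \<Rightarrow> nat \<Rightarrow> 'b) \<Rightarrow> bool" where
  "sc_class_enc 0 E U F V f \<longleftrightarrow> sc0 E U F V f"
| "sc_class_enc (Suc k) E U F V f \<longleftrightarrow> sc0 E U F V f \<and>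
     (\<exists>D. sc_derivative E U F f D \<and>
          sc0 (tangent_space E) (tangent_set E U) (tangent_space F) (tangent_set F V) (tangent_map f D) \<and>
          sc_class_enc k
            (push join unjoin \<circ> tangent_space E) (join ` tangent_set E U)
            (push join unjoin \<circ> tangent_space F) (join ` tangent_set F V)
            (join \<circ> tangent_map f D \<circ> unjoin))"

definition sc_class :: "nat \<Rightarrow> 'a::real_vector scspace \<Rightarrow> 'a set \<Rightarrow> 'b::real_vector scspace \<Rightarrow> 'b set
    \<Rightarrow> ('a \<Rightarrow> 'b) \<Rightarrow> bool" where
  "sc_class k E U F V f \<longleftrightarrow>
     sc_class_enc k (push leaf unleaf \<circ> E) (leaf ` U) (push leaf unleaf \<circ> F) (leaf ` V)
       (leaf \<circ> f \<circ> unleaf)"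


section \<open>Increments in the quadrant, and the recursions without the encodings\<close>

lemma normedD:
  assumes "normed X"
  shows "subspace (pts X)" "x \<in> pts X \<Longrightarrow> 0 \<le> nrm X x" "x \<in> pts X \<Longrightarrow> nrm X x = 0 \<longleftrightarrow> x = 0"
    "x \<in> pts X \<Longrightarrow> nrm X (c *\<^sub>R x) = \<bar>c\<bar> * nrm X x"
    "x \<in> pts X \<Longrightarrow> y \<in> pts X \<Longrightarrow> nrm X (x + y) \<le> nrm X x + nrm X y"
    "0 \<in> pts X" "x \<in> pts X \<Longrightarrow> y \<in> pts X \<Longrightarrow> x + y \<in> pts X"
    "x \<in> pts X \<Longrightarrow> c *\<^sub>R x \<in> pts X" "x \<in> pts X \<Longrightarrow> y \<in> pts X \<Longrightarrow> x - y \<in> pts X"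
  using assms by (auto simp: normed_def subspace_0 subspace_add subspace_scale subspace_diff)

lemma nrm_minus_commute:
  assumes "normed X" "x \<in> pts X" "y \<in> pts X"
  shows "nrm X (x - y) = nrm X (y - x)"
proof -
  have "nrm X ((-1) *\<^sub>R (y - x)) = nrm X (y - x)"
    using normedD(4,9)[OF assms(1)] assms by (metis abs_minus_cancel abs_one mult_1)
  then show ?thesis by simp
qed

lemma Metric_space_ntop:
  assumes "normed X" shows "Metric_space (pts X) (ndist X)"
proof
  note N = normedD[OF assms]
  show "0 \<le> ndist X x y" for x y by (simp add: ndist_def N)
  show "ndist X x y = ndist X y x" for x y by (simp add: ndist_def nrm_minus_commute[OF assms])
  show "ndist X x y = 0 \<longleftrightarrow> x = y" if "x \<in> pts X" "y \<in> pts X" for x y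
    using that by (simp add: ndist_def N)
  show "ndist X x z \<le> ndist X x y + ndist X y z"
    if "x \<in> pts X" "y \<in> pts X" "z \<in> pts X" for x y z
    using that N(5)[of "x - y" "y - z"] by (simp add: ndist_def N)
qed

lemma openin_ntop:
  assumes "normed X"
  shows "openin (ntop X) S \<longleftrightarrow> S \<subseteq> pts X \<and> (\<forall>x\<in>S. \<exists>r>0. \<forall>y\<in>pts X. nrm X (x - y) < r \<longrightarrow> y \<in> S)"
proof -
  interpret Metric_space "pts X" "ndist X" by (rule Metric_space_ntop[OF assms])
  have *: "mball x r \<subseteq> S \<longleftrightarrow> (\<forall>y\<in>pts X. nrm X (x - y) < r \<longrightarrow> y \<in> S)" if "x \<in> pts X" for x r
    using that by (auto simp: ndist_def)
  show ?thesis
    unfolding ntop_def openin_mtopology using * by (smt (verit) subsetD)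
qed

lemma topspace_ntop [simp]:
  assumes "normed X" shows "topspace (ntop X) = pts X"
  unfolding ntop_def by (rule Metric_space.topspace_mtopology[OF Metric_space_ntop[OF assms]])

lemma sc_banach_normed: "sc_banach E \<Longrightarrow> normed (E m)"
  by (simp add: sc_banach_def banach_space_def)

lemma nrm_incl_bound:
  assumes E: "sc_banach E"
  shows "\<exists>c>0. \<forall>x\<in>pts (E (Suc m)). nrm (E m) x \<le> c * nrm (E (Suc m)) x"
proof -
  note N = normedD[OF sc_banach_normed[OF E]]
  interpret Metric_space "pts (E m)" "ndist (E m)" by (rule Metric_space_ntop[OF sc_banach_normed[OF E]])
  let ?B = "{x \<in> pts (E (Suc m)). nrm (E (Suc m)) x \<le> 1}"
  have sub: "pts (E (Suc m)) \<subseteq> pts (E m)" using E by (simp add: sc_banach_def)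
  have "compactin (ntop (E m)) (ntop (E m) closure_of ?B)"
  proof -
    have "\<forall>m B. B \<subseteq> pts (E (Suc m)) \<and> (\<exists>c. \<forall>x\<in>B. nrm (E (Suc m)) x \<le> c)
        \<longrightarrow> compactin (ntop (E m)) (ntop (E m) closure_of B)"
      using E unfolding sc_banach_def by blast
    moreover have "?B \<subseteq> pts (E (Suc m))" "\<exists>c. \<forall>x\<in>?B. nrm (E (Suc m)) x \<le> c" by auto
    ultimately show ?thesis by blast
  qed
  then have "mbounded (mtopology closure_of ?B)" unfolding ntop_def by (rule compactin_imp_mbounded)
  moreover have "?B \<subseteq> mtopology closure_of ?B" using sub by (intro closure_of_subset) auto
  ultimately have "mbounded ?B" by (rule mbounded_subset)
  then obtain a b where ab: "?B \<subseteq> mcball a b" unfolding mbounded_def by blast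
  have "0 \<in> ?B" using N(6)[of "Suc m"] N(3)[of 0 "Suc m"] by simp
  with ab have a: "a \<in> pts (E m)" by auto
  have bd: "nrm (E m) x \<le> b + nrm (E m) a" if "x \<in> ?B" for x
  proof -
    have "x \<in> mcball a b" using ab that by blast
    then have x: "x \<in> pts (E m)" "nrm (E m) (a - x) \<le> b" by (auto simp: ndist_def)
    have "nrm (E m) x \<le> nrm (E m) (x - a) + nrm (E m) a"
      using N(5)[of "x - a" m a] x a by (simp add: N)
    then show ?thesis using x a nrm_minus_commute[OF sc_banach_normed[OF E], of x m a] by simp
  qed
  define c where "c = \<bar>b + nrm (E m) a\<bar> + 1"
  have "nrm (E m) x \<le> c * nrm (E (Suc m)) x" if x: "x \<in> pts (E (Suc m))" for x
  proof (cases "x = 0")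
    case True
    then show ?thesis using N(3)[of 0 m] N(3)[of 0 "Suc m"] N(6) by simp
  next
    case False
    then have p: "nrm (E (Suc m)) x > 0" using N(2,3)[OF x] by linarith
    let ?y = "(1 / nrm (E (Suc m)) x) *\<^sub>R x"
    have "?y \<in> ?B" using p x by (simp add: N)
    then have "nrm (E m) ?y \<le> c" using bd unfolding c_def by fastforce
    moreover have "nrm (E m) ?y = nrm (E m) x / nrm (E (Suc m)) x"
      using p x sub by (subst N(4)) auto
    ultimately show ?thesis using p by (simp add: divide_simps)
  qed
  then show ?thesis by (intro exI[of _ c]) (auto simp: c_def)
qed

lemma has_fderiv_quadrant:
  assumes E: "sc_banach E" and U: "openin (subtopology (ntop (E 0)) C) U" and x: "x \<in> U \<inter> pts (E 1)"
  shows "has_fderiv (E 1) (F 0) U f x A \<longleftrightarrow> has_fderiv (E 1) (F 0) C f x A"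
proof -
  note N = normedD[OF sc_banach_normed[OF E]]
  have sub: "pts (E 1) \<subseteq> pts (E 0)" using E by (simp add: sc_banach_def)
  obtain S where S: "openin (ntop (E 0)) S" "U = S \<inter> C" using U by (auto simp: openin_subtopology)
  then obtain r where r: "r > 0" "\<And>y. y \<in> pts (E 0) \<Longrightarrow> nrm (E 0) (x - y) < r \<Longrightarrow> y \<in> S"
    using x unfolding openin_ntop[OF sc_banach_normed[OF E]] by blast
  obtain c where c: "c > 0" "\<And>x. x \<in> pts (E 1) \<Longrightarrow> nrm (E 0) x \<le> c * nrm (E 1) x"
    using nrm_incl_bound[OF E, of 0] by auto
  have key: "x + h \<in> U \<longleftrightarrow> x + h \<in> C" if h: "h \<in> pts (E 1)" "nrm (E 1) h < r / c" for h
  proof -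
    have "nrm (E 0) (x - (x + h)) = nrm (E 0) h"
      using nrm_minus_commute[OF sc_banach_normed[OF E], of x 0 "x + h"] x h sub N(7) by auto
    also have "\<dots> < r" using c(2)[OF h(1)] h(2) c(1) by (simp add: field_simps)
    finally have "x + h \<in> S" using r(2)[of "x + h"] x h sub N(7) by auto
    then show ?thesis using S by simp
  qed
  have mono: "has_fderiv (E 1) (F 0) T f x A" if T: "has_fderiv (E 1) (F 0) T' f x A"
    and T2: "\<And>h. h \<in> pts (E 1) \<Longrightarrow> nrm (E 1) h < r / c \<Longrightarrow> x + h \<in> T \<Longrightarrow> x + h \<in> T'" for T T'
    unfolding has_fderiv_def
  proof (intro allI impI)
    fix \<epsilon> :: real assume "\<epsilon> > 0"
    then obtain \<delta> where \<delta>: "\<delta> > 0" "\<forall>h\<in>pts (E 1). 0 < nrm (E 1) h \<and> nrm (E 1) h < \<delta> \<and> x + h \<in> T' \<longrightarrow>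
        nrm (F 0) (f (x + h) - f x - A h) / nrm (E 1) h < \<epsilon>"
      using T[unfolded has_fderiv_def, THEN spec, THEN mp] by blast
    show "\<exists>\<delta>>0. \<forall>h\<in>pts (E 1). 0 < nrm (E 1) h \<and> nrm (E 1) h < \<delta> \<and> x + h \<in> T \<longrightarrow>
        nrm (F 0) (f (x + h) - f x - A h) / nrm (E 1) h < \<epsilon>"
    proof (intro exI conjI ballI impI)
      show "0 < min \<delta> (r / c)" using \<delta>(1) r(1) c(1) by simp
      fix h assume h: "h \<in> pts (E 1)" "0 < nrm (E 1) h \<and> nrm (E 1) h < min \<delta> (r / c) \<and> x + h \<in> T"
      then have "x + h \<in> T'" using T2[of h] by simp
      then show "nrm (F 0) (f (x + h) - f x - A h) / nrm (E 1) h < \<epsilon>" using \<delta>(2) h by simp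
    qed
  qed
  show ?thesis
  proof
    assume "has_fderiv (E 1) (F 0) U f x A"
    then show "has_fderiv (E 1) (F 0) C f x A" by (rule mono) (rule key[THEN iffD2])
  next
    assume "has_fderiv (E 1) (F 0) C f x A"
    then show "has_fderiv (E 1) (F 0) U f x A" by (rule mono) (rule key[THEN iffD1])
  qed
qed

lemma normed_direct_sum:
  assumes "normed X" "normed Y" shows "normed (direct_sum X Y)"
proof -
  note N = normedD[OF assms(1)] and M = normedD[OF assms(2)]
  show ?thesis
    unfolding normed_def
  proof (intro conjI ballI allI)
    show "subspace (pts (direct_sum X Y))" using subspace_Times[OF N(1) M(1)] by (simp add: direct_sum_def)
    fix x assume x: "x \<in> pts (direct_sum X Y)"
    then have x': "fst x \<in> pts X" "snd x \<in> pts Y" by (auto simp: direct_sum_def)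
    note n = N(2)[OF x'(1)] N(3)[OF x'(1)] M(2)[OF x'(2)] M(3)[OF x'(2)]
    show "0 \<le> nrm (direct_sum X Y) x" using n by (simp add: direct_sum_def case_prod_beta)
    show "(nrm (direct_sum X Y) x = 0) \<longleftrightarrow> x = 0"
      using n by (simp add: direct_sum_def case_prod_beta prod_eq_iff add_nonneg_eq_0_iff)
    show "nrm (direct_sum X Y) (c *\<^sub>R x) = \<bar>c\<bar> * nrm (direct_sum X Y) x" for c
      using N(4)[OF x'(1)] M(4)[OF x'(2)] by (simp add: direct_sum_def case_prod_beta distrib_left)
    fix y assume "y \<in> pts (direct_sum X Y)"
    then have y': "fst y \<in> pts X" "snd y \<in> pts Y" by (auto simp: direct_sum_def)
    show "nrm (direct_sum X Y) (x + y) \<le> nrm (direct_sum X Y) x + nrm (direct_sum X Y) y"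
      using N(5)[OF x'(1) y'(1)] M(5)[OF x'(2) y'(2)] by (simp add: direct_sum_def case_prod_beta)
  qed
qed

lemma normed_op_space:
  assumes X: "normed X" and Y: "normed Y" shows "normed (op_space X Y)"
proof -
  note N = normedD[OF X] and M = normedD[OF Y]
  let ?B = "{x \<in> pts X. nrm X x \<le> 1}" and ?Z = "op_space X Y"
  have ne: "?B \<noteq> {}" using N(6) N(3)[of 0] by force
  have lin: "A x \<in> pts Y" "A (c *\<^sub>R x) = c *\<^sub>R A x" if "A \<in> pts ?Z" "x \<in> pts X" for A x c
    using that by (auto simp: op_space_def bounded_op_def linear_op_def)
  have bdd: "bdd_above ((\<lambda>x. nrm Y (A x)) ` ?B)" if A: "A \<in> pts ?Z" for A
  proof -
    obtain b where b: "\<And>x. x \<in> pts X \<Longrightarrow> nrm Y (A x) \<le> b * nrm X x"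
      using A by (auto simp: op_space_def bounded_op_def)
    have "nrm Y (A x) \<le> \<bar>b\<bar>" if "x \<in> ?B" for x
    proof -
      have "nrm Y (A x) \<le> b * nrm X x" using b that by simp
      also have "\<dots> \<le> \<bar>b\<bar> * nrm X x" using that N(2) by (intro mult_right_mono) auto
      also have "\<dots> \<le> \<bar>b\<bar> * 1" using that by (intro mult_left_mono) auto
      finally show ?thesis by simp
    qed
    then show ?thesis by (auto intro!: bdd_aboveI)
  qed
  have up: "nrm Y (A x) \<le> nrm ?Z A" if "A \<in> pts ?Z" "x \<in> ?B" for A x
    using cSUP_upper[OF that(2) bdd[OF that(1)]] by (simp add: op_space_def)
  have le: "nrm ?Z A \<le> b" if "\<And>x. x \<in> ?B \<Longrightarrow> nrm Y (A x) \<le> b" for A b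
    using cSUP_least[OF ne, of "\<lambda>x. nrm Y (A x)" b] that by (simp add: op_space_def)
  have pos: "0 \<le> nrm ?Z A" if A: "A \<in> pts ?Z" for A
  proof -
    obtain x where "x \<in> ?B" using ne by blast
    then show ?thesis using up[OF A, of x] M(2)[OF lin(1)[OF A, of x]] by force
  qed
  have sc: "c *\<^sub>R A \<in> pts ?Z" if A: "A \<in> pts ?Z" for A c
  proof -
    obtain b where b: "\<And>x. x \<in> pts X \<Longrightarrow> nrm Y (A x) \<le> b * nrm X x"
      using A by (auto simp: op_space_def bounded_op_def)
    have "nrm Y (c *\<^sub>R A x) \<le> (\<bar>c\<bar> * b) * nrm X x" if "x \<in> pts X" for x
      using mult_left_mono[OF b[OF that], of "\<bar>c\<bar>"] M(4)[OF lin(1)[OF A that]] by (simp add: mult.assoc)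
    then show ?thesis using A M(8) unfolding op_space_def bounded_op_def linear_op_def
      by (auto simp: scaleR_add_right scaleR_left_commute)
  qed
  have ad: "A + B \<in> pts ?Z" if A: "A \<in> pts ?Z" and B: "B \<in> pts ?Z" for A B
  proof -
    obtain a b where ab: "\<And>x. x \<in> pts X \<Longrightarrow> nrm Y (A x) \<le> a * nrm X x" "\<And>x. x \<in> pts X \<Longrightarrow> nrm Y (B x) \<le> b * nrm X x"
      using A B by (fastforce simp: op_space_def bounded_op_def)
    have "nrm Y (A x + B x) \<le> (a + b) * nrm X x" if "x \<in> pts X" for x
      using ab[OF that] M(5)[OF lin(1)[OF A that] lin(1)[OF B that]] by (simp add: algebra_simps)
    then have "\<exists>b. \<forall>x\<in>pts X. nrm Y ((A + B) x) \<le> b * nrm X x" by auto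
    moreover have "linear_op X Y (A + B)"
      using A B M(7) by (simp add: op_space_def bounded_op_def linear_op_def scaleR_add_right image_subset_iff)
    ultimately show ?thesis using A B by (simp add: op_space_def bounded_op_def)
  qed
  have z: "0 \<in> pts ?Z"
    using M(3)[of 0] M(6) by (auto simp: op_space_def bounded_op_def linear_op_def intro!: exI[of _ 0])
  have nz: "nrm ?Z (0 :: 'a \<Rightarrow> 'b) = 0"
    using le[of 0 0] pos[OF z] M(3)[of 0] M(6) by simp
  have zero: "A = 0" if A: "A \<in> pts ?Z" and 0: "nrm ?Z A = 0" for A
  proof
    fix x
    show "A x = 0 x"
    proof (cases "x \<in> pts X \<and> x \<noteq> 0")
      case True
      then have p: "nrm X x > 0" using N(2)[of x] N(3)[of x] by simp
      let ?y = "(1 / nrm X x) *\<^sub>R x"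
      have "?y \<in> ?B" using p True by (simp add: N)
      then have "nrm Y (A ?y) = 0" using up[OF A, of ?y] 0 M(2)[of "A ?y"] lin(1)[OF A] by force
      then have "A ?y = 0" using M(3) lin(1)[OF A] N(8) True by blast
      then show ?thesis using lin(2)[OF A] True p by simp
    next
      case False
      have "A (0 *\<^sub>R 0) = 0 *\<^sub>R A 0" using lin(2)[OF A N(6)] .
      then show ?thesis using A False by (auto simp: op_space_def)
    qed
  qed
  have scle: "nrm ?Z (c *\<^sub>R A) \<le> \<bar>c\<bar> * nrm ?Z A" if A: "A \<in> pts ?Z" for A c
    using up[OF A] lin(1)[OF A] M(4) by (intro le) (simp add: mult_left_mono)
  have sceq: "nrm ?Z (c *\<^sub>R A) = \<bar>c\<bar> * nrm ?Z A" if A: "A \<in> pts ?Z" for A c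
  proof (cases "c = 0")
    case True
    then show ?thesis using nz by simp
  next
    case False
    have "nrm ?Z A \<le> \<bar>1 / c\<bar> * nrm ?Z (c *\<^sub>R A)"
      using scle[OF sc[OF A], of "1 / c" c] False by simp
    then have "\<bar>c\<bar> * nrm ?Z A \<le> nrm ?Z (c *\<^sub>R A)" using False by (simp add: field_simps)
    then show ?thesis using scle[OF A, of c] by simp
  qed
  have tri: "nrm ?Z (A + B) \<le> nrm ?Z A + nrm ?Z B" if A: "A \<in> pts ?Z" and B: "B \<in> pts ?Z" for A B
  proof (rule le)
    fix x assume x: "x \<in> ?B"
    have "nrm Y ((A + B) x) \<le> nrm Y (A x) + nrm Y (B x)" using M(5) lin(1)[OF A] lin(1)[OF B] x by simp
    also have "\<dots> \<le> nrm ?Z A + nrm ?Z B" using up[OF A x] up[OF B x] by simp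
    finally show "nrm Y ((A + B) x) \<le> nrm ?Z A + nrm ?Z B" .
  qed
  show ?thesis
    unfolding normed_def
  proof (intro conjI ballI allI)
    show "subspace (pts ?Z)" using z ad sc by (intro subspaceI)
    show "(nrm ?Z A = 0) \<longleftrightarrow> A = 0" if "A \<in> pts ?Z" for A using zero[OF that] nz by blast
  qed (simp_all only: pos sceq tri)
qed

definition embedding :: "('a::real_vector \<Rightarrow> 'b::real_vector) \<Rightarrow> ('b \<Rightarrow> 'a) \<Rightarrow> bool" where
  "embedding e p \<longleftrightarrow> linear e \<and> (\<forall>x. p (e x) = x)"

lemma embeddingD:
  assumes "embedding e p"
  shows "p (e x) = x" "e (x + y) = e x + e y" "e (x - y) = e x - e y" "e (c *\<^sub>R x) = c *\<^sub>R e x" "e 0 = 0"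
    "e x = e y \<longleftrightarrow> x = y" "linear e"
proof -
  have l: "linear e" and p: "p (e z) = z" for z using assms by (auto simp: embedding_def)
  show "p (e x) = x" "linear e" by fact+
  show "e (x + y) = e x + e y" "e (x - y) = e x - e y" "e (c *\<^sub>R x) = c *\<^sub>R e x" "e 0 = 0"
    using l by (rule linear_add, rule linear_diff, rule linear_scale, rule linear_0)
  show "e x = e y \<longleftrightarrow> x = y" using p by metis
qed

lemma pts_push [simp]: "pts (push e p X) = e ` pts X" and nrm_push [simp]: "nrm (push e p X) = (\<lambda>v. nrm X (p v))"
  by (simp_all add: push_def)

lemma normed_push:
  assumes e: "embedding e p" and X: "normed X" shows "normed (push e p X)"
proof -
  note N = normedD[OF X] and P = embeddingD[OF e]
  have z: "e x = 0 \<longleftrightarrow> x = 0" for x using P(5,6) by metis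
  show ?thesis
    unfolding normed_def using linear_subspace_image[OF P(7) N(1)] N(2-5)
    by (simp add: P(1) z flip: P(2) P(4))
qed

lemma homeo_push:
  assumes e: "embedding e p" and X: "normed X"
  shows "homeomorphic_maps (ntop X) (ntop (push e p X)) e p"
proof -
  note P = embeddingD[OF e]
  note N = openin_ntop[OF X] openin_ntop[OF normed_push[OF e X]]
  have 1: "openin (ntop X) {x \<in> pts X. e x \<in> S}" if "openin (ntop (push e p X)) S" for S
    unfolding N(1)
  proof (intro conjI ballI)
    fix x assume "x \<in> {x \<in> pts X. e x \<in> S}"
    then have x: "e x \<in> S" by simp
    have "\<forall>z\<in>S. \<exists>r>0. \<forall>y\<in>pts X. nrm X (p (z - e y)) < r \<longrightarrow> e y \<in> S"
      using that unfolding N(2) by simp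
    from bspec[OF this x] obtain r where "r > 0" "\<forall>y\<in>pts X. nrm X (x - y) < r \<longrightarrow> e y \<in> S"
      unfolding P(3)[symmetric] P(1) by blast
    then show "\<exists>r>0. \<forall>y\<in>pts X. nrm X (x - y) < r \<longrightarrow> y \<in> {x \<in> pts X. e x \<in> S}" by auto
  qed auto
  have 2: "openin (ntop (push e p X)) {x \<in> e ` pts X. p x \<in> S}" if "openin (ntop X) S" for S
    using that unfolding N by (auto simp: P(1) simp flip: P(3))
  have "continuous_map (ntop X) (ntop (push e p X)) e"
    unfolding continuous_map_def using X normed_push[OF e X] 1 by auto
  moreover have "continuous_map (ntop (push e p X)) (ntop X) p"
    unfolding continuous_map_def using X normed_push[OF e X] 2 by (auto simp: P(1))
  ultimately show ?thesis
    using X normed_push[OF e X] by (auto simp: homeomorphic_maps_def P(1))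
qed

lemma continuous_push:
  assumes e: "embedding e p" "embedding e' p'" and X: "normed X" "normed Y"
  shows "continuous_map (subtopology (ntop (push e p X)) (e ` U)) (subtopology (ntop (push e' p' Y)) (e' ` V)) (e' \<circ> f \<circ> p)
    \<longleftrightarrow> continuous_map (subtopology (ntop X) U) (subtopology (ntop Y) V) f" (is "?L \<longleftrightarrow> ?R")
proof -
  note P = embeddingD[OF e(1)] and Q = embeddingD[OF e(2)]
  have 1: "homeomorphic_maps (subtopology (ntop X) U) (subtopology (ntop (push e p X)) (e ` U)) e p"
    using homeo_push[OF e(1) X(1)] X normed_push[OF e(1) X(1)]
    by (intro homeomorphic_maps_subtopologies) (auto simp: P)
  have 2: "homeomorphic_maps (subtopology (ntop Y) V) (subtopology (ntop (push e' p' Y)) (e' ` V)) e' p'"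
    using homeo_push[OF e(2) X(2)] X normed_push[OF e(2) X(2)]
    by (intro homeomorphic_maps_subtopologies) (auto simp: Q)
  show ?thesis
  proof
    assume ?R
    then show ?L
      using 1 2 unfolding homeomorphic_maps_def by (meson continuous_map_compose)
  next
    assume ?L
    then have "continuous_map (subtopology (ntop X) U) (subtopology (ntop Y) V) (p' \<circ> ((e' \<circ> f \<circ> p) \<circ> e))"
      using 1 2 unfolding homeomorphic_maps_def by (meson continuous_map_compose)
    moreover have "p' \<circ> ((e' \<circ> f \<circ> p) \<circ> e) = f" by (auto simp: P(1) Q(1))
    ultimately show ?R by simp
  qed
qed


lemma push_push: "push e' p' (push e p X) = push (e' \<circ> e) (p \<circ> p') X"
  by (simp add: push_def image_comp o_def)

lemma bounded_op_push:
  assumes "embedding e p" "embedding e' p'"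
  shows "bounded_op (push e p X) (push e' p' Y) (\<lambda>w. e' (A (p w))) \<longleftrightarrow> bounded_op X Y A"
proof -
  note P = embeddingD[OF assms(1)] and Q = embeddingD[OF assms(2)]
  have *: "e' y \<in> e' ` T \<longleftrightarrow> y \<in> T" for y T using Q(6) by auto
  show ?thesis
    unfolding bounded_op_def linear_op_def image_subset_iff pts_push nrm_push ball_simps
      P(1) Q(1) * P(2)[symmetric] P(4)[symmetric] Q(2)[symmetric] Q(4)[symmetric] Q(6) ..
qed

lemma has_fderiv_push:
  assumes "embedding e p" "embedding e' p'"
  shows "has_fderiv (push e p X) (push e' p' Y) (e ` S) (e' \<circ> f \<circ> p) (e x) (\<lambda>w. e' (A (p w))) \<longleftrightarrow> has_fderiv X Y S f x A"
proof -
  note P = embeddingD[OF assms(1)] and Q = embeddingD[OF assms(2)]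
  have m: "e z \<in> e ` S \<longleftrightarrow> z \<in> S" for z using P(6) by auto
  show ?thesis
    unfolding has_fderiv_def pts_push nrm_push ball_simps o_apply
      P(2)[symmetric] P(1) Q(3)[symmetric] Q(1) m ..
qed

lemma has_fderiv_cong:
  assumes "\<And>y. y \<in> S \<Longrightarrow> f y = g y" "x \<in> S" "\<And>h. h \<in> pts X \<Longrightarrow> A h = B h"
  shows "has_fderiv X Y S f x A \<longleftrightarrow> has_fderiv X Y S g x B"
  unfolding has_fderiv_def using assms by (simp cong: conj_cong imp_cong)

lemma bounded_op_cong:
  assumes "normed X" "\<And>h. h \<in> pts X \<Longrightarrow> A h = B h"
  shows "bounded_op X Y A \<longleftrightarrow> bounded_op X Y B"
  unfolding bounded_op_def linear_op_def using assms(2) normedD(7,8)[OF assms(1)]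
  by (simp cong: ball_cong image_cong)

lemma continuous_map_subtopology_cong:
  assumes "\<And>x. x \<in> U \<Longrightarrow> f x = g x"
  shows "continuous_map (subtopology T U) T' f \<longleftrightarrow> continuous_map (subtopology T U) T' g"
  by (rule iffI; erule continuous_map_eq) (use assms in auto)

lemma C_class_enc_cong:
  assumes "\<And>x. x \<in> U \<Longrightarrow> f x = g x"
  shows "C_class_enc k X U Y f \<longleftrightarrow> C_class_enc k X U Y g"
proof (cases k)
  case 0
  then show ?thesis using continuous_map_subtopology_cong[OF assms] by simp
next
  case (Suc n)
  have "has_fderiv X Y U f x A \<longleftrightarrow> has_fderiv X Y U g x A" if "x \<in> U" for x A
    using has_fderiv_cong[of U f g x X A A Y] assms that by blast
  then show ?thesis using assms unfolding Suc by (simp cong: ball_cong image_cong)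
qed

lemma embedding_uncur: "embedding uncur cur"
  unfolding embedding_def by (auto simp: uncur_def cur_def fun_eq_iff intro!: linearI)

lemma cur_uncur [simp]: "cur (uncur A) = A" and uncur_cur [simp]: "uncur (cur B) = B"
proof -
  show "cur (uncur A) = A" by (simp add: cur_def uncur_def fun_eq_iff)
  have c: "case_nat (s 0) (\<lambda>n. s (Suc n)) = s" for s :: "nat \<Rightarrow> 'c"
    by (simp add: fun_eq_iff split: nat.split)
  show "uncur (cur B) = B" by (rule ext) (simp only: cur_def uncur_def c)
qed

lemma embedding_cst: "embedding cst uncst"
  unfolding embedding_def by (auto simp: cst_def uncst_def fun_eq_iff intro!: linearI)

lemma embedding_comp_left:
  assumes "embedding e p" shows "embedding (\<lambda>A. e \<circ> A) (\<lambda>B. p \<circ> B)"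
  using embeddingD[OF assms] unfolding embedding_def by (auto simp: fun_eq_iff intro!: linearI)

lemma embedding_lift_op:
  assumes "embedding e p"
  shows "embedding (\<lambda>B. uncur (e \<circ> cur B)) (\<lambda>B. uncur (p \<circ> cur B))"
  unfolding embedding_def
proof
  have c: "cur (A + B) h = cur A h + cur B h" "cur (c *\<^sub>R A) h = c *\<^sub>R cur A h"
    for A B :: "(nat \<Rightarrow> 'x) \<Rightarrow> 'y::real_vector" and c h
    by (simp_all add: cur_def fun_eq_iff)
  show "linear (\<lambda>B. uncur (e \<circ> cur B))"
    by (intro linearI; rule ext) (simp_all add: uncur_def embeddingD(2,4)[OF assms] c)
  have "p \<circ> e = id" by (simp add: fun_eq_iff embeddingD(1)[OF assms])
  then show "\<forall>B. uncur (p \<circ> cur (uncur (e \<circ> cur B))) = B"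
    by (simp only: cur_uncur uncur_cur o_assoc id_o simp_thms)
qed

lemma op_space_push:
  assumes e: "embedding e p"
  shows "op_space X (push e p Y) = push (\<lambda>A. e \<circ> A) (\<lambda>B. p \<circ> B) (op_space X Y)"
proof -
  note P = embeddingD[OF e]
  have id: "embedding id id" by (auto simp: embedding_def intro!: linearI)
  have X: "push id id X = X" by (simp add: push_def)
  have B: "bounded_op X (push e p Y) (e \<circ> A) \<longleftrightarrow> bounded_op X Y A" for A
    using bounded_op_push[OF id e, of X Y A] by (simp add: X o_def)
  have "B \<in> pts (op_space X (push e p Y)) \<longleftrightarrow> B \<in> (\<lambda>A. e \<circ> A) ` pts (op_space X Y)" for B
  proof
    assume L: "B \<in> pts (op_space X (push e p Y))"
    have "e (p (B x)) = B x" for x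
    proof (cases "x \<in> pts X")
      case True
      then have "B x \<in> e ` pts Y" using L by (auto simp: op_space_def bounded_op_def linear_op_def)
      then show ?thesis using P(1) by auto
    next
      case False
      then have "B x = 0" using L by (auto simp: op_space_def)
      then show ?thesis using P(1)[of 0] P(5) by simp
    qed
    then have eq: "B = e \<circ> (p \<circ> B)" by (simp add: fun_eq_iff)
    have "bounded_op X (push e p Y) (e \<circ> (p \<circ> B))" using L eq by (simp add: op_space_def)
    then have "bounded_op X Y (p \<circ> B)" by (simp only: B)
    moreover have "(p \<circ> B) x = 0" if "x \<notin> pts X" for x
      using L that P(1)[of 0] P(5) by (simp add: op_space_def)
    ultimately show "B \<in> (\<lambda>A. e \<circ> A) ` pts (op_space X Y)"
      using eq by (intro image_eqI[where x = "p \<circ> B"]) (auto simp: op_space_def)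
  next
    assume "B \<in> (\<lambda>A. e \<circ> A) ` pts (op_space X Y)"
    then show "B \<in> pts (op_space X (push e p Y))" using B P(5) by (auto simp: op_space_def)
  qed
  then have "pts (op_space X (push e p Y)) = (\<lambda>A. e \<circ> A) ` pts (op_space X Y)" by blast
  moreover have "nrm (op_space X (push e p Y)) = (\<lambda>B. nrm (op_space X Y) (p \<circ> B))"
    by (simp add: op_space_def)
  ultimately show ?thesis by (simp add: push_def)
qed

lemma continuous_push_right:
  assumes e: "embedding e p" and Y: "normed Y"
  shows "continuous_map T (ntop (push e p Y)) (e \<circ> f) \<longleftrightarrow> continuous_map T (ntop Y) f"
proof
  note H = homeo_push[OF e Y, unfolded homeomorphic_maps_def]
  assume "continuous_map T (ntop (push e p Y)) (e \<circ> f)"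
  then have "continuous_map T (ntop Y) (p \<circ> (e \<circ> f))" using H continuous_map_compose by blast
  moreover have "p \<circ> (e \<circ> f) = f" by (simp add: fun_eq_iff embeddingD(1)[OF e])
  ultimately show "continuous_map T (ntop Y) f" by simp
next
  note H = homeo_push[OF e Y, unfolded homeomorphic_maps_def]
  assume "continuous_map T (ntop Y) f"
  then show "continuous_map T (ntop (push e p Y)) (e \<circ> f)" using H continuous_map_compose by blast
qed

lemma has_fderiv_push_right:
  assumes e: "embedding e p"
  shows "has_fderiv X (push e p Y) S (e \<circ> f) x (e \<circ> A) \<longleftrightarrow> has_fderiv X Y S f x A"
  unfolding has_fderiv_def nrm_push o_apply embeddingD(3)[OF e, symmetric] embeddingD(1)[OF e] ..

lemma ex_derivative_push_right:
  assumes e: "embedding e p"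
    and Q: "\<And>D D'. (\<And>x. x \<in> U \<Longrightarrow> D x = D' x) \<Longrightarrow> Q D \<longleftrightarrow> Q D'"
  shows "(\<exists>D. (\<forall>x\<in>U. D x \<in> pts (op_space X (push e p Y)) \<and> has_fderiv X (push e p Y) U (e \<circ> f) x (D x)) \<and> Q D)
    \<longleftrightarrow> (\<exists>D. (\<forall>x\<in>U. D x \<in> pts (op_space X Y) \<and> has_fderiv X Y U f x (D x)) \<and> Q (\<lambda>x. e \<circ> D x))"
    (is "?L \<longleftrightarrow> ?R")
proof
  assume ?L
  then obtain D where D: "\<forall>x\<in>U. D x \<in> pts (op_space X (push e p Y)) \<and> has_fderiv X (push e p Y) U (e \<circ> f) x (D x)" "Q D"
    by blast
  have "\<forall>x\<in>U. \<exists>A\<in>pts (op_space X Y). D x = e \<circ> A"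
    using D(1) by (auto simp: op_space_push[OF e])
  then obtain D' where D': "\<And>x. x \<in> U \<Longrightarrow> D' x \<in> pts (op_space X Y)" "\<And>x. x \<in> U \<Longrightarrow> D x = e \<circ> D' x"
    by metis
  have "Q (\<lambda>x. e \<circ> D' x)" using Q[of D "\<lambda>x. e \<circ> D' x"] D' D(2) by simp
  moreover have "has_fderiv X Y U f x (D' x)" if "x \<in> U" for x
  proof -
    have "has_fderiv X (push e p Y) U (e \<circ> f) x (e \<circ> D' x)"
      using D(1)[rule_format, OF that] unfolding D'(2)[OF that] ..
    then show ?thesis unfolding has_fderiv_push_right[OF e] .
  qed
  ultimately show ?R using D' by blast
next
  assume ?R
  then obtain D where D: "\<forall>x\<in>U. D x \<in> pts (op_space X Y) \<and> has_fderiv X Y U f x (D x)" "Q (\<lambda>x. e \<circ> D x)"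
    by blast
  have "has_fderiv X (push e p Y) U (e \<circ> f) x (e \<circ> D x)" if "x \<in> U" for x
    unfolding has_fderiv_push_right[OF e] using D(1) that by blast
  then show ?L
    using D by (intro exI[of _ "\<lambda>x. e \<circ> D x"]) (auto simp: op_space_push[OF e] simp del: o_apply)
qed

lemma image_push_right:
  assumes e: "embedding e p"
  shows "(e \<circ> f) ` U \<subseteq> pts (push e p Y) \<longleftrightarrow> f ` U \<subseteq> pts Y"
proof -
  have "e y \<in> e ` T \<longleftrightarrow> y \<in> T" for y T using embeddingD(6)[OF e] by auto
  then show ?thesis by (simp add: image_subset_iff)
qed

lemma C_class_enc_push:
  assumes "normed X" "normed Y" "embedding e p"
  shows "C_class_enc k X U (push e p Y) (e \<circ> f) \<longleftrightarrow> C_class_enc k X U Y f"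
  using assms(2,3)
proof (induction k arbitrary: Y e p f)
  case 0
  show ?case unfolding C_class_enc.simps by (rule continuous_push_right[OF 0(2,1)])
next
  case (Suc k)
  note e = Suc.prems(2)
  let ?e = "\<lambda>B. uncur (e \<circ> cur B)" and ?p = "\<lambda>B. uncur (p \<circ> cur B)"
  have pp: "push uncur cur (op_space X (push e p Y)) = push ?e ?p (push uncur cur (op_space X Y))"
    unfolding op_space_push[OF e] push_push by (simp add: comp_def)
  have n: "normed (push uncur cur (op_space X Y))"
    by (intro normed_push embedding_uncur normed_op_space assms Suc.prems)
  have D: "C_class_enc k X U (push uncur cur (op_space X (push e p Y))) (uncur \<circ> (\<lambda>x. e \<circ> D x)) \<longleftrightarrow>
      C_class_enc k X U (push uncur cur (op_space X Y)) (uncur \<circ> D)" for D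
  proof -
    have "uncur \<circ> (\<lambda>x. e \<circ> D x) = ?e \<circ> (uncur \<circ> D)" by (rule ext) simp
    then show ?thesis using Suc.IH[OF n embedding_lift_op[OF e], of "uncur \<circ> D"] unfolding pp by (simp only: )
  qed
  have "(\<exists>D. (\<forall>x\<in>U. D x \<in> pts (op_space X (push e p Y)) \<and> has_fderiv X (push e p Y) U (e \<circ> f) x (D x)) \<and>
        C_class_enc k X U (push uncur cur (op_space X (push e p Y))) (uncur \<circ> D)) \<longleftrightarrow>
      (\<exists>D. (\<forall>x\<in>U. D x \<in> pts (op_space X Y) \<and> has_fderiv X Y U f x (D x)) \<and>
        C_class_enc k X U (push uncur cur (op_space X (push e p Y))) (uncur \<circ> (\<lambda>x. e \<circ> D x)))"
    by (rule ex_derivative_push_right[OF e]) (rule C_class_enc_cong, simp)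
  then show ?case unfolding C_class_enc.simps image_push_right[OF e] D by (simp only: )
qed

definition reorder :: "((nat \<Rightarrow> 'a) \<Rightarrow> 'a \<Rightarrow> 'b) \<Rightarrow> (nat \<Rightarrow> 'a) \<Rightarrow> 'b" where
  "reorder B s = B (\<lambda>n. s (Suc n)) (s 0)"

definition unreorder :: "((nat \<Rightarrow> 'a) \<Rightarrow> 'b) \<Rightarrow> (nat \<Rightarrow> 'a) \<Rightarrow> 'a \<Rightarrow> 'b" where
  "unreorder B s h = B (case_nat h s)"

lemma embedding_reorder: "embedding reorder unreorder"
  unfolding embedding_def by (auto simp: reorder_def unreorder_def fun_eq_iff intro!: linearI)

lemma C_class_0:
  assumes "normed Y"
  shows "C_class 0 X U Y f \<longleftrightarrow> continuous_map (subtopology (ntop X) U) (ntop Y) f"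
  unfolding C_class_def C_class_enc.simps by (rule continuous_push_right[OF embedding_cst assms])

lemma C_class_Suc:
  fixes X :: "'a::real_vector nspace" and Y :: "'b::real_vector nspace"
  assumes "normed X" "normed Y"
  shows "C_class (Suc k) X U Y f \<longleftrightarrow> f ` U \<subseteq> pts Y \<and>
     (\<exists>D. (\<forall>x\<in>U. D x \<in> pts (op_space X Y) \<and> has_fderiv X Y U f x (D x)) \<and>
          C_class k X U (op_space X Y) D)"
proof -
  have e: "embedding (cst :: 'b \<Rightarrow> (nat \<Rightarrow> 'a) \<Rightarrow> 'b) uncst" by (rule embedding_cst)
  let ?O = "push uncur cur (op_space X (push cst uncst Y))"
  have pp: "?O = push reorder unreorder (push cst uncst (op_space X Y))"
    unfolding op_space_push[OF e] push_push
    by (rule arg_cong2[where f = "\<lambda>a b. push a b (op_space X Y)"])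
      (auto simp: fun_eq_iff uncur_def cur_def cst_def uncst_def reorder_def unreorder_def)
  have "normed (push cst uncst (op_space X Y))"
    by (intro normed_push embedding_cst normed_op_space assms)
  note tr = C_class_enc_push[OF assms(1) this embedding_reorder, of k U]
  have *: "C_class_enc k X U ?O (uncur \<circ> (\<lambda>x. cst \<circ> D x)) \<longleftrightarrow> C_class k X U (op_space X Y) D" for D
  proof -
    have "uncur \<circ> (\<lambda>x. cst \<circ> D x) = reorder \<circ> (cst \<circ> D)"
      by (simp add: fun_eq_iff uncur_def cst_def reorder_def)
    then show ?thesis unfolding C_class_def pp using tr[of "cst \<circ> D"] by simp
  qed
  have "(\<exists>D. (\<forall>x\<in>U. D x \<in> pts (op_space X (push cst uncst Y)) \<and> has_fderiv X (push cst uncst Y) U (cst \<circ> f) x (D x)) \<and>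
        C_class_enc k X U ?O (uncur \<circ> D)) \<longleftrightarrow>
      (\<exists>D. (\<forall>x\<in>U. D x \<in> pts (op_space X Y) \<and> has_fderiv X Y U f x (D x)) \<and>
        C_class_enc k X U ?O (uncur \<circ> (\<lambda>x. cst \<circ> D x)))"
    by (rule ex_derivative_push_right[OF e]) (rule C_class_enc_cong, simp)
  then show ?thesis
    unfolding C_class_def[of "Suc k"] C_class_enc.simps image_push_right[OF e] * by (simp only: )
qed

definition nested :: "'a::real_vector scspace \<Rightarrow> bool" where
  "nested E \<longleftrightarrow> (\<forall>m. normed (E m)) \<and> (\<forall>m. pts (E (Suc m)) \<subseteq> pts (E m))"

lemma nestedD: "nested E \<Longrightarrow> normed (E m)" "nested E \<Longrightarrow> pts (E (Suc m)) \<subseteq> pts (E m)"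
  by (auto simp: nested_def)

lemma sc_banach_nested: "sc_banach E \<Longrightarrow> nested E"
  by (simp add: nested_def sc_banach_def banach_space_def)

lemma nested_push: "embedding e p \<Longrightarrow> nested E \<Longrightarrow> nested (push e p \<circ> E)"
  by (auto simp: nested_def normed_push)

lemma pts_tangent_space: "pts (tangent_space E m) = pts (E (Suc m)) \<times> pts (E m)"
  by (simp add: tangent_space_def sc_sum_def direct_sum_def)

lemma nested_tangent_space:
  assumes "nested E" shows "nested (tangent_space E)"
  unfolding nested_def pts_tangent_space
  using nestedD[OF assms] by (auto simp: tangent_space_def sc_sum_def normed_direct_sum)

lemma embedding_map_prod:
  assumes "embedding e p" shows "embedding (map_prod e e) (map_prod p p)"
  using embeddingD[OF assms] unfolding embedding_def by (auto intro!: linearI)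

lemma unjoin_join [simp]: "unjoin (join v) = v"
  by (simp add: join_def unjoin_def prod_eq_iff)

lemma join_unjoin [simp]: "join (unjoin s) = s"
proof
  fix n show "join (unjoin s) n = s n" by (cases "even n") (auto simp: join_def unjoin_def)
qed

lemma linear_join: "linear join" and linear_unjoin: "linear unjoin"
  by (auto intro!: linearI simp: join_def unjoin_def fun_eq_iff)

lemma embedding_join: "embedding join unjoin"
  by (simp add: embedding_def linear_join)

lemma embedding_leaf: "embedding leaf unleaf"
  unfolding embedding_def by (auto simp: leaf_def unleaf_def fun_eq_iff intro!: linearI)

lemma embedding_conj_join:
  assumes "embedding e p"
  shows "embedding (join \<circ> map_prod e e \<circ> unjoin) (join \<circ> map_prod p p \<circ> unjoin)"
proof -
  have pe: "map_prod p p (map_prod e e v) = v" for v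
    using assms by (cases v) (simp add: embedding_def)
  have "linear (join \<circ> map_prod e e \<circ> unjoin)"
    by (intro linear_compose linear_join linear_unjoin embeddingD(7)[OF embedding_map_prod[OF assms]])
  then show ?thesis unfolding embedding_def by (simp add: pe)
qed

lemma tangent_space_push: "tangent_space (push e p \<circ> E) = push (map_prod e e) (map_prod p p) \<circ> tangent_space E"
proof
  fix m
  have "map_prod e e ` (A \<times> B) = e ` A \<times> e ` B" for A B by force
  then show "tangent_space (push e p \<circ> E) m = (push (map_prod e e) (map_prod p p) \<circ> tangent_space E) m"
    by (simp add: tangent_space_def sc_sum_def direct_sum_def push_def fun_eq_iff)
qed

lemma tangent_set_push:
  assumes "embedding e p"
  shows "tangent_set (push e p \<circ> E) (e ` U) = map_prod e e ` tangent_set E U"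
proof -
  have "e ` U \<inter> e ` T = e ` (U \<inter> T)" for T using embeddingD(6)[OF assms] by auto
  moreover have "map_prod e e ` (A \<times> B) = e ` A \<times> e ` B" for A B by force
  ultimately show ?thesis by (simp add: tangent_set_def)
qed

lemma sc0_push:
  assumes "embedding e p" "embedding e' p'" "nested E" "nested F"
  shows "sc0 (push e p \<circ> E) (e ` U) (push e' p' \<circ> F) (e' ` V) (e' \<circ> f \<circ> p) \<longleftrightarrow> sc0 E U F V f"
  unfolding sc0_def using continuous_push[OF assms(1,2) nestedD(1)[OF assms(3)] nestedD(1)[OF assms(4)]]
  by simp

lemma sc0_cong:
  assumes "\<And>x. x \<in> U \<Longrightarrow> f x = g x"
  shows "sc0 E U F V f \<longleftrightarrow> sc0 E U F V g"
  unfolding sc0_def by (rule iff_allI, rule continuous_map_subtopology_cong, rule assms)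

lemma sc_derivative_cong:
  assumes E: "nested E" and f: "\<And>x. x \<in> U \<Longrightarrow> f x = g x"
    and D: "\<And>x h. x \<in> U \<inter> pts (E 1) \<Longrightarrow> h \<in> pts (E 0) \<Longrightarrow> D x h = D' x h"
  shows "sc_derivative E U F f D \<longleftrightarrow> sc_derivative E U F g D'"
  unfolding sc_derivative_def
proof (rule ball_cong[OF refl])
  fix x assume x: "x \<in> U \<inter> pts (E 1)"
  have "bounded_op (E 0) (F 0) (D x) \<longleftrightarrow> bounded_op (E 0) (F 0) (D' x)"
    by (rule bounded_op_cong[OF nestedD(1)[OF E] D[OF x]])
  moreover have "has_fderiv (E 1) (F 0) U f x (D x) \<longleftrightarrow> has_fderiv (E 1) (F 0) U g x (D' x)"
    using x f D[OF x] nestedD(2)[OF E, of 0] by (intro has_fderiv_cong) auto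
  ultimately show "(bounded_op (E 0) (F 0) (D x) \<and> has_fderiv (E 1) (F 0) U f x (D x)) \<longleftrightarrow>
      (bounded_op (E 0) (F 0) (D' x) \<and> has_fderiv (E 1) (F 0) U g x (D' x))" by simp
qed

lemma sc_derivative_push:
  assumes "embedding e p" "embedding e' p'"
  shows "sc_derivative (push e p \<circ> E) (e ` U) (push e' p' \<circ> F) (e' \<circ> f \<circ> p) (\<lambda>v w. e' (D (p v) (p w)))
    \<longleftrightarrow> sc_derivative E U F f D"
proof -
  have *: "e ` U \<inter> e ` T = e ` (U \<inter> T)" for T using embeddingD(6)[OF assms(1)] by auto
  show ?thesis
    unfolding sc_derivative_def o_apply[of "push e p" E] o_apply[of "push e' p'" F] pts_push * ball_simps
      bounded_op_push[OF assms] has_fderiv_push[OF assms] embeddingD(1)[OF assms(1)] ..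
qed

lemma sc_class_enc_cong:
  assumes E: "nested E" and fg: "\<And>x. x \<in> U \<Longrightarrow> f x = g x"
  shows "sc_class_enc k E U F V f \<longleftrightarrow> sc_class_enc k E U F V g"
  using assms
proof (induction k arbitrary: E U F V f g)
  case 0
  then show ?case using sc0_cong[of U f g] by simp
next
  case (Suc k)
  have T: "tangent_map f D z = tangent_map g D z" if "z \<in> tangent_set E U" for D z
    using that Suc.prems(2) by (auto simp: tangent_map_def tangent_set_def)
  have T': "(join \<circ> tangent_map f D \<circ> unjoin) z = (join \<circ> tangent_map g D \<circ> unjoin) z"
    if "z \<in> join ` tangent_set E U" for D z
    using that T by auto
  have n: "nested (push join unjoin \<circ> tangent_space E)"
    by (intro nested_push embedding_join nested_tangent_space Suc.prems)
  have "sc_derivative E U F f D \<longleftrightarrow> sc_derivative E U F g D" for D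
    by (rule sc_derivative_cong) (use Suc.prems in auto)
  moreover have "sc0 (tangent_space E) (tangent_set E U) (tangent_space F) (tangent_set F V) (tangent_map f D) \<longleftrightarrow>
      sc0 (tangent_space E) (tangent_set E U) (tangent_space F) (tangent_set F V) (tangent_map g D)" for D
    by (rule sc0_cong) (rule T)
  moreover have "sc_class_enc k (push join unjoin \<circ> tangent_space E) (join ` tangent_set E U)
        (push join unjoin \<circ> tangent_space F) (join ` tangent_set F V) (join \<circ> tangent_map f D \<circ> unjoin) \<longleftrightarrow>
      sc_class_enc k (push join unjoin \<circ> tangent_space E) (join ` tangent_set E U)
        (push join unjoin \<circ> tangent_space F) (join ` tangent_set F V) (join \<circ> tangent_map g D \<circ> unjoin)" for D
    by (rule Suc.IH[OF n]) (rule T')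
  moreover have "sc0 E U F V f \<longleftrightarrow> sc0 E U F V g"
    by (rule sc0_cong) (rule Suc.prems(2))
  ultimately show ?case unfolding sc_class_enc.simps by (simp only: )
qed

lemma ex_sc_derivative_push:
  assumes e: "embedding e p" "embedding e' p'" and E: "nested E"
    and Q: "\<And>g g'. (\<And>z. z \<in> tangent_set (push e p \<circ> E) (e ` U) \<Longrightarrow> g z = g' z) \<Longrightarrow> Q g \<longleftrightarrow> Q g'"
  shows "(\<exists>D. sc_derivative (push e p \<circ> E) (e ` U) (push e' p' \<circ> F) (e' \<circ> f \<circ> p) D \<and> Q (tangent_map (e' \<circ> f \<circ> p) D)) \<longleftrightarrow>
    (\<exists>D. sc_derivative E U F f D \<and> Q (map_prod e' e' \<circ> tangent_map f D \<circ> map_prod p p))" (is "?L \<longleftrightarrow> ?R")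
proof
  have TM: "tangent_map (e' \<circ> f \<circ> p) (\<lambda>v w. e' (D (p v) (p w))) = map_prod e' e' \<circ> tangent_map f D \<circ> map_prod p p" for D
    by (auto simp: tangent_map_def)
  {
    assume ?R
    then obtain D where "sc_derivative E U F f D" "Q (map_prod e' e' \<circ> tangent_map f D \<circ> map_prod p p)" by blast
    then show ?L
      by (intro exI[of _ "\<lambda>v w. e' (D (p v) (p w))"]) (simp only: TM sc_derivative_push[OF e] simp_thms)
  }
  assume ?L
  then obtain D where D: "sc_derivative (push e p \<circ> E) (e ` U) (push e' p' \<circ> F) (e' \<circ> f \<circ> p) D"
    "Q (tangent_map (e' \<circ> f \<circ> p) D)" by blast
  define D' where "D' x h = p' (D (e x) (e h))" for x h
  have DD: "D v w = e' (D' (p v) (p w))"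
    if "v \<in> e ` U \<inter> pts ((push e p \<circ> E) 1)" "w \<in> pts ((push e p \<circ> E) 0)" for v w
  proof -
    have "bounded_op ((push e p \<circ> E) 0) ((push e' p' \<circ> F) 0) (D v)"
      using D(1)[unfolded sc_derivative_def, THEN bspec, OF that(1)] by (rule conjunct1)
    then have "D v w \<in> pts ((push e' p' \<circ> F) 0)"
      using that(2) unfolding bounded_op_def linear_op_def by blast
    then obtain y where "D v w = e' y" by auto
    moreover have "e (p v) = v" "e (p w) = w" using that by (auto simp: embeddingD(1)[OF e(1)])
    ultimately show ?thesis by (simp add: D'_def embeddingD(1)[OF e(2)])
  qed
  have "sc_derivative (push e p \<circ> E) (e ` U) (push e' p' \<circ> F) (e' \<circ> f \<circ> p) (\<lambda>v w. e' (D' (p v) (p w)))"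
    using D(1) sc_derivative_cong[OF nested_push[OF e(1) E], of "e ` U" "e' \<circ> f \<circ> p" "e' \<circ> f \<circ> p" D
        "\<lambda>v w. e' (D' (p v) (p w))", OF refl DD] by simp
  then have "sc_derivative E U F f D'" by (simp only: sc_derivative_push[OF e])
  moreover have "Q (tangent_map (e' \<circ> f \<circ> p) (\<lambda>v w. e' (D' (p v) (p w))))"
  proof (rule Q[THEN iffD1, OF _ D(2)])
    fix z assume "z \<in> tangent_set (push e p \<circ> E) (e ` U)"
    then have "fst z \<in> e ` U \<inter> pts ((push e p \<circ> E) 1)" "snd z \<in> pts ((push e p \<circ> E) 0)"
      unfolding tangent_set_def by (rule mem_Times_iff[THEN iffD1, THEN conjunct1], rule mem_Times_iff[THEN iffD1, THEN conjunct2])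
    from DD[OF this] show "tangent_map (e' \<circ> f \<circ> p) D z = tangent_map (e' \<circ> f \<circ> p) (\<lambda>v w. e' (D' (p v) (p w))) z"
      by (simp add: tangent_map_def case_prod_beta)
  qed
  ultimately show ?R unfolding TM by blast
qed

lemma push_comp_push: "push e' p' \<circ> (push e p \<circ> E) = push (e' \<circ> e) (p \<circ> p') \<circ> E"
  by (simp add: fun_eq_iff push_push)

lemma join_comp [simp]: "unjoin \<circ> join = id" "join \<circ> unjoin = id"
  by (auto simp: fun_eq_iff)

lemma sc_class_enc_push:
  assumes "embedding e p" "embedding e' p'" "nested E" "nested F"
  shows "sc_class_enc k (push e p \<circ> E) (e ` U) (push e' p' \<circ> F) (e' ` V) (e' \<circ> f \<circ> p) \<longleftrightarrow>
    sc_class_enc k E U F V f"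
  using assms
proof (induction k arbitrary: E U F V f e p e' p')
  case 0
  then show ?case unfolding sc_class_enc.simps by (rule sc0_push)
next
  case (Suc k)
  note e = Suc.prems(1,2) and EF = Suc.prems(3,4)
  note nE = nested_tangent_space[OF EF(1)] and nF = nested_tangent_space[OF EF(2)]
  let ?c = "\<lambda>e. join \<circ> map_prod e e \<circ> unjoin"
  let ?Q = "\<lambda>g. sc0 (tangent_space (push e p \<circ> E)) (tangent_set (push e p \<circ> E) (e ` U))
        (tangent_space (push e' p' \<circ> F)) (tangent_set (push e' p' \<circ> F) (e' ` V)) g \<and>
      sc_class_enc k
        (push join unjoin \<circ> tangent_space (push e p \<circ> E)) (join ` tangent_set (push e p \<circ> E) (e ` U))
        (push join unjoin \<circ> tangent_space (push e' p' \<circ> F)) (join ` tangent_set (push e' p' \<circ> F) (e' ` V))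
        (join \<circ> g \<circ> unjoin)"
  have n: "nested (push join unjoin \<circ> tangent_space (push e p \<circ> E))"
    by (intro nested_push embedding_join nested_tangent_space e EF)
  have Q: "?Q g \<longleftrightarrow> ?Q g'" if "\<And>z. z \<in> tangent_set (push e p \<circ> E) (e ` U) \<Longrightarrow> g z = g' z" for g g'
    by (rule arg_cong2[of _ _ _ _ "(\<and>)"], rule sc0_cong, erule that, rule sc_class_enc_cong[OF n])
      (auto simp: that)
  have sp: "push join unjoin \<circ> tangent_space (push a b \<circ> G) = push (?c a) (?c b) \<circ> (push join unjoin \<circ> tangent_space G)"
    for a :: "(nat \<Rightarrow> 'x::real_vector) \<Rightarrow> nat \<Rightarrow> 'y::real_vector" and b G
    unfolding tangent_space_push push_comp_push
    by (rule arg_cong2[where f = "\<lambda>a b. push a b \<circ> tangent_space G"]) (simp_all add: fun_eq_iff)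
  have st: "join ` map_prod a a ` S = ?c a ` join ` S" for a :: "(nat \<Rightarrow> 'x) \<Rightarrow> nat \<Rightarrow> 'y" and S
    by (simp add: image_image)
  have fn: "join \<circ> (map_prod e' e' \<circ> g \<circ> map_prod p p) \<circ> unjoin = ?c e' \<circ> (join \<circ> g \<circ> unjoin) \<circ> ?c p" for g
    by (simp add: fun_eq_iff)
  have QQ: "?Q (map_prod e' e' \<circ> g \<circ> map_prod p p) \<longleftrightarrow>
      sc0 (tangent_space E) (tangent_set E U) (tangent_space F) (tangent_set F V) g \<and>
      sc_class_enc k (push join unjoin \<circ> tangent_space E) (join ` tangent_set E U)
        (push join unjoin \<circ> tangent_space F) (join ` tangent_set F V) (join \<circ> g \<circ> unjoin)" for g
  proof -
    have "sc0 (tangent_space (push e p \<circ> E)) (tangent_set (push e p \<circ> E) (e ` U))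
        (tangent_space (push e' p' \<circ> F)) (tangent_set (push e' p' \<circ> F) (e' ` V)) (map_prod e' e' \<circ> g \<circ> map_prod p p) \<longleftrightarrow>
        sc0 (tangent_space E) (tangent_set E U) (tangent_space F) (tangent_set F V) g"
      unfolding tangent_space_push tangent_set_push[OF e(1)] tangent_set_push[OF e(2)]
      by (rule sc0_push[OF e[THEN embedding_map_prod] nE nF])
    moreover note Suc.IH[OF e[THEN embedding_conj_join] nested_push[OF embedding_join nE] nested_push[OF embedding_join nF],
        of "join ` tangent_set E U" "join ` tangent_set F V" "join \<circ> g \<circ> unjoin"]
    ultimately show ?thesis
      unfolding sp tangent_set_push[OF e(1)] tangent_set_push[OF e(2)] st fn by (simp only: )
  qed
  show ?case
    unfolding sc_class_enc.simps sc0_push[OF e EF]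
    using ex_sc_derivative_push[OF e EF(1), where Q = ?Q and U = U and F = F and f = f, OF Q]
    unfolding QQ by (simp only: )
qed

definition mix :: "(nat \<Rightarrow> 'a \<times> 'a) \<Rightarrow> nat \<Rightarrow> 'a" where
  "mix v = join (fst \<circ> v, snd \<circ> v)"

definition unmix :: "(nat \<Rightarrow> 'a) \<Rightarrow> nat \<Rightarrow> 'a \<times> 'a" where
  "unmix w n = (fst (unjoin w) n, snd (unjoin w) n)"

lemma embedding_mix: "embedding mix unmix"
  unfolding embedding_def by (auto simp: mix_def unmix_def join_def fun_eq_iff intro!: linearI)

lemma sc_class_0:
  assumes "nested E" "nested F"
  shows "sc_class 0 E U F V f \<longleftrightarrow> sc0 E U F V f"
  unfolding sc_class_def sc_class_enc.simps by (rule sc0_push[OF embedding_leaf embedding_leaf assms])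

lemma sc_class_Suc:
  fixes E :: "'a::real_vector scspace" and F :: "'b::real_vector scspace"
  assumes EF: "nested E" "nested F"
  shows "sc_class (Suc k) E U F V f \<longleftrightarrow> sc0 E U F V f \<and>
    (\<exists>D. sc_derivative E U F f D \<and>
      sc0 (tangent_space E) (tangent_set E U) (tangent_space F) (tangent_set F V) (tangent_map f D) \<and>
      sc_class k (tangent_space E) (tangent_set E U) (tangent_space F) (tangent_set F V) (tangent_map f D))"
proof -
  note e = embedding_leaf[where 'a = 'a] embedding_leaf[where 'a = 'b]
  note nE = nested_tangent_space[OF EF(1)] and nF = nested_tangent_space[OF EF(2)]
  let ?Q = "\<lambda>g. sc0 (tangent_space (push leaf unleaf \<circ> E)) (tangent_set (push leaf unleaf \<circ> E) (leaf ` U))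
        (tangent_space (push leaf unleaf \<circ> F)) (tangent_set (push leaf unleaf \<circ> F) (leaf ` V)) g \<and>
      sc_class_enc k
        (push join unjoin \<circ> tangent_space (push leaf unleaf \<circ> E)) (join ` tangent_set (push leaf unleaf \<circ> E) (leaf ` U))
        (push join unjoin \<circ> tangent_space (push leaf unleaf \<circ> F)) (join ` tangent_set (push leaf unleaf \<circ> F) (leaf ` V))
        (join \<circ> g \<circ> unjoin)"
  have n: "nested (push join unjoin \<circ> tangent_space (push leaf unleaf \<circ> E))"
    by (intro nested_push embedding_join nested_tangent_space e EF)
  have Q: "?Q g \<longleftrightarrow> ?Q g'" if "\<And>z. z \<in> tangent_set (push leaf unleaf \<circ> E) (leaf ` U) \<Longrightarrow> g z = g' z" for g g'
    by (rule arg_cong2[of _ _ _ _ "(\<and>)"], rule sc0_cong, erule that, rule sc_class_enc_cong[OF n])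
      (auto simp: that)
  have mj: "join (map_prod leaf leaf z) = mix (leaf z)" for z :: "'x::real_vector \<times> 'x"
    by (cases z) (auto simp: mix_def leaf_def join_def fun_eq_iff)
  have um: "map_prod unleaf unleaf (unjoin w) = unleaf (unmix w)" for w :: "nat \<Rightarrow> 'x::real_vector"
    by (simp add: unmix_def unleaf_def prod_eq_iff)
  have sp: "push join unjoin \<circ> tangent_space (push leaf unleaf \<circ> G) = push mix unmix \<circ> (push leaf unleaf \<circ> tangent_space G)"
    for G :: "'x::real_vector scspace"
    unfolding tangent_space_push push_comp_push
    by (rule arg_cong2[where f = "\<lambda>a b. push a b \<circ> tangent_space G"]) (simp_all add: fun_eq_iff mj um)
  have st: "join ` map_prod leaf leaf ` S = mix ` leaf ` S" for S :: "('x::real_vector \<times> 'x) set"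
    by (simp add: image_image mj)
  have fn: "join \<circ> (map_prod leaf leaf \<circ> g \<circ> map_prod unleaf unleaf) \<circ> unjoin = mix \<circ> (leaf \<circ> g \<circ> unleaf) \<circ> unmix"
    for g :: "'a \<times> 'a \<Rightarrow> 'b \<times> 'b"
    by (rule ext) (simp add: mj um)
  have QQ: "?Q (map_prod leaf leaf \<circ> g \<circ> map_prod unleaf unleaf) \<longleftrightarrow>
      sc0 (tangent_space E) (tangent_set E U) (tangent_space F) (tangent_set F V) g \<and>
      sc_class k (tangent_space E) (tangent_set E U) (tangent_space F) (tangent_set F V) g" for g
  proof -
    have "sc0 (tangent_space (push leaf unleaf \<circ> E)) (tangent_set (push leaf unleaf \<circ> E) (leaf ` U))
        (tangent_space (push leaf unleaf \<circ> F)) (tangent_set (push leaf unleaf \<circ> F) (leaf ` V)) (map_prod leaf leaf \<circ> g \<circ> map_prod unleaf unleaf) \<longleftrightarrow>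
        sc0 (tangent_space E) (tangent_set E U) (tangent_space F) (tangent_set F V) g"
      unfolding tangent_space_push tangent_set_push[OF e(1)] tangent_set_push[OF e(2)]
      by (rule sc0_push[OF e[THEN embedding_map_prod] nE nF])
    moreover note sc_class_enc_push[OF embedding_mix embedding_mix nested_push[OF embedding_leaf nE] nested_push[OF embedding_leaf nF],
        of k "leaf ` tangent_set E U" "leaf ` tangent_set F V" "leaf \<circ> g \<circ> unleaf"]
    ultimately show ?thesis
      unfolding sp tangent_set_push[OF e(1)] tangent_set_push[OF e(2)] st fn sc_class_def by (simp only: )
  qed
  show ?thesis
    unfolding sc_class_def[of "Suc k"] sc_class_enc.simps sc0_push[OF e EF]
    using ex_sc_derivative_push[OF e EF(1), where Q = ?Q and U = U and F = F and f = f, OF Q]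
    unfolding QQ by (simp only: )
qed

end

theory Submission
  imports Defs "HOL-Library.Landau_Symbols" "HOL-Library.More_List"
begin

text \<open>
  Write \<open>D\<^sup>jf\<close> for the iterated derivative of \<open>f\<close>. It is tempting to apply an induction
  hypothesis to \<open>Tf\<close>, but \<open>Tf\<close> does not inherit the assumption: its component
  \<open>(x, h) \<mapsto> Df(x)h\<close> would have to be of class $C^{l+1}$ from \<open>U\<^sub>m\<^sub>+\<^sub>l\<^sub>+\<^sub>1 \<oplus> E\<^sub>m\<^sub>+\<^sub>l\<close> to \<open>F\<^sub>m\<close>, while the
  assumption makes \<open>Df\<close> a map of class $C^{l+1}$ only with values in the operators on the smaller
  space \<open>E\<^sub>m\<^sub>+\<^sub>l\<^sub>+\<^sub>1\<close>. So the induction runs over an explicit class of maps that contains \<open>f\<close> and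
  is closed under passing to the tangent map.

  Up to the order of the entries, \<open>T\<^sup>pf\<close> acts on tuples \<open>v\<close> of \<open>2\<^sup>p\<close> vectors, the \<open>i\<close>-th of which lies on level
  \<open>s i + m\<close> when the tuple lies on level \<open>m\<close>, and each of its components is a sum of terms
  \<open>D\<^sup>jf(v\<^sub>0)[v\<^sub>i\<^sub>1, \<dots>, v\<^sub>i\<^sub>j]\<close>. The point is that the shifts always satisfy
    \<^item> \<open>s i \<ge> r + j - 1\<close> for the arguments \<open>i = i\<^sub>1, \<dots>, i\<^sub>j\<close>, and
    \<^item> \<open>s 0 \<ge> r + j\<close>,
  where \<open>r\<close> is the shift of the component (predicate \<open>admissible\<close>). Put \<open>a = r + m\<close>. If \<open>j \<ge> 1\<close>, then the
  two conditions place \<open>v\<^sub>0\<close> and all arguments in \<open>E\<^sub>a\<^sub>+\<^sub>j\<^sub>-\<^sub>1\<close>, and the term is continuous with values in \<open>F\<^sub>a\<close>,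
  because \<open>f : U\<^sub>a\<^sub>+\<^sub>j\<^sub>-\<^sub>1 \<rightarrow> F\<^sub>a\<close> is of class $C^j$ (lemma \<open>term_tendsto\<close>). On the next level all arguments lie in \<open>E\<^sub>a\<^sub>+\<^sub>j\<close>, where \<open>f\<close> is of class
  $C^{j+1}$; there the term is differentiable, with the derivative in direction \<open>w\<close>
  \[ D^{j+1}f(v_0)[w_0, v_{i_1}, \dots, v_{i_j}] + \sum_q D^jf(v_0)[v_{i_1}, \dots, w_{i_q}, \dots, v_{i_j}] \]
  (lemma \<open>term_deriv_smallo\<close>). This extends to a bounded operator on the level below
  (lemma \<open>term_deriv_bounded_linear\<close>). In the tangent map the base tuple \<open>v\<close> is shifted up by one
  level and \<open>w\<close> is not, so the new terms satisfy the same two inequalities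
  (lemma \<open>admissible_tangent_terms\<close>), and \<open>j\<close> has grown by at most one.

  All this presupposes that \<open>D\<^sup>jf\<close> does not depend on the pair of levels on which it is computed.
  Derivatives on a partial quadrant \<open>C\<close> are unique, because they are determined by directions
  pointing into \<open>C\<close> and these span every level; hence the derivatives computed on the various
  levels restrict to each other (lemmas \<open>jet_unique\<close> and \<open>ex_coherent_jet\<close>).
\<close>

section \<open>Normed spaces and continuity\<close>

lemma nrm_zero: "normed X \<Longrightarrow> nrm X 0 = 0"
  using normedD(3,6) by blast

lemma nrm_add_le: "normed Y \<Longrightarrow> a \<in> pts Y \<Longrightarrow> b \<in> pts Y \<Longrightarrow> nrm Y a \<le> \<alpha> \<Longrightarrow> nrm Y b \<le> \<beta> \<Longrightarrow> nrm Y (a + b) \<le> \<alpha> + \<beta>"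
  using normedD(5)[of Y a b] by linarith

lemma nrm_diff_le:
  assumes X: "normed X" and xy: "x \<in> pts X" "y \<in> pts X"
  shows "nrm X (x - y) \<le> nrm X x + nrm X y"
proof -
  have "nrm X (x + (0 - y)) \<le> nrm X x + nrm X (0 - y)"
    by (intro normedD(5)[OF X] normedD(9)[OF X] normedD(6)[OF X] xy)
  then show ?thesis using nrm_minus_commute[OF X normedD(6)[OF X] xy(2)] by simp
qed

lemma continuous_map_ntop:
  assumes X: "normed X" and Y: "normed Y"
  shows "continuous_map (subtopology (ntop X) U) (subtopology (ntop Y) V) f \<longleftrightarrow>
    f ` (U \<inter> pts X) \<subseteq> V \<inter> pts Y \<and>
    (\<forall>x\<in>U \<inter> pts X. \<forall>\<epsilon>>0. \<exists>\<delta>>0. \<forall>y\<in>U \<inter> pts X. nrm X (y - x) < \<delta> \<longrightarrow> nrm Y (f y - f x) < \<epsilon>)"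
    (is "?L \<longleftrightarrow> ?R")
proof -
  interpret A: Metric_space "pts X" "ndist X" by (rule Metric_space_ntop[OF X])
  interpret B: Metric_space "pts Y" "ndist Y" by (rule Metric_space_ntop[OF Y])
  interpret S: Submetric "pts X" "ndist X" "U \<inter> pts X" by unfold_locales auto
  have top: "subtopology (ntop X) U = S.sub.mtopology"
    unfolding S.mtopology_submetric ntop_def by (metis A.topspace_mtopology subtopology_restrict inf_commute)
  have "?L \<longleftrightarrow> f ` (U \<inter> pts X) \<subseteq> V \<and> continuous_map S.sub.mtopology B.mtopology f"
    unfolding continuous_map_in_subtopology top by (auto simp: ntop_def image_subset_iff_funcset)
  also have "\<dots> \<longleftrightarrow> f ` (U \<inter> pts X) \<subseteq> V \<and> f ` (U \<inter> pts X) \<subseteq> pts Y \<and>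
    (\<forall>x\<in>U \<inter> pts X. \<forall>\<epsilon>>0. \<exists>\<delta>>0. \<forall>y. y \<in> U \<inter> pts X \<and> ndist X x y < \<delta> \<longrightarrow> ndist Y (f x) (f y) < \<epsilon>)"
    unfolding S.sub.metric_continuous_map[OF B.Metric_space_axioms] by (simp add: image_subset_iff_funcset)
  also have "\<dots> \<longleftrightarrow> ?R"
  proof (intro iffI; elim conjE; intro conjI ballI allI impI)
    fix x and \<epsilon> :: real
    assume f: "f ` (U \<inter> pts X) \<subseteq> pts Y" and x: "x \<in> U \<inter> pts X" and e: "\<epsilon> > 0"
    have d: "ndist X x y = nrm X (y - x)" "ndist Y (f x) (f y) = nrm Y (f y - f x)" if "y \<in> U \<inter> pts X" for y
      using f x that nrm_minus_commute[OF X, of x y] nrm_minus_commute[OF Y, of "f x" "f y"]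
      by (auto simp: ndist_def image_subset_iff)
    show "\<exists>\<delta>>0. \<forall>y\<in>U \<inter> pts X. nrm X (y - x) < \<delta> \<longrightarrow> nrm Y (f y - f x) < \<epsilon>"
      if "\<forall>x\<in>U \<inter> pts X. \<forall>\<epsilon>>0. \<exists>\<delta>>0. \<forall>y. y \<in> U \<inter> pts X \<and> ndist X x y < \<delta> \<longrightarrow> ndist Y (f x) (f y) < \<epsilon>"
      using that x e d by metis
  next
    fix x and \<epsilon> :: real
    assume f: "f ` (U \<inter> pts X) \<subseteq> V \<inter> pts Y" and x: "x \<in> U \<inter> pts X" and e: "\<epsilon> > 0"
    have d: "ndist X x y = nrm X (y - x)" "ndist Y (f x) (f y) = nrm Y (f y - f x)" if "y \<in> U \<inter> pts X" for y
      using f x that nrm_minus_commute[OF X, of x y] nrm_minus_commute[OF Y, of "f x" "f y"]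
      by (auto simp: ndist_def image_subset_iff)
    show "\<exists>\<delta>>0. \<forall>y. y \<in> U \<inter> pts X \<and> ndist X x y < \<delta> \<longrightarrow> ndist Y (f x) (f y) < \<epsilon>"
      if "\<forall>x\<in>U \<inter> pts X. \<forall>\<epsilon>>0. \<exists>\<delta>>0. \<forall>y\<in>U \<inter> pts X. nrm X (y - x) < \<delta> \<longrightarrow> nrm Y (f y - f x) < \<epsilon>"
      using that x e d by metis
  qed auto
  finally show ?thesis .
qed

lemma has_fderiv_imp_continuous:
  assumes X: "normed X" and Y: "normed Y" and U: "U \<subseteq> pts X" and f: "f ` U \<subseteq> pts Y"
    and A: "bounded_op X Y A" and D: "has_fderiv X Y U f x A" and x: "x \<in> U" and e: "\<epsilon> > 0"
  shows "\<exists>\<delta>>0. \<forall>y\<in>U. nrm X (y - x) < \<delta> \<longrightarrow> nrm Y (f y - f x) < \<epsilon>"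
proof -
  obtain b where b: "\<And>h. h \<in> pts X \<Longrightarrow> nrm Y (A h) \<le> b * nrm X h" and Ap: "\<And>h. h \<in> pts X \<Longrightarrow> A h \<in> pts Y"
    using A unfolding bounded_op_def linear_op_def image_subset_iff by metis
  obtain \<delta> where \<delta>: "\<delta> > 0" "\<And>h. h \<in> pts X \<Longrightarrow> 0 < nrm X h \<Longrightarrow> nrm X h < \<delta> \<Longrightarrow> x + h \<in> U \<Longrightarrow>
      nrm Y (f (x + h) - f x - A h) / nrm X h < 1"
    using D[unfolded has_fderiv_def, THEN spec, of 1] zero_less_one by metis
  show ?thesis
  proof (intro exI conjI ballI impI)
    show "0 < min \<delta> (\<epsilon> / (\<bar>b\<bar> + 1))" using \<delta>(1) e by simp
    fix y assume y: "y \<in> U" "nrm X (y - x) < min \<delta> (\<epsilon> / (\<bar>b\<bar> + 1))"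
    let ?h = "y - x"
    have h: "?h \<in> pts X" using normedD(9)[OF X] x y U by auto
    show "nrm Y (f y - f x) < \<epsilon>"
    proof (cases "nrm X ?h = 0")
      case True
      then have "y = x" using normedD(3)[OF X h] by simp
      then show ?thesis using e nrm_zero[OF Y] by simp
    next
      case False
      then have p: "0 < nrm X ?h" using normedD(2)[OF X h] by simp
      then have "nrm Y (f y - f x - A ?h) < nrm X ?h" using \<delta>(2)[OF h p] y by (simp add: divide_simps)
      moreover have "nrm Y (f y - f x) \<le> nrm Y (f y - f x - A ?h) + nrm Y (A ?h)"
        using normedD(5)[OF Y, of "f y - f x - A ?h" "A ?h"] normedD(9)[OF Y] Ap[OF h] f x y
        by (simp add: image_subset_iff)
      moreover have "nrm Y (A ?h) \<le> \<bar>b\<bar> * nrm X ?h"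
        using b[OF h] p mult_right_mono[of b "\<bar>b\<bar>" "nrm X ?h"] by linarith
      ultimately have "nrm Y (f y - f x) < (\<bar>b\<bar> + 1) * nrm X ?h" by (simp add: algebra_simps)
      also have "\<dots> < \<epsilon>" using y(2) by (simp add: field_simps)
      finally show ?thesis .
    qed
  qed
qed

lemma op_space_bound:
  assumes X: "normed X" and Y: "normed Y" and A: "A \<in> pts (op_space X Y)" and x: "x \<in> pts X"
  shows "nrm Y (A x) \<le> nrm (op_space X Y) A * nrm X x"
proof (cases "x = 0")
  case True
  have "A (0 *\<^sub>R 0) = 0 *\<^sub>R A 0"
    using A normedD(6)[OF X] unfolding op_space_def bounded_op_def linear_op_def by fastforce
  then show ?thesis using True nrm_zero[OF X] nrm_zero[OF Y] by simp
next
  case False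
  let ?B = "{x \<in> pts X. nrm X x \<le> 1}"
  obtain b where b: "\<And>x. x \<in> pts X \<Longrightarrow> nrm Y (A x) \<le> b * nrm X x"
    using A by (auto simp: op_space_def bounded_op_def)
  have "nrm Y (A x) \<le> \<bar>b\<bar>" if "x \<in> ?B" for x
  proof -
    have "b * nrm X x \<le> \<bar>b\<bar> * nrm X x" using that normedD(2)[OF X] by (intro mult_right_mono) auto
    also have "\<dots> \<le> \<bar>b\<bar> * 1" using that by (intro mult_left_mono) auto
    finally show ?thesis using b[of x] that by simp
  qed
  then have bdd: "bdd_above ((\<lambda>x. nrm Y (A x)) ` ?B)" by (auto intro!: bdd_aboveI)
  have p: "nrm X x > 0" using normedD(2,3)[OF X x] False by simp
  let ?y = "(1 / nrm X x) *\<^sub>R x"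
  have "?y \<in> ?B" using p x by (simp add: normedD[OF X])
  then have "nrm Y (A ?y) \<le> nrm (op_space X Y) A"
    using cSUP_upper[OF _ bdd] by (simp add: op_space_def)
  moreover have "A ?y = (1 / nrm X x) *\<^sub>R A x" "A x \<in> pts Y"
    using A x by (auto simp: op_space_def bounded_op_def linear_op_def)
  ultimately show ?thesis using p by (simp add: normedD(4)[OF Y] divide_simps)
qed

lemma nested_mono: "nested E \<Longrightarrow> a \<le> b \<Longrightarrow> pts (E b) \<subseteq> pts (E a)"
  by (rule lift_Suc_antimono_le[of "\<lambda>m. pts (E m)"]) (auto dest: nestedD)

text \<open>Iterates the bound for one step, which comes from the compactness of the inclusions.\<close>

lemma nrm_le_higher_level:
  assumes E: "sc_banach E" and ab: "a \<le> b"
  shows "\<exists>c>0. \<forall>x\<in>pts (E b). nrm (E a) x \<le> c * nrm (E b) x"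
  using ab
proof (induction b rule: dec_induct)
  case base
  show ?case by (rule exI[of _ 1]) auto
next
  case (step b)
  then obtain c where c: "c > 0" "\<And>x. x \<in> pts (E b) \<Longrightarrow> nrm (E a) x \<le> c * nrm (E b) x" by blast
  obtain c' where c': "c' > 0" "\<And>x. x \<in> pts (E (Suc b)) \<Longrightarrow> nrm (E b) x \<le> c' * nrm (E (Suc b)) x"
    using nrm_incl_bound[OF E] by blast
  have "nrm (E a) x \<le> (c * c') * nrm (E (Suc b)) x" if "x \<in> pts (E (Suc b))" for x
  proof -
    have "x \<in> pts (E b)" using that nestedD(2)[OF sc_banach_nested[OF E]] by blast
    then have "nrm (E a) x \<le> c * nrm (E b) x" by (rule c)
    also have "\<dots> \<le> c * (c' * nrm (E (Suc b)) x)" using c'(2)[OF that] c(1) by simp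
    finally show ?thesis by (simp add: mult.assoc)
  qed
  then show ?case using c(1) c'(1) by (intro exI[of _ "c * c'"]) auto
qed

section \<open>Bounded multilinear maps\<close>

text \<open>A \<open>j\<close>-linear map is a function evaluated at lists of length \<open>j\<close>. The
  lists put multilinear maps of all orders into one type, so that induction on \<open>j\<close> is possible.\<close>

primrec multilin :: "'a::real_vector nspace \<Rightarrow> 'b::real_vector nspace \<Rightarrow> nat \<Rightarrow> ('a list \<Rightarrow> 'b) \<Rightarrow> bool" where
  "multilin X Y 0 B \<longleftrightarrow> B [] \<in> pts Y"
| "multilin X Y (Suc j) B \<longleftrightarrow> (\<forall>h\<in>pts X. multilin X Y j (\<lambda>hs. B (h # hs))) \<and>
     (\<forall>hs\<in>lists (pts X). length hs = j \<longrightarrow>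
        (\<forall>a\<in>pts X. \<forall>b\<in>pts X. B ((a + b) # hs) = B (a # hs) + B (b # hs)) \<and>
        (\<forall>a\<in>pts X. \<forall>c. B (c *\<^sub>R a # hs) = c *\<^sub>R B (a # hs)))"

definition mbound :: "'a nspace \<Rightarrow> 'b nspace \<Rightarrow> nat \<Rightarrow> real \<Rightarrow> ('a list \<Rightarrow> 'b) \<Rightarrow> bool" where
  "mbound X Y j \<beta> B \<longleftrightarrow>
     (\<forall>hs\<in>lists (pts X). length hs = j \<longrightarrow> nrm Y (B hs) \<le> \<beta> * prod_list (map (nrm X) hs))"

lemma multilin_in_pts: "multilin X Y j B \<Longrightarrow> set hs \<subseteq> pts X \<Longrightarrow> length hs = j \<Longrightarrow> B hs \<in> pts Y"
proof (induction j arbitrary: B hs)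
  case (Suc j)
  then obtain h hs' where "hs = h # hs'" by (cases hs) auto
  then show ?case using Suc.IH[of "\<lambda>hs. B (h # hs)" hs'] Suc.prems by simp
qed simp

lemma multilin_Cons:
  assumes "multilin X Y (Suc j) B" "set hs \<subseteq> pts X" "length hs = j" "a \<in> pts X"
  shows "b \<in> pts X \<Longrightarrow> B ((a + b) # hs) = B (a # hs) + B (b # hs)" "B (c *\<^sub>R a # hs) = c *\<^sub>R B (a # hs)"
proof -
  have "hs \<in> lists (pts X)" using assms(2) by auto
  then show "b \<in> pts X \<Longrightarrow> B ((a + b) # hs) = B (a # hs) + B (b # hs)" "B (c *\<^sub>R a # hs) = c *\<^sub>R B (a # hs)"
    using assms(1,3,4) by simp_all
qed

lemma multilin_cong:
  assumes X: "normed X" and "\<And>hs. set hs \<subseteq> pts X \<Longrightarrow> length hs = j \<Longrightarrow> B hs = B' hs"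
  shows "multilin X Y j B \<longleftrightarrow> multilin X Y j B'"
  using assms(2)
proof (induction j arbitrary: B B')
  case (Suc j)
  have "multilin X Y j (\<lambda>hs. B (h # hs)) \<longleftrightarrow> multilin X Y j (\<lambda>hs. B' (h # hs))" if "h \<in> pts X" for h
    using Suc.prems that by (intro Suc.IH) auto
  moreover have "B (h # hs) = B' (h # hs)" if "h \<in> pts X" "hs \<in> lists (pts X)" "length hs = j" for h hs
    using Suc.prems[of "h # hs"] that by auto
  ultimately show ?case using normedD(7,8)[OF X] by (simp cong: conj_cong ball_cong imp_cong)
qed simp

lemma mbound_cong:
  assumes "\<And>hs. set hs \<subseteq> pts X \<Longrightarrow> length hs = j \<Longrightarrow> B hs = B' hs"
  shows "mbound X Y j b B \<longleftrightarrow> mbound X Y j b B'"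
  unfolding mbound_def
proof (intro ball_cong imp_cong refl)
  fix hs assume "hs \<in> lists (pts X)" "length hs = j"
  then have "B hs = B' hs" by (intro assms) auto
  then show "nrm Y (B hs) \<le> b * prod_list (map (nrm X) hs) \<longleftrightarrow> nrm Y (B' hs) \<le> b * prod_list (map (nrm X) hs)" by simp
qed

lemma mbound_Cons: "mbound X Y (Suc j) \<beta> B \<Longrightarrow> h \<in> pts X \<Longrightarrow> mbound X Y j (\<beta> * nrm X h) (\<lambda>hs. B (h # hs))"
  unfolding mbound_def
proof (intro ballI impI)
  fix hs assume *: "\<forall>hs\<in>lists (pts X). length hs = Suc j \<longrightarrow> nrm Y (B hs) \<le> \<beta> * prod_list (map (nrm X) hs)"
    and "h \<in> pts X" "hs \<in> lists (pts X)" "length hs = j"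
  then show "nrm Y (B (h # hs)) \<le> \<beta> * nrm X h * prod_list (map (nrm X) hs)"
    using bspec[OF *, of "h # hs"] by (simp add: mult.assoc)
qed

lemma mbound_mono:
  assumes X: "normed X" and "mbound X Y j \<beta> B" "\<beta> \<le> \<gamma>" shows "mbound X Y j \<gamma> B"
  unfolding mbound_def
proof (intro ballI impI)
  fix hs assume hs: "hs \<in> lists (pts X)" "length hs = j"
  have "0 \<le> prod_list (map (nrm X) hs)"
    using hs(1) normedD(2)[OF X] by (intro prod_list_nonneg) auto
  then have "\<beta> * prod_list (map (nrm X) hs) \<le> \<gamma> * prod_list (map (nrm X) hs)"
    using assms(3) by (rule mult_right_mono[rotated])
  moreover have "nrm Y (B hs) \<le> \<beta> * prod_list (map (nrm X) hs)"
    using assms(2) hs unfolding mbound_def by blast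
  ultimately show "nrm Y (B hs) \<le> \<gamma> * prod_list (map (nrm X) hs)" by linarith
qed

text \<open>The derivative of \<open>v \<mapsto> B (map v ix)\<close> in direction \<open>w\<close>: the product rule, one summand
  for every slot. The index list \<open>ix\<close> allows repeated and permuted arguments.\<close>

primrec mderiv :: "('a list \<Rightarrow> 'b::real_vector) \<Rightarrow> ('i \<Rightarrow> 'a) \<Rightarrow> ('i \<Rightarrow> 'a) \<Rightarrow> 'i list \<Rightarrow> 'b" where
  "mderiv B v w [] = 0"
| "mderiv B v w (i # ix) = B (w i # map v ix) + mderiv (\<lambda>hs. B (v i # hs)) v w ix"

context
  fixes X :: "'a::real_vector nspace" and Y :: "'b::real_vector nspace" and R :: real
  assumes X: "normed X" and Y: "normed Y" and R: "1 \<le> R"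
begin

lemma mbound_map_le:
  assumes "mbound X Y (length ix) \<beta> B" "0 \<le> \<beta>" "\<And>i. i \<in> set ix \<Longrightarrow> v i \<in> pts X \<and> nrm X (v i) \<le> R"
  shows "nrm Y (B (map v ix)) \<le> \<beta> * R ^ length ix"
  using assms
proof (induction ix arbitrary: B \<beta>)
  case Nil
  then show ?case by (simp add: mbound_def)
next
  case (Cons i ix)
  have v: "v i \<in> pts X" "nrm X (v i) \<le> R" "0 \<le> nrm X (v i)" using Cons.prems(3) normedD(2)[OF X] by auto
  have "nrm Y (B (v i # map v ix)) \<le> \<beta> * nrm X (v i) * R ^ length ix"
    using Cons.prems v by (intro Cons.IH[where B = "\<lambda>hs. B (v i # hs)"] mbound_Cons) auto
  also have "\<dots> \<le> \<beta> * R * R ^ length ix"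
    using v Cons.prems(2) R by (intro mult_right_mono mult_left_mono) auto
  finally show ?case by (simp add: mult.assoc)
qed

context
  fixes \<kappa> :: real
  assumes \<kappa>: "0 \<le> \<kappa>"
begin

lemma mderiv_le:
  assumes "multilin X Y (length ix) B" "mbound X Y (length ix) \<beta> B" "0 \<le> \<beta>"
    "\<And>i. i \<in> set ix \<Longrightarrow> v i \<in> pts X \<and> nrm X (v i) \<le> R" "\<And>i. i \<in> set ix \<Longrightarrow> w i \<in> pts X \<and> nrm X (w i) \<le> \<kappa>"
  shows "mderiv B v w ix \<in> pts Y \<and> nrm Y (mderiv B v w ix) \<le> \<beta> * length ix * \<kappa> * R ^ length ix"
  using assms
proof (induction ix arbitrary: B \<beta>)
  case Nil
  then show ?case using nrm_zero[OF Y] normedD(6)[OF Y] by simp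
next
  case (Cons i ix)
  note vw = Cons.prems(4)[of i] Cons.prems(5)[of i]
  let ?n = "length ix"
  have nn: "0 \<le> nrm X (v i)" "0 \<le> nrm X (w i)" using vw normedD(2)[OF X] by auto
  have p: "0 \<le> R ^ ?n" "R ^ ?n \<le> R * R ^ ?n" using R by auto
  have "nrm Y (B (w i # map v ix)) \<le> \<beta> * nrm X (w i) * R ^ ?n"
    using Cons.prems vw nn by (intro mbound_map_le[where B = "\<lambda>hs. B (w i # hs)"] mbound_Cons) auto
  also have "\<dots> \<le> \<beta> * \<kappa> * (R * R ^ ?n)"
    using vw nn Cons.prems(3) p \<kappa> by (intro mult_mono mult_nonneg_nonneg) auto
  finally have 1: "nrm Y (B (w i # map v ix)) \<le> \<beta> * \<kappa> * (R * R ^ ?n)" .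
  have 2: "B (w i # map v ix) \<in> pts Y"
    using multilin_in_pts[OF Cons.prems(1), of "w i # map v ix"] Cons.prems(4,5) by auto
  have 3: "mderiv (\<lambda>hs. B (v i # hs)) v w ix \<in> pts Y \<and>
      nrm Y (mderiv (\<lambda>hs. B (v i # hs)) v w ix) \<le> \<beta> * nrm X (v i) * ?n * \<kappa> * R ^ ?n"
    using Cons.prems vw nn by (intro Cons.IH[where B = "\<lambda>hs. B (v i # hs)"] mbound_Cons) auto
  have "\<beta> * nrm X (v i) * ?n * \<kappa> * R ^ ?n \<le> \<beta> * R * ?n * \<kappa> * R ^ ?n"
    using vw Cons.prems(3) p \<kappa> by (intro mult_right_mono mult_left_mono) auto
  with 3 have "nrm Y (mderiv (\<lambda>hs. B (v i # hs)) v w ix) \<le> \<beta> * R * ?n * \<kappa> * R ^ ?n" by linarith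
  from nrm_add_le[OF Y 2 conjunct1[OF 3] 1 this] show ?case
    using normedD(7)[OF Y 2 conjunct1[OF 3]] by (simp add: algebra_simps)
qed

lemma multilin_increment_le:
  assumes "multilin X Y (length ix) B" "mbound X Y (length ix) \<beta> B" "0 \<le> \<beta>"
    "\<And>i. i \<in> set ix \<Longrightarrow> v i \<in> pts X \<and> nrm X (v i) \<le> R" "\<And>i. i \<in> set ix \<Longrightarrow> w i \<in> pts X \<and> nrm X (w i) \<le> \<kappa>"
    "\<And>i. i \<in> set ix \<Longrightarrow> nrm X (v i + w i) \<le> R"
  shows "nrm Y (B (map (\<lambda>i. v i + w i) ix) - B (map v ix)) \<le> \<beta> * length ix * \<kappa> * R ^ length ix"
  using assms
proof (induction ix arbitrary: B \<beta>)
  case Nil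
  then show ?case using nrm_zero[OF Y] by simp
next
  case (Cons i ix)
  note vw = Cons.prems(4)[of i] Cons.prems(5)[of i]
  let ?n = "length ix" and ?u = "\<lambda>i. v i + w i"
  have u: "?u i \<in> pts X \<and> nrm X (?u i) \<le> R" if "i \<in> set ix" for i
    using Cons.prems(4-6)[of i] that normedD(7)[OF X] by auto
  have nn: "0 \<le> nrm X (v i)" "0 \<le> nrm X (w i)" using vw normedD(2)[OF X] by auto
  have p: "0 \<le> R ^ ?n" "R ^ ?n \<le> R * R ^ ?n" using R by auto
  have "nrm Y (B (w i # map ?u ix)) \<le> \<beta> * nrm X (w i) * R ^ ?n"
    using Cons.prems vw nn u by (intro mbound_map_le[where B = "\<lambda>hs. B (w i # hs)"] mbound_Cons) auto
  also have "\<dots> \<le> \<beta> * \<kappa> * (R * R ^ ?n)"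
    using vw nn Cons.prems(3) p \<kappa> by (intro mult_mono mult_nonneg_nonneg) auto
  finally have 1: "nrm Y (B (w i # map ?u ix)) \<le> \<beta> * \<kappa> * (R * R ^ ?n)" .
  have in_Y: "B hs \<in> pts Y" if "set hs \<subseteq> pts X" "length hs = Suc ?n" for hs
    using multilin_in_pts[OF Cons.prems(1) that(1)] that(2) by simp
  have 2: "B (w i # map ?u ix) \<in> pts Y" and 4: "B (v i # map ?u ix) - B (v i # map v ix) \<in> pts Y"
    using u Cons.prems(4,5) by (auto intro!: normedD(9)[OF Y] in_Y)
  have "nrm Y (B (v i # map ?u ix) - B (v i # map v ix)) \<le> \<beta> * nrm X (v i) * ?n * \<kappa> * R ^ ?n"
    using Cons.prems vw nn by (intro Cons.IH[where B = "\<lambda>hs. B (v i # hs)"] mbound_Cons) auto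
  also have "\<dots> \<le> \<beta> * R * ?n * \<kappa> * R ^ ?n"
    using vw Cons.prems(3) p \<kappa> by (intro mult_right_mono mult_left_mono) auto
  finally have 3: "nrm Y (B (v i # map ?u ix) - B (v i # map v ix)) \<le> \<beta> * R * ?n * \<kappa> * R ^ ?n" .
  have "map ?u ix \<in> lists (pts X)" using u by auto
  then have "B (?u i # map ?u ix) = B (v i # map ?u ix) + B (w i # map ?u ix)"
    using Cons.prems(1) vw by simp
  then have "B (map ?u (i # ix)) - B (map v (i # ix)) =
      B (w i # map ?u ix) + (B (v i # map ?u ix) - B (v i # map v ix))" by simp
  then show ?case using nrm_add_le[OF Y 2 4 1 3] by (simp add: algebra_simps)
qed

text \<open>The first-order Taylor remainder of a multilinear map is of second order in the increment. The bounds
  here and in the two preceding lemmas use one radius \<open>R \<ge> 1\<close> for all arguments, so that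
  passing from \<open>j\<close> to \<open>j + 1\<close> slots costs one more factor \<open>R\<close>.\<close>

lemma multilin_remainder_le:
  assumes "multilin X Y (length ix) B" "mbound X Y (length ix) \<beta> B" "0 \<le> \<beta>"
    "\<And>i. i \<in> set ix \<Longrightarrow> v i \<in> pts X \<and> nrm X (v i) \<le> R" "\<And>i. i \<in> set ix \<Longrightarrow> w i \<in> pts X \<and> nrm X (w i) \<le> \<kappa>"
    "\<And>i. i \<in> set ix \<Longrightarrow> nrm X (v i + w i) \<le> R"
  shows "nrm Y (B (map (\<lambda>i. v i + w i) ix) - B (map v ix) - mderiv B v w ix) \<le> \<beta> * (length ix)\<^sup>2 * \<kappa>\<^sup>2 * R ^ length ix"
  using assms
proof (induction ix arbitrary: B \<beta>)
  case Nil
  then show ?case using nrm_zero[OF Y] by simp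
next
  case (Cons i ix)
  note vw = Cons.prems(4)[of i] Cons.prems(5)[of i]
  let ?n = "length ix" and ?u = "\<lambda>i. v i + w i" and ?D = "mderiv (\<lambda>hs. B (v i # hs)) v w ix"
  have u: "?u i \<in> pts X \<and> nrm X (?u i) \<le> R" if "i \<in> set ix" for i
    using Cons.prems(4-6)[of i] that normedD(7)[OF X] by auto
  have nn: "0 \<le> nrm X (v i)" "0 \<le> nrm X (w i)" using vw normedD(2)[OF X] by auto
  have p: "0 \<le> R ^ ?n" "R ^ ?n \<le> R * R ^ ?n" using R by auto
  have in_Y: "B hs \<in> pts Y" if "set hs \<subseteq> pts X" "length hs = Suc ?n" for hs
    using multilin_in_pts[OF Cons.prems(1) that(1)] that(2) by simp
  have D: "?D \<in> pts Y"
    using mderiv_le[where B = "\<lambda>hs. B (v i # hs)" and \<beta> = "\<beta> * nrm X (v i)" and ix = ix] Cons.prems vw nn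
    by (auto intro: mbound_Cons)
  have 2: "B (w i # map ?u ix) - B (w i # map v ix) \<in> pts Y"
    and 4: "B (v i # map ?u ix) - B (v i # map v ix) - ?D \<in> pts Y"
    using u D Cons.prems(4,5) by (auto intro!: normedD(9)[OF Y] in_Y)
  have "nrm Y (B (w i # map ?u ix) - B (w i # map v ix)) \<le> \<beta> * nrm X (w i) * ?n * \<kappa> * R ^ ?n"
    using Cons.prems vw nn by (intro multilin_increment_le[where B = "\<lambda>hs. B (w i # hs)"] mbound_Cons) auto
  also have "\<dots> \<le> \<beta> * \<kappa> * ?n * \<kappa> * (R * R ^ ?n)"
    using vw nn Cons.prems(3) p \<kappa> by (intro mult_mono mult_nonneg_nonneg) auto
  finally have 1: "nrm Y (B (w i # map ?u ix) - B (w i # map v ix)) \<le> \<beta> * \<kappa> * ?n * \<kappa> * (R * R ^ ?n)" .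
  have "nrm Y (B (v i # map ?u ix) - B (v i # map v ix) - ?D) \<le> \<beta> * nrm X (v i) * ?n\<^sup>2 * \<kappa>\<^sup>2 * R ^ ?n"
    using Cons.prems vw nn by (intro Cons.IH[where B = "\<lambda>hs. B (v i # hs)"] mbound_Cons) auto
  also have "\<dots> \<le> \<beta> * R * ?n\<^sup>2 * \<kappa>\<^sup>2 * R ^ ?n"
    using vw Cons.prems(3) p by (intro mult_right_mono mult_left_mono) auto
  finally have 3: "nrm Y (B (v i # map ?u ix) - B (v i # map v ix) - ?D) \<le> \<beta> * R * ?n\<^sup>2 * \<kappa>\<^sup>2 * R ^ ?n" .
  have "map ?u ix \<in> lists (pts X)" using u by auto
  then have "B (?u i # map ?u ix) = B (v i # map ?u ix) + B (w i # map ?u ix)"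
    using Cons.prems(1) vw by simp
  then have "B (map ?u (i # ix)) - B (map v (i # ix)) - mderiv B v w (i # ix) =
      (B (w i # map ?u ix) - B (w i # map v ix)) + (B (v i # map ?u ix) - B (v i # map v ix) - ?D)" by (simp add: algebra_simps)
  then have "nrm Y (B (map ?u (i # ix)) - B (map v (i # ix)) - mderiv B v w (i # ix))
      \<le> \<beta> * \<kappa> * ?n * \<kappa> * (R * R ^ ?n) + \<beta> * R * ?n\<^sup>2 * \<kappa>\<^sup>2 * R ^ ?n"
    using nrm_add_le[OF Y 2 4 1 3] by (simp only: )
  also have "\<dots> = \<beta> * (?n\<^sup>2 + ?n) * \<kappa>\<^sup>2 * (R * R ^ ?n)" by (simp add: algebra_simps power2_eq_square)
  also have "\<dots> \<le> \<beta> * (Suc ?n)\<^sup>2 * \<kappa>\<^sup>2 * (R * R ^ ?n)"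
    using Cons.prems(3) R by (intro mult_right_mono mult_left_mono) (auto simp: power2_eq_square algebra_simps)
  finally show ?case by simp
qed

end

end

lemma multilin_mderiv_linear:
  assumes "normed X" "multilin X Y (length ix) B" "\<And>i. i \<in> set ix \<Longrightarrow> v i \<in> pts X \<and> w i \<in> pts X \<and> w' i \<in> pts X"
  shows "mderiv B v (\<lambda>i. w i + w' i) ix = mderiv B v w ix + mderiv B v w' ix \<and>
    mderiv B v (\<lambda>i. c *\<^sub>R w i) ix = c *\<^sub>R mderiv B v w ix"
  using assms(2,3)
proof (induction ix arbitrary: B)
  case (Cons i ix)
  have l: "map v ix \<in> lists (pts X)" using Cons.prems(2) by auto
  show ?case
    using Cons.IH[of "\<lambda>hs. B (v i # hs)"] Cons.prems l by (simp add: scaleR_add_right)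
qed simp

section \<open>Higher derivatives as multilinear maps\<close>

text \<open>\<open>d x hs\<close> stands for the derivative of order \<open>length hs\<close> at \<open>x\<close> in the directions \<open>hs\<close>, the
  most recent direction being the head of the list; \<open>d x []\<close> is the map itself. For orders up to
  \<open>n\<close> the derivatives are bounded multilinear and depend continuously on \<open>x\<close> in the operator norm,
  and each one is the derivative of its predecessor, uniformly in the remaining directions.\<close>

definition jet :: "'a::real_vector nspace \<Rightarrow> 'b::real_vector nspace \<Rightarrow> 'a set \<Rightarrow> nat \<Rightarrow> ('a \<Rightarrow> 'a list \<Rightarrow> 'b) \<Rightarrow> bool" where
  "jet X Y U n d \<longleftrightarrow>
     (\<forall>x\<in>U. \<forall>j\<le>n. multilin X Y j (d x) \<and> (\<exists>\<beta>\<ge>0. mbound X Y j \<beta> (d x))) \<and>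
     (\<forall>x\<in>U. \<forall>j\<le>n. \<forall>\<epsilon>>0. \<exists>\<delta>>0. \<forall>y\<in>U. nrm X (y - x) < \<delta> \<longrightarrow>
        mbound X Y j \<epsilon> (\<lambda>hs. d y hs - d x hs)) \<and>
     (\<forall>x\<in>U. \<forall>j<n. \<forall>\<epsilon>>0. \<exists>\<delta>>0. \<forall>h\<in>pts X. nrm X h < \<delta> \<and> x + h \<in> U \<longrightarrow>
        mbound X Y j (\<epsilon> * nrm X h) (\<lambda>hs. d (x + h) hs - d x hs - d x (h # hs)))"

lemma jetD:
  assumes "jet X Y U n d" "x \<in> U"
  shows "j \<le> n \<Longrightarrow> multilin X Y j (d x)" "j \<le> n \<Longrightarrow> \<exists>\<beta>\<ge>0. mbound X Y j \<beta> (d x)"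
    "j \<le> n \<Longrightarrow> \<epsilon> > 0 \<Longrightarrow> \<exists>\<delta>>0. \<forall>y\<in>U. nrm X (y - x) < \<delta> \<longrightarrow> mbound X Y j \<epsilon> (\<lambda>hs. d y hs - d x hs)"
    "j < n \<Longrightarrow> \<epsilon> > 0 \<Longrightarrow> \<exists>\<delta>>0. \<forall>h\<in>pts X. nrm X h < \<delta> \<and> x + h \<in> U \<longrightarrow>
        mbound X Y j (\<epsilon> * nrm X h) (\<lambda>hs. d (x + h) hs - d x hs - d x (h # hs))"
  using assms unfolding jet_def by simp_all

lemma jet_cong:
  assumes X: "normed X" and U: "U \<subseteq> pts X" and d: "jet X Y U n d"
    and eq: "\<And>x hs. x \<in> U \<Longrightarrow> set hs \<subseteq> pts X \<Longrightarrow> length hs \<le> n \<Longrightarrow> d x hs = d' x hs"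
  shows "jet X Y U n d'"
proof -
  have ml: "multilin X Y j (d' x) \<longleftrightarrow> multilin X Y j (d x)" if "x \<in> U" "j \<le> n" for j x
    by (rule multilin_cong[OF X]) (use eq that in auto)
  have mb: "mbound X Y j b (d' x) \<longleftrightarrow> mbound X Y j b (d x)" if "x \<in> U" "j \<le> n" for j b x
    by (rule mbound_cong) (use eq that in auto)
  have mc: "mbound X Y j b (\<lambda>hs. d' y hs - d' x hs) \<longleftrightarrow> mbound X Y j b (\<lambda>hs. d y hs - d x hs)"
    if "x \<in> U" "y \<in> U" "j \<le> n" for j b x y
    by (rule mbound_cong) (use eq that in auto)
  have md: "mbound X Y j b (\<lambda>hs. d' (x + h) hs - d' x hs - d' x (h # hs)) \<longleftrightarrow>
      mbound X Y j b (\<lambda>hs. d (x + h) hs - d x hs - d x (h # hs))"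
    if "x \<in> U" "x + h \<in> U" "h \<in> pts X" "j < n" for j b x h
    by (rule mbound_cong) (use eq that in auto)
  show ?thesis
    using d unfolding jet_def by (simp add: ml mb mc md cong: conj_cong imp_cong ball_cong)
qed

text \<open>The target space that the recursion for $C^k$ maps has reached after \<open>j\<close> differentiations: iterated
  operators, uncurried to functions of a sequence of which only the first \<open>j\<close> entries matter.\<close>

primrec enc_op_space :: "'a::real_vector nspace \<Rightarrow> 'b::real_vector nspace \<Rightarrow> nat \<Rightarrow> ((nat \<Rightarrow> 'a) \<Rightarrow> 'b) nspace" where
  "enc_op_space X Y 0 = push cst uncst Y"
| "enc_op_space X Y (Suc j) = push uncur cur (op_space X (enc_op_space X Y j))"

definition decode :: "((nat \<Rightarrow> 'a::zero) \<Rightarrow> 'b) \<Rightarrow> 'a list \<Rightarrow> 'b" where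
  "decode B hs = B (nth_default 0 hs)"

lemma decode_Cons: "decode B (h # hs) = decode (cur B h) hs"
proof -
  have "nth_default 0 (h # hs) = case_nat h (nth_default 0 hs)"
    by (simp add: fun_eq_iff nth_default_Cons split: nat.split)
  then show ?thesis by (simp add: decode_def cur_def)
qed

lemma decode_diff: "decode (A - B) hs = decode A hs - decode B hs"
  by (simp add: decode_def)

lemma normed_enc_op_space:
  assumes "normed X" "normed Y" shows "normed (enc_op_space X Y j)"
  by (induction j) (auto intro!: normed_push embedding_cst embedding_uncur normed_op_space assms)

text \<open>The iterated operator norm dominates the norm of the multilinear map, one slot per differentiation.\<close>

lemma enc_op_space_multilin:
  assumes X: "normed X" and Y: "normed Y" and B: "B \<in> pts (enc_op_space X Y j)"
  shows "multilin X Y j (decode B) \<and> mbound X Y j (nrm (enc_op_space X Y j) B) (decode B)"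
  using B
proof (induction j arbitrary: B)
  case 0
  then show ?case by (auto simp: decode_def cst_def uncst_def mbound_def)
next
  case (Suc j)
  let ?Z = "enc_op_space X Y j"
  from Suc.prems obtain A where A: "A \<in> pts (op_space X ?Z)" and BA: "B = uncur A" by auto
  have c: "decode B (h # hs) = decode (A h) hs" for h hs by (simp add: decode_Cons BA)
  have n: "nrm (enc_op_space X Y (Suc j)) B = nrm (op_space X ?Z) A" by (simp add: BA)
  have AZ: "A h \<in> pts ?Z" if "h \<in> pts X" for h
    using A that by (auto simp: op_space_def bounded_op_def linear_op_def)
  have lin: "A (a + b) = A a + A b" "A (r *\<^sub>R a) = r *\<^sub>R A a" if "a \<in> pts X" "b \<in> pts X" for a b r
    using A that by (auto simp: op_space_def bounded_op_def linear_op_def)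
  have "multilin X Y (Suc j) (decode B)"
    using Suc.IH[OF AZ] by (simp add: c lin) (simp add: decode_def)
  moreover have "mbound X Y (Suc j) (nrm (op_space X ?Z) A) (decode B)"
    unfolding mbound_def
  proof (intro ballI impI)
    fix hs assume "hs \<in> lists (pts X)" "length hs = Suc j"
    then obtain h hs' where hs: "hs = h # hs'" "h \<in> pts X" "hs' \<in> lists (pts X)" "length hs' = j"
      by (cases hs) auto
    have "0 \<le> prod_list (map (nrm X) hs')"
      using hs(3) normedD(2)[OF X] by (intro prod_list_nonneg) auto
    then have "nrm ?Z (A h) * prod_list (map (nrm X) hs') \<le> nrm (op_space X ?Z) A * nrm X h * prod_list (map (nrm X) hs')"
      using op_space_bound[OF X normed_enc_op_space[OF X Y] A hs(2)] by (rule mult_right_mono[rotated])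
    moreover have "nrm Y (decode (A h) hs') \<le> nrm ?Z (A h) * prod_list (map (nrm X) hs')"
      using Suc.IH[OF AZ[OF hs(2)]] hs(3,4) unfolding mbound_def by blast
    ultimately show "nrm Y (decode B hs) \<le> nrm (op_space X ?Z) A * prod_list (map (nrm X) hs)"
      by (simp add: hs(1) c mult.assoc)
  qed
  ultimately show ?case by (simp only: n)
qed

text \<open>Collects the derivatives, one existential quantifier per step of the recursion, into a
  single sequence. The shift \<open>j\<close> is what the induction on \<open>n\<close> needs.\<close>

lemma C_class_enc_chain:
  assumes X: "normed X" and Y: "normed Y" and U: "U \<subseteq> pts X"
    and C: "C_class_enc n X U (enc_op_space X Y j) f"
  shows "\<exists>g. g 0 = f \<and> (\<forall>i\<le>n. \<forall>x\<in>U. g i x \<in> pts (enc_op_space X Y (j + i))) \<and>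
    (\<forall>i<n. \<forall>x\<in>U. has_fderiv X (enc_op_space X Y (j + i)) U (g i) x (cur (g (Suc i) x))) \<and>
    (\<forall>i\<le>n. \<forall>x\<in>U. \<forall>\<epsilon>>0. \<exists>\<delta>>0. \<forall>y\<in>U. nrm X (y - x) < \<delta> \<longrightarrow>
       nrm (enc_op_space X Y (j + i)) (g i y - g i x) < \<epsilon>)"
  using C
proof (induction n arbitrary: j f)
  case 0
  let ?Z = "enc_op_space X Y j"
  have UX: "U \<inter> pts X = U" using U by blast
  have "continuous_map (subtopology (ntop X) U) (subtopology (ntop ?Z) UNIV) f" using 0 by simp
  from this[unfolded continuous_map_ntop[OF X normed_enc_op_space[OF X Y]] UX Int_UNIV_left] show ?case
    by (intro exI[of _ "\<lambda>_. f"]) (simp only: le_zero_eq add_0_right not_less_zero image_subset_iff simp_thms)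
next
  case (Suc n)
  let ?Z = "enc_op_space X Y"
  note Z = normed_enc_op_space[OF X Y]
  from Suc.prems obtain D where f: "f ` U \<subseteq> pts (?Z j)"
    and D: "\<And>x. x \<in> U \<Longrightarrow> D x \<in> pts (op_space X (?Z j))" "\<And>x. x \<in> U \<Longrightarrow> has_fderiv X (?Z j) U f x (D x)"
    and C: "C_class_enc n X U (?Z (Suc j)) (uncur \<circ> D)" by auto
  from Suc.IH[OF C] obtain g where g: "g 0 = uncur \<circ> D"
    "\<forall>i\<le>n. \<forall>x\<in>U. g i x \<in> pts (?Z (Suc j + i))"
    "\<forall>i<n. \<forall>x\<in>U. has_fderiv X (?Z (Suc j + i)) U (g i) x (cur (g (Suc i) x))"
    "\<forall>i\<le>n. \<forall>x\<in>U. \<forall>\<epsilon>>0. \<exists>\<delta>>0. \<forall>y\<in>U. nrm X (y - x) < \<delta> \<longrightarrow> nrm (?Z (Suc j + i)) (g i y - g i x) < \<epsilon>"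
    by (elim exE conjE) (rule that)
  have c: "\<exists>\<delta>>0. \<forall>y\<in>U. nrm X (y - x) < \<delta> \<longrightarrow> nrm (?Z j) (f y - f x) < \<epsilon>" if "x \<in> U" "\<epsilon> > 0" for x \<epsilon>
    using D[OF that(1)] by (intro has_fderiv_imp_continuous[OF X Z U f _ _ that]) (auto simp: op_space_def)
  show ?case
  proof (intro exI[of _ "case_nat f g"] conjI allI impI)
    fix i
    show "\<forall>x\<in>U. case_nat f g i x \<in> pts (?Z (j + i))" if "i \<le> Suc n"
      using g(2) f that by (cases i) auto
    show "\<forall>x\<in>U. has_fderiv X (?Z (j + i)) U (case_nat f g i) x (cur (case_nat f g (Suc i) x))" if "i < Suc n"
      using g(1,3) D(2) that by (cases i) auto
    show "\<forall>x\<in>U. \<forall>\<epsilon>>0. \<exists>\<delta>>0. \<forall>y\<in>U. nrm X (y - x) < \<delta> \<longrightarrow>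
        nrm (?Z (j + i)) (case_nat f g i y - case_nat f g i x) < \<epsilon>" if "i \<le> Suc n"
    proof (cases i)
      case 0
      then show ?thesis using c by simp
    next
      case (Suc i')
      then show ?thesis using g(4) that by simp
    qed
  qed simp
qed

text \<open>All estimates for the operator-valued derivatives pass to the multilinear maps, since the decoding
  is linear and does not increase norms.\<close>

lemma C_class_imp_jet:
  assumes X: "normed X" and Y: "normed Y" and U: "U \<subseteq> pts X" and C: "C_class n X U Y f"
  shows "\<exists>d. jet X Y U n d \<and> (\<forall>x\<in>U. d x [] = f x)"
proof -
  let ?Z = "enc_op_space X Y"
  note Z = normed_enc_op_space[OF X Y] and M = enc_op_space_multilin[OF X Y]
  have "C_class_enc n X U (?Z 0) (cst \<circ> f)" using C by (simp add: C_class_def)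
  from C_class_enc_chain[OF X Y U this, unfolded add_0] obtain g where g0: "g 0 = cst \<circ> f"
    "\<forall>i\<le>n. \<forall>x\<in>U. g i x \<in> pts (?Z i)"
    "\<forall>i<n. \<forall>x\<in>U. has_fderiv X (?Z i) U (g i) x (cur (g (Suc i) x))"
    "\<forall>i\<le>n. \<forall>x\<in>U. \<forall>\<epsilon>>0. \<exists>\<delta>>0. \<forall>y\<in>U. nrm X (y - x) < \<delta> \<longrightarrow> nrm (?Z i) (g i y - g i x) < \<epsilon>"
    by (elim exE conjE) (rule that)
  note g = g0[rule_format]
  define d where "d x hs = decode (g (length hs) x) hs" for x hs
  have ml: "multilin X Y j (d x) \<longleftrightarrow> multilin X Y j (decode (g j x))" for j x
    by (rule multilin_cong[OF X]) (simp add: d_def)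
  have mb: "mbound X Y j b (d x) \<longleftrightarrow> mbound X Y j b (decode (g j x))" for j x b
    unfolding mbound_def d_def by auto
  show ?thesis
    unfolding jet_def
  proof (intro exI[of _ d] conjI ballI allI impI)
    fix x j assume x: "x \<in> U"
    show "d x [] = f x" by (simp add: d_def g(1) decode_def cst_def)
    { assume j: "j \<le> n"
      note gx = g(2)[OF j x]
      show "multilin X Y j (d x)" using M[OF gx] by (simp add: ml)
      show "\<exists>\<beta>\<ge>0. mbound X Y j \<beta> (d x)"
        using M[OF gx] normedD(2)[OF Z gx] by (auto simp: mb)
      fix \<epsilon> :: real assume e: "\<epsilon> > 0"
      from g(4)[OF j x e] obtain \<delta> where \<delta>: "\<delta> > 0" "\<And>y. y \<in> U \<Longrightarrow> nrm X (y - x) < \<delta> \<Longrightarrow> nrm (?Z j) (g j y - g j x) < \<epsilon>"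
        by blast
      have "mbound X Y j \<epsilon> (\<lambda>hs. d y hs - d x hs)" if y: "y \<in> U" "nrm X (y - x) < \<delta>" for y
      proof -
        have "g j y - g j x \<in> pts (?Z j)" using normedD(9)[OF Z] g(2)[OF j] x y by blast
        from conjunct2[OF M[OF this]] have "mbound X Y j \<epsilon> (decode (g j y - g j x))"
          by (rule mbound_mono[OF X]) (use \<delta>(2)[OF y] in simp)
        then show ?thesis unfolding mbound_def by (auto simp: d_def decode_diff)
      qed
      with \<delta>(1) show "\<exists>\<delta>>0. \<forall>y\<in>U. nrm X (y - x) < \<delta> \<longrightarrow> mbound X Y j \<epsilon> (\<lambda>hs. d y hs - d x hs)" by blast
    }
    fix \<epsilon> :: real assume j: "j < n" and e: "\<epsilon> > 0"
    from g(3)[OF j x] e obtain \<delta> where \<delta>: "\<delta> > 0"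
      "\<And>h. h \<in> pts X \<Longrightarrow> 0 < nrm X h \<Longrightarrow> nrm X h < \<delta> \<Longrightarrow> x + h \<in> U \<Longrightarrow>
        nrm (?Z j) (g j (x + h) - g j x - cur (g (Suc j) x) h) / nrm X h < \<epsilon>"
      unfolding has_fderiv_def by metis
    have "mbound X Y j (\<epsilon> * nrm X h) (\<lambda>hs. d (x + h) hs - d x hs - d x (h # hs))"
      if h: "h \<in> pts X" "nrm X h < \<delta>" "x + h \<in> U" for h
    proof -
      let ?r = "g j (x + h) - g j x - cur (g (Suc j) x) h"
      have "g (Suc j) x \<in> pts (?Z (Suc j))" using g(2)[of "Suc j" x] j x by simp
      then obtain A where A: "A \<in> pts (op_space X (?Z j))" "g (Suc j) x = uncur A" by auto
      have Ah: "A h \<in> pts (?Z j)"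
        using A(1) h by (auto simp: op_space_def bounded_op_def linear_op_def)
      then have r: "?r \<in> pts (?Z j)"
        using A g(2)[of j] j x h by (auto intro!: normedD(9)[OF Z])
      have "nrm (?Z j) ?r \<le> \<epsilon> * nrm X h"
      proof (cases "nrm X h = 0")
        case True
        then have h0: "h = 0" using normedD(3)[OF X h(1)] by simp
        have "A (0 *\<^sub>R 0) = 0 *\<^sub>R A 0"
          using A(1) normedD(6)[OF X] unfolding op_space_def bounded_op_def linear_op_def by fastforce
        then show ?thesis using h0 True A(2) nrm_zero[OF Z] by simp
      next
        case False
        then have "0 < nrm X h" using normedD(2)[OF X h(1)] by simp
        then show ?thesis using \<delta>(2)[OF h(1) _ h(2,3)] by (simp add: divide_simps)
      qed
      with conjunct2[OF M[OF r]] have "mbound X Y j (\<epsilon> * nrm X h) (decode ?r)" by (rule mbound_mono[OF X])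
      then show ?thesis unfolding mbound_def by (auto simp: d_def decode_diff decode_Cons)
    qed
    with \<delta>(1) show "\<exists>\<delta>>0. \<forall>h\<in>pts X. nrm X h < \<delta> \<and> x + h \<in> U \<longrightarrow>
        mbound X Y j (\<epsilon> * nrm X h) (\<lambda>hs. d (x + h) hs - d x hs - d x (h # hs))" by blast
  qed
qed

section \<open>Uniqueness of derivatives on partial quadrants\<close>

text \<open>Two systems of derivatives of the same map, the second with respect to a smaller domain space and a
  smaller target space, agree on the smaller domain. For a direction \<open>h\<close> that stays in the domain
  for small \<open>t > 0\<close> the difference of the two derivatives is a limit of differences of
  difference quotients, which vanish by induction on the order; all other directions are differences of such
  directions.\<close>

lemma jet_unique:
  assumes X: "normed X" and X': "normed X'" and Y: "normed Y" and Y': "normed Y'"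
    and XX: "pts X' \<subseteq> pts X" and YY: "pts Y' \<subseteq> pts Y" and c: "\<And>y. y \<in> pts Y' \<Longrightarrow> nrm Y y \<le> c * nrm Y' y"
    and d: "jet X Y U n d" and d': "jet X' Y' U' n d'" and U: "U' \<subseteq> U"
    and K: "\<And>h. h \<in> K \<Longrightarrow> h \<in> pts X'"
      "\<And>x h. x \<in> U' \<Longrightarrow> h \<in> K \<Longrightarrow> \<exists>\<tau>>0. \<forall>t. 0 < t \<and> t < \<tau> \<longrightarrow> x + t *\<^sub>R h \<in> U'"
      "\<And>h. h \<in> pts X' \<Longrightarrow> \<exists>a\<in>K. \<exists>b\<in>K. h = a - b"
    and base: "\<And>x. x \<in> U' \<Longrightarrow> d x [] = d' x []"
    and x: "x \<in> U'" and hs: "set hs \<subseteq> pts X'" "length hs \<le> n"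
  shows "d x hs = d' x hs"
  using x hs
proof (induction hs arbitrary: x)
  case Nil
  then show ?case using base by simp
next
  case (Cons h hs)
  let ?j = "length hs"
  have hs: "hs \<in> lists (pts X')" "hs \<in> lists (pts X)" "?j < n" using Cons.prems XX by auto
  have sets: "set hs \<subseteq> pts X'" "set hs \<subseteq> pts X" using Cons.prems XX by auto
  have x: "x \<in> U'" "x \<in> U" using Cons.prems U by auto
  have "multilin X Y (Suc ?j) (d x)" "multilin X' Y' (Suc ?j) (d' x)"
    using jetD(1)[OF d x(2)] jetD(1)[OF d' x(1)] hs(3) by (simp_all add: Suc_leI del: multilin.simps)
  then have lin: "a \<in> pts X' \<Longrightarrow> b \<in> pts X' \<Longrightarrow> d x ((a + b) # hs) = d x (a # hs) + d x (b # hs)"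
    "a \<in> pts X' \<Longrightarrow> d x (r *\<^sub>R a # hs) = r *\<^sub>R d x (a # hs)" "a \<in> pts X' \<Longrightarrow> d x (a # hs) \<in> pts Y"
    "a \<in> pts X' \<Longrightarrow> b \<in> pts X' \<Longrightarrow> d' x ((a + b) # hs) = d' x (a # hs) + d' x (b # hs)"
    "a \<in> pts X' \<Longrightarrow> d' x (r *\<^sub>R a # hs) = r *\<^sub>R d' x (a # hs)" "a \<in> pts X' \<Longrightarrow> d' x (a # hs) \<in> pts Y'" for a b r
    using hs(3) sets XX multilin_in_pts[of X Y "Suc ?j" "d x" "a # hs"] multilin_in_pts[of X' Y' "Suc ?j" "d' x" "a # hs"]
      multilin_Cons[of X Y ?j "d x" hs a] multilin_Cons[of X' Y' ?j "d' x" hs a]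
    by (simp_all add: subset_iff del: multilin.simps)
  have cone: "d x (h # hs) = d' x (h # hs)" if h: "h \<in> K" for h
  proof -
    note hX = K(1)[OF h]
    define P where "P = prod_list (map (nrm X) hs)"
    define P' where "P' = prod_list (map (nrm X') hs)"
    define M where "M = nrm X h * P + \<bar>c\<bar> * (nrm X' h * P')"
    have pos: "0 \<le> P" "0 \<le> P'" "0 \<le> nrm X h" "0 \<le> nrm X' h"
      using hs normedD(2)[OF X] normedD(2)[OF X'] hX XX unfolding P_def P'_def
      by (auto intro!: prod_list_nonneg)
    let ?q = "d x (h # hs)" and ?q' = "d' x (h # hs)"
    have q: "?q \<in> pts Y" "?q' \<in> pts Y" using lin(3,6)[OF hX] YY by auto
    have "nrm Y (?q - ?q') \<le> \<epsilon> * M" if e: "\<epsilon> > 0" for \<epsilon>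
    proof -
      obtain \<tau> where \<tau>: "\<tau> > 0" "\<And>t. 0 < t \<Longrightarrow> t < \<tau> \<Longrightarrow> x + t *\<^sub>R h \<in> U'" using K(2)[OF x(1) h] by blast
      obtain \<delta> where \<delta>: "\<delta> > 0" "\<And>h. h \<in> pts X \<Longrightarrow> nrm X h < \<delta> \<Longrightarrow> x + h \<in> U \<Longrightarrow>
          mbound X Y ?j (\<epsilon> * nrm X h) (\<lambda>hs. d (x + h) hs - d x hs - d x (h # hs))"
        using jetD(4)[OF d x(2) hs(3) e] by blast
      obtain \<delta>' where \<delta>': "\<delta>' > 0" "\<And>h. h \<in> pts X' \<Longrightarrow> nrm X' h < \<delta>' \<Longrightarrow> x + h \<in> U' \<Longrightarrow>
          mbound X' Y' ?j (\<epsilon> * nrm X' h) (\<lambda>hs. d' (x + h) hs - d' x hs - d' x (h # hs))"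
        using jetD(4)[OF d' x(1) hs(3) e] by blast
      have "0 < min \<tau> (min (\<delta> / (nrm X h + 1)) (\<delta>' / (nrm X' h + 1)))"
        using \<tau>(1) \<delta>(1) \<delta>'(1) pos by simp
      then obtain t where "0 < t" "t < min \<tau> (min (\<delta> / (nrm X h + 1)) (\<delta>' / (nrm X' h + 1)))"
        using dense by blast
      then have t: "0 < t" "t < \<tau>" and "t < \<delta> / (nrm X h + 1)" "t < \<delta>' / (nrm X' h + 1)" by simp_all
      then have "t * (nrm X h + 1) < \<delta>" "t * (nrm X' h + 1) < \<delta>'" using pos by (auto simp: pos_less_divide_eq)
      then have t2: "nrm X (t *\<^sub>R h) < \<delta>" "nrm X' (t *\<^sub>R h) < \<delta>'"
        using t hX XX pos by (auto simp: normedD(4)[OF X] normedD(4)[OF X'] subsetD distrib_left)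
      have th: "t *\<^sub>R h \<in> pts X'" "t *\<^sub>R h \<in> pts X" using hX XX normedD(8)[OF X'] by auto
      have xt: "x + t *\<^sub>R h \<in> U'" "x + t *\<^sub>R h \<in> U" using \<tau>(2)[OF t] U by auto
      define r where "r = d (x + t *\<^sub>R h) hs - d x hs - t *\<^sub>R ?q"
      define r' where "r' = d' (x + t *\<^sub>R h) hs - d' x hs - t *\<^sub>R ?q'"
      have "nrm X (t *\<^sub>R h) = t * nrm X h" "nrm X' (t *\<^sub>R h) = t * nrm X' h"
        using t(1) hX XX by (auto simp: normedD(4)[OF X] normedD(4)[OF X'] subsetD)
      then have rb: "nrm Y r \<le> \<epsilon> * (t * nrm X h) * P" "nrm Y' r' \<le> \<epsilon> * (t * nrm X' h) * P'"
        using \<delta>(2)[OF th(2) t2(1) xt(2)] \<delta>'(2)[OF th(1) t2(2) xt(1)] hs(1,2) lin(2,5)[OF hX]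
        unfolding mbound_def r_def r'_def P_def P'_def by auto
      have eq: "d (x + t *\<^sub>R h) hs = d' (x + t *\<^sub>R h) hs" "d x hs = d' x hs"
        using Cons.IH xt(1) x(1) Cons.prems by auto
      have in_Y': "d' y hs \<in> pts Y'" if "y \<in> U'" for y
        using multilin_in_pts[OF jetD(1)[OF d' that] sets(1) refl] hs(3) by simp
      have r'Y': "r' \<in> pts Y'"
        unfolding r'_def using xt x lin(6)[OF hX] by (intro normedD(8,9)[OF Y'] in_Y') auto
      \<comment> \<open>The increments of the two systems cancel, since they agree in order \<open>length hs\<close>.\<close>
      have qr: "t *\<^sub>R (?q - ?q') = r' - r" unfolding r_def r'_def eq by (simp add: algebra_simps)
      have rY: "r \<in> pts Y"
      proof -
        have "r = r' - t *\<^sub>R (?q - ?q')" using qr by simp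
        then show ?thesis using r'Y' YY q normedD(8,9)[OF Y] by auto
      qed
      have "t * nrm Y (?q - ?q') = nrm Y (t *\<^sub>R (?q - ?q'))"
        using t(1) q normedD(9)[OF Y] by (simp add: normedD(4)[OF Y])
      also have "\<dots> \<le> nrm Y r' + nrm Y r" unfolding qr using r'Y' rY YY by (intro nrm_diff_le[OF Y]) auto
      also have "\<dots> \<le> \<bar>c\<bar> * (\<epsilon> * (t * nrm X' h) * P') + \<epsilon> * (t * nrm X h) * P"
      proof (rule add_mono[OF _ rb(1)])
        have "nrm Y r' \<le> \<bar>c\<bar> * nrm Y' r'"
          using c[OF r'Y'] mult_right_mono[of c "\<bar>c\<bar>" "nrm Y' r'"] normedD(2)[OF Y' r'Y'] by linarith
        also have "\<dots> \<le> \<bar>c\<bar> * (\<epsilon> * (t * nrm X' h) * P')" using rb(2) by (intro mult_left_mono) auto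
        finally show "nrm Y r' \<le> \<bar>c\<bar> * (\<epsilon> * (t * nrm X' h) * P')" .
      qed
      also have "\<dots> = t * (\<epsilon> * M)" unfolding M_def by (simp add: algebra_simps)
      finally show ?thesis using t(1) by simp
    qed
    \<comment> \<open>The bound holds for every positive \<open>\<epsilon>\<close>, and \<open>M\<close> does not depend on it.\<close>
    moreover have "((\<lambda>\<epsilon>. \<epsilon> * M) \<longlongrightarrow> 0 * M) (at_right 0)" by (intro tendsto_intros)
    ultimately have "nrm Y (?q - ?q') \<le> 0 * M"
      by (intro tendsto_lowerbound[where F = "at_right 0" and f = "\<lambda>\<epsilon>. \<epsilon> * M"])
        (auto simp: eventually_at_right_less intro!: eventually_mono[OF eventually_at_right_less])
    then have "nrm Y (?q - ?q') = 0" using normedD(2)[OF Y normedD(9)[OF Y q]] by simp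
    then show ?thesis using normedD(3)[OF Y normedD(9)[OF Y q]] by simp
  qed
  obtain a b where ab: "a \<in> K" "b \<in> K" "h = a - b" using K(3)[of h] Cons.prems by auto
  then have h: "h = a + (-1) *\<^sub>R b" by simp
  have b': "(-1) *\<^sub>R b \<in> pts X'" using K(1)[OF ab(2)] normedD(8)[OF X'] by blast
  show ?case
    unfolding h lin(1)[OF K(1)[OF ab(1)] b'] lin(4)[OF K(1)[OF ab(1)] b'] lin(2,5)[OF K(1)[OF ab(2)]]
    by (simp only: cone ab(1,2))
qed

text \<open>In coordinates, \<open>C\<close> consists of the pairs whose \<open>\<real>\<^sup>n\<close> part is nonnegative. It
  is therefore closed under adding nonnegative multiples of its elements, and splitting the
  \<open>\<real>\<^sup>n\<close> part into positive and negative part writes any vector as a difference of two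
  elements, without leaving the level.\<close>

lemma partial_quadrant_cone:
  assumes E: "sc_banach E" and C: "partial_quadrant TYPE('w::real_vector) E C"
    and U: "openin (subtopology (ntop (E 0)) C) U"
  shows "x \<in> U \<inter> pts (E m) \<Longrightarrow> h \<in> C \<inter> pts (E m) \<Longrightarrow>
      \<exists>\<tau>>0. \<forall>t. 0 < t \<and> t < \<tau> \<longrightarrow> x + t *\<^sub>R h \<in> U \<inter> pts (E m)"
    and "h \<in> pts (E m) \<Longrightarrow> \<exists>a\<in>C \<inter> pts (E m). \<exists>b\<in>C \<inter> pts (E m). h = a - b"
proof -
  note nE = sc_banach_normed[OF E]
  note N = normedD[OF nE]
  obtain W :: "'w scspace" and n T where W: "sc_banach W" and T: "sc_iso E (sc_sum (euclid n) W) T"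
    and TC: "T ` C = {a \<in> pts (euclid n 0). \<forall>i<n. 0 \<le> a i} \<times> pts (W 0)"
    and "closedin (ntop (E 0)) C"
    using C unfolding partial_quadrant_def by blast
  then have C0: "C \<subseteq> pts (E 0)" using closedin_subset[of "ntop (E 0)" C] nE by simp
  have lev0: "pts (E m) \<subseteq> pts (E 0)" for m using nested_mono[OF sc_banach_nested[OF E], of 0 m] by simp
  have eu: "normed (euclid n m)" for m
  proof -
    have "L2_set x {..<n} = 0 \<longleftrightarrow> x = 0" if "\<forall>i\<ge>n. x i = 0" for x :: "nat \<Rightarrow> real"
      using that by (auto simp: L2_set_eq_0_iff fun_eq_iff) (metis lessThan_iff not_le)
    moreover have "L2_set (x + y) {..<n} \<le> L2_set x {..<n} + L2_set y {..<n}" for x y :: "nat \<Rightarrow> real"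
      using L2_set_triangle_ineq[of x y "{..<n}"] by (simp add: plus_fun_def)
    ultimately show ?thesis
      unfolding normed_def euclid_def
      by (auto intro!: subspaceI simp: L2_set_right_distrib[symmetric] L2_set_nonneg)
         (simp add: L2_set_def power_mult_distrib sum_distrib_left[symmetric] real_sqrt_mult)
  qed
  let ?G = "sc_sum (euclid n) W"
  have nG: "normed (?G m)" for m unfolding sc_sum_def by (rule normed_direct_sum[OF eu sc_banach_normed[OF W]])
  have ptsG: "pts (?G m) = {a. \<forall>i\<ge>n. a i = 0} \<times> pts (W m)" for m
    by (simp add: sc_sum_def direct_sum_def euclid_def)
  define S where "S = the_inv_into (pts (E 0)) T"
  have bij: "bij_betw T (pts (E 0)) (pts (?G 0))" and oT: "sc_operator E ?G T" and oS: "sc_operator ?G E S"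
    using T unfolding sc_iso_def S_def by auto
  have inj: "inj_on T (pts (E 0))" using bij by (rule bij_betw_imp_inj_on)
  have ST: "S (T x) = x" if "x \<in> pts (E 0)" for x unfolding S_def by (rule the_inv_into_f_f[OF inj that])
  have TS: "T (S y) = y" if "y \<in> pts (?G 0)" for y
    unfolding S_def using that bij by (intro f_the_inv_into_f[OF inj]) (auto simp: bij_betw_def)
  have lin: "T (x + y) = T x + T y" "T (c *\<^sub>R x) = c *\<^sub>R T x" if "x \<in> pts (E 0)" "y \<in> pts (E 0)" for x y c
    using oT that unfolding sc_operator_def linear_op_def by auto
  have levT: "T x \<in> pts (?G m)" if "x \<in> pts (E m)" for x m
    using oT that nE nG continuous_map_image_subset_topspace[of "ntop (E m)" "ntop (?G m)" T]
    unfolding sc_operator_def by auto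
  have levS: "S y \<in> pts (E m)" if "y \<in> pts (?G m)" for y m
    using oS that nE nG continuous_map_image_subset_topspace[of "ntop (?G m)" "ntop (E m)" S]
    unfolding sc_operator_def by auto
  have inC: "x \<in> C \<longleftrightarrow> (\<forall>i<n. 0 \<le> fst (T x) i)" if x: "x \<in> pts (E 0)" for x
  proof -
    have "x \<in> C \<longleftrightarrow> T x \<in> T ` C" using inj_on_image_mem_iff[OF inj x C0] by simp
    then show ?thesis unfolding TC using levT[OF x] by (cases "T x") (auto simp: ptsG euclid_def)
  qed
  {
    assume x: "x \<in> U \<inter> pts (E m)" and h: "h \<in> C \<inter> pts (E m)"
    have h0: "h \<in> pts (E 0)" and x0: "x \<in> pts (E 0)" using h x lev0 by auto
    obtain V where V: "openin (ntop (E 0)) V" "U = V \<inter> C" using U by (auto simp: openin_subtopology)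
    then obtain r where r: "r > 0" "\<And>y. y \<in> pts (E 0) \<Longrightarrow> nrm (E 0) (x - y) < r \<Longrightarrow> y \<in> V"
      using x unfolding openin_ntop[OF nE] by blast
    show "\<exists>\<tau>>0. \<forall>t. 0 < t \<and> t < \<tau> \<longrightarrow> x + t *\<^sub>R h \<in> U \<inter> pts (E m)"
    proof (intro exI conjI allI impI)
      have p: "0 \<le> nrm (E 0) h" by (rule N(2)[OF h0])
      then show "0 < r / (nrm (E 0) h + 1)" using r(1) by simp
      fix t assume t: "0 < t \<and> t < r / (nrm (E 0) h + 1)"
      have xt: "x + t *\<^sub>R h \<in> pts (E m)" using x h N(7,8) by auto
      have "nrm (E 0) (x - (x + t *\<^sub>R h)) = t * nrm (E 0) h"
        using nrm_minus_commute[OF nE, of x 0 "x + t *\<^sub>R h"] x0 xt lev0 t N(4)[OF h0, of t] by auto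
      also have "\<dots> < r" using t p by (simp add: field_simps)
      finally have "x + t *\<^sub>R h \<in> V" using r(2)[of "x + t *\<^sub>R h"] xt lev0 by blast
      moreover have "x + t *\<^sub>R h \<in> C"
      proof -
        have "T (x + t *\<^sub>R h) = T x + t *\<^sub>R T h" using lin(1)[OF x0 N(8)[OF h0]] lin(2)[OF h0 h0] by simp
        then show ?thesis
          using inC[of "x + t *\<^sub>R h"] inC[OF x0] inC[OF h0] x h V(2) t xt lev0 by auto
      qed
      ultimately show "x + t *\<^sub>R h \<in> U \<inter> pts (E m)" using V(2) xt by blast
    qed
  }
  assume h: "h \<in> pts (E m)"
  obtain \<alpha> w where Th: "T h = (\<alpha>, w)" by (cases "T h")
  then have aw: "\<forall>i\<ge>n. \<alpha> i = 0" "w \<in> pts (W m)" using levT[OF h] by (auto simp: ptsG)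
  define p where "p = (\<lambda>i. max (\<alpha> i) 0, w)"
  define q where "q = (\<lambda>i. max (- \<alpha> i) 0, 0 :: 'w)"
  have pq: "p \<in> pts (?G m)" "q \<in> pts (?G m)"
    using aw normedD(6)[OF sc_banach_normed[OF W]] by (auto simp: ptsG p_def q_def)
  have G0: "pts (?G m) \<subseteq> pts (?G 0)"
    using nested_mono[OF sc_banach_nested[OF W], of 0 m] by (auto simp: ptsG)
  note s = levS[OF pq(1)] levS[OF pq(2)]
  have s0: "S p \<in> pts (E 0)" "S q \<in> pts (E 0)" using s lev0 by blast+
  have TSp: "T (S p) = p" "T (S q) = q" using pq G0 by (auto intro!: TS simp del: split_paired_All)
  have C': "S p \<in> C" "S q \<in> C"
    using s lev0 inC[of "S p"] inC[of "S q"] TSp by (auto simp: p_def q_def)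
  have "T (S p - S q) = p - q"
    using lin(1)[of "S p" "(-1) *\<^sub>R S q"] lin(2)[of "S q" "S q" "-1"] s0 TSp N(8)[OF s0(2), of "-1"] by simp
  also have "p - q = T h" by (auto simp: p_def q_def Th fun_eq_iff max_def)
  finally have "h = S p - S q" using inj h s lev0 N(9)[OF s] by (metis inj_onD subsetD)
  then show "\<exists>a\<in>C \<inter> pts (E m). \<exists>b\<in>C \<inter> pts (E m). h = a - b" using C' s by blast
qed

text \<open>The derivative of order \<open>j \<ge> 1\<close> is taken from the largest space on which it is given, namely
  from the $C^j$ map from \<open>U\<^sub>j\<^sub>-\<^sub>1\<close> to \<open>F\<^sub>0\<close>; by uniqueness all others are its restrictions.\<close>

lemma ex_coherent_jet:
  fixes E :: "'a::real_vector scspace" and F :: "'b::real_vector scspace"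
  assumes E: "sc_banach E" and F: "sc_banach F"
    and C: "partial_quadrant TYPE('w::real_vector) E C" and U: "openin (subtopology (ntop (E 0)) C) U"
    and f: "\<And>l m. l \<le> k \<Longrightarrow> C_class (l + 1) (E (m + l)) (U \<inter> pts (E (m + l))) (F m) f"
  shows "\<exists>d. (\<forall>x. d x [] = f x) \<and>
    (\<forall>m l. l \<le> k \<longrightarrow> jet (E (m + l)) (F m) (U \<inter> pts (E (m + l))) (Suc l) d)"
proof -
  note nE = sc_banach_normed[OF E] and nF = sc_banach_normed[OF F]
  note cone = partial_quadrant_cone[OF E C U]
  define D where "D m l = (SOME d. jet (E (m + l)) (F m) (U \<inter> pts (E (m + l))) (Suc l) d \<and>
    (\<forall>x\<in>U \<inter> pts (E (m + l)). d x [] = f x))" for m l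
  have D: "jet (E (m + l)) (F m) (U \<inter> pts (E (m + l))) (Suc l) (D m l)"
    "x \<in> U \<inter> pts (E (m + l)) \<Longrightarrow> D m l x [] = f x" if l: "l \<le> k" for m l x
  proof -
    have "\<exists>d. jet (E (m + l)) (F m) (U \<inter> pts (E (m + l))) (Suc l) d \<and> (\<forall>x\<in>U \<inter> pts (E (m + l)). d x [] = f x)"
      using C_class_imp_jet[OF nE nF Int_lower2 f[OF l]] by simp
    note * = someI_ex[OF this, folded D_def]
    show "jet (E (m + l)) (F m) (U \<inter> pts (E (m + l))) (Suc l) (D m l)" by (rule conjunct1[OF *])
    show "x \<in> U \<inter> pts (E (m + l)) \<Longrightarrow> D m l x [] = f x" by (rule conjunct2[OF *, rule_format])
  qed
  define d where "d x hs = (if hs = [] then f x else D 0 (length hs - 1) x hs)" for x hs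
  have "jet (E (m + l)) (F m) (U \<inter> pts (E (m + l))) (Suc l) d" if l: "l \<le> k" for m l
  proof (rule jet_cong[OF nE _ D(1)[OF l]])
    fix x hs assume x: "x \<in> U \<inter> pts (E (m + l))" and hs: "set hs \<subseteq> pts (E (m + l))" "length hs \<le> Suc l"
    show "D m l x hs = d x hs"
    proof (cases "hs = []")
      case True
      then show ?thesis using D(2)[OF l x] by (simp add: d_def)
    next
      case False
      define i where "i = length hs - 1"
      have i: "length hs = Suc i" "i \<le> l" using False hs(2) by (auto simp: i_def Suc_le_eq)
      obtain c where c: "\<And>y. y \<in> pts (F m) \<Longrightarrow> nrm (F 0) y \<le> c * nrm (F m) y"
        using nrm_le_higher_level[OF F, of 0 m] by auto
      have sub: "pts (E (m + l)) \<subseteq> pts (E (0 + i))" "pts (F m) \<subseteq> pts (F 0)"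
        using i by (intro nested_mono[OF sc_banach_nested] E F; simp)+
      have "jet (E (m + l)) (F m) (U \<inter> pts (E (m + l))) (Suc i) (D m l)"
        using D(1)[OF l, of m] i(2) unfolding jet_def by simp
      moreover have "U \<inter> pts (E (m + l)) \<subseteq> U \<inter> pts (E (0 + i))" using sub by auto
      moreover have "D 0 i y [] = D m l y []" if "y \<in> U \<inter> pts (E (m + l))" for y
        using D(2)[of i y 0] D(2)[OF l that] l i(2) that sub by auto
      ultimately have "D 0 i x hs = D m l x hs"
        using jet_unique[OF nE nE nF nF sub c D(1)[of i 0], of "U \<inter> pts (E (m + l))" "D m l" "C \<inter> pts (E (m + l))" x hs]
          cone l i sub x hs by auto
      then show ?thesis using False by (simp add: d_def i_def)
    qed
  qed auto
  then show ?thesis by (intro exI[of _ d]) (auto simp: d_def)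
qed

section \<open>Iterated tangent spaces\<close>

text \<open>The iterated tangent spaces of \<open>E\<close>, up to the encoding of pairs by interleaving: a tuple has \<open>N\<close>
  entries, and entry \<open>i\<close> is shifted by \<open>s i\<close> levels.\<close>

definition tuple_space :: "nat \<Rightarrow> (nat \<Rightarrow> nat) \<Rightarrow> 'a::real_vector scspace \<Rightarrow> (nat \<Rightarrow> 'a) scspace" where
  "tuple_space N s E m = \<lparr>pts = {v. (\<forall>i<N. v i \<in> pts (E (s i + m))) \<and> (\<forall>i\<ge>N. v i = 0)},
     nrm = (\<lambda>v. \<Sum>i<N. nrm (E (s i + m)) (v i))\<rparr>"

definition tuple_set :: "nat \<Rightarrow> (nat \<Rightarrow> nat) \<Rightarrow> 'a::real_vector scspace \<Rightarrow> 'a set \<Rightarrow> (nat \<Rightarrow> 'a) set" where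
  "tuple_set N s E U = {v \<in> pts (tuple_space N s E 0). v 0 \<in> U}"

text \<open>Base points sit at even positions and are shifted up once more, directions at odd positions.\<close>

definition tan_shift :: "(nat \<Rightarrow> nat) \<Rightarrow> nat \<Rightarrow> nat" where
  "tan_shift s n = (if even n then Suc (s (n div 2)) else s (n div 2))"

lemma tan_shift_simps [simp]: "tan_shift s (2 * n) = Suc (s n)" "tan_shift s (Suc (2 * n)) = s n"
  by (simp_all add: tan_shift_def)

lemma join_simps [simp]: "join (v, w) (2 * n) = v n" "join (v, w) (Suc (2 * n)) = w n" "join (v, w) 0 = v 0"
  by (simp_all add: join_def)

lemma unjoin_simps [simp]: "fst (unjoin v) n = v (2 * n)" "snd (unjoin v) n = v (Suc (2 * n))"
  by (simp_all add: unjoin_def)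

lemma pts_tuple_space: "v \<in> pts (tuple_space N s E m) \<longleftrightarrow> (\<forall>i<N. v i \<in> pts (E (s i + m))) \<and> (\<forall>i\<ge>N. v i = 0)"
  by (simp add: tuple_space_def)

lemma nrm_tuple_space: "nrm (tuple_space N s E m) v = (\<Sum>i<N. nrm (E (s i + m)) (v i))"
  by (simp add: tuple_space_def)

lemma nested_tuple_space:
  assumes E: "nested E" shows "nested (tuple_space N s E)"
  unfolding nested_def
proof (intro conjI allI subsetI)
  note N = normedD[OF nestedD(1)[OF E]]
  fix m
  show "normed (tuple_space N s E m)"
    unfolding normed_def
  proof (intro conjI ballI allI)
    show "subspace (pts (tuple_space N s E m))" by (intro subspaceI) (auto simp: pts_tuple_space N)
    fix v assume v: "v \<in> pts (tuple_space N s E m)"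
    then have p: "0 \<le> nrm (E (s i + m)) (v i)" if "i < N" for i using that by (simp add: pts_tuple_space N)
    then show "0 \<le> nrm (tuple_space N s E m) v" unfolding nrm_tuple_space by (intro sum_nonneg) auto
    have "nrm (tuple_space N s E m) v = 0 \<longleftrightarrow> (\<forall>i<N. v i = 0)"
      unfolding nrm_tuple_space using p v by (subst sum_nonneg_eq_0_iff) (auto simp: pts_tuple_space N)
    also have "\<dots> \<longleftrightarrow> v = 0" using v by (auto simp: fun_eq_iff pts_tuple_space) (metis not_le)
    finally show "(nrm (tuple_space N s E m) v = 0) \<longleftrightarrow> v = 0" .
    show "nrm (tuple_space N s E m) (c *\<^sub>R v) = \<bar>c\<bar> * nrm (tuple_space N s E m) v" for c
      using v by (simp add: nrm_tuple_space sum_distrib_left pts_tuple_space N)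
    fix w assume "w \<in> pts (tuple_space N s E m)"
    then show "nrm (tuple_space N s E m) (v + w) \<le> nrm (tuple_space N s E m) v + nrm (tuple_space N s E m) w"
      unfolding nrm_tuple_space sum.distrib[symmetric] using v by (intro sum_mono) (auto simp: pts_tuple_space N)
  qed
  show "v \<in> pts (tuple_space N s E m)" if "v \<in> pts (tuple_space N s E (Suc m))" for v
    using that nestedD(2)[OF E] by (auto simp: pts_tuple_space)
qed

lemma sum_lessThan_double: "(\<Sum>n<2 * N. f n) = (\<Sum>n<N. f (2 * n)) + (\<Sum>n<N. f (Suc (2 * n)))" for f :: "nat \<Rightarrow> real"
  by (induction N) simp_all

lemma all_double: "(\<forall>n. P n) \<longleftrightarrow> (\<forall>n. P (2 * n) \<and> P (Suc (2 * n)))" for P :: "nat \<Rightarrow> bool"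
  by (metis evenE oddE Suc_eq_plus1)

lemma join_tuple_space:
  "v \<in> pts (tuple_space (2 * N) (tan_shift s) E m) \<longleftrightarrow>
     fst (unjoin v) \<in> pts (tuple_space N s E (Suc m)) \<and> snd (unjoin v) \<in> pts (tuple_space N s E m)"
proof -
  have "v \<in> pts (tuple_space (2 * N) (tan_shift s) E m) \<longleftrightarrow>
      (\<forall>i. (i < 2 * N \<longrightarrow> v i \<in> pts (E (tan_shift s i + m))) \<and> (i \<ge> 2 * N \<longrightarrow> v i = 0))"
    unfolding pts_tuple_space by blast
  also have "\<dots> \<longleftrightarrow> (\<forall>i. (i < N \<longrightarrow> v (2 * i) \<in> pts (E (s i + Suc m))) \<and> (i \<ge> N \<longrightarrow> v (2 * i) = 0) \<and>
      (i < N \<longrightarrow> v (Suc (2 * i)) \<in> pts (E (s i + m))) \<and> (i \<ge> N \<longrightarrow> v (Suc (2 * i)) = 0))"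
  proof (subst all_double, rule iff_allI)
    fix i
    have "Suc (2 * i) < 2 * N \<longleftrightarrow> i < N" "2 * N \<le> Suc (2 * i) \<longleftrightarrow> N \<le> i" by arith+
    then show "((2 * i < 2 * N \<longrightarrow> v (2 * i) \<in> pts (E (tan_shift s (2 * i) + m))) \<and> (2 * N \<le> 2 * i \<longrightarrow> v (2 * i) = 0)) \<and>
         (Suc (2 * i) < 2 * N \<longrightarrow> v (Suc (2 * i)) \<in> pts (E (tan_shift s (Suc (2 * i)) + m))) \<and>
         (2 * N \<le> Suc (2 * i) \<longrightarrow> v (Suc (2 * i)) = 0) \<longleftrightarrow>
         (i < N \<longrightarrow> v (2 * i) \<in> pts (E (s i + Suc m))) \<and> (N \<le> i \<longrightarrow> v (2 * i) = 0) \<and>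
         (i < N \<longrightarrow> v (Suc (2 * i)) \<in> pts (E (s i + m))) \<and> (N \<le> i \<longrightarrow> v (Suc (2 * i)) = 0)"
      by simp
  qed
  also have "\<dots> \<longleftrightarrow> fst (unjoin v) \<in> pts (tuple_space N s E (Suc m)) \<and> snd (unjoin v) \<in> pts (tuple_space N s E m)"
    unfolding pts_tuple_space unjoin_simps by blast
  finally show ?thesis .
qed

lemma join_image_iff: "v \<in> join ` S \<longleftrightarrow> unjoin v \<in> S"
  by (metis image_iff join_unjoin unjoin_join)

lemma push_join_tuple_space:
  "push join unjoin \<circ> tangent_space (tuple_space N s E) = tuple_space (2 * N) (tan_shift s) E"
proof
  fix m
  have "pts ((push join unjoin \<circ> tangent_space (tuple_space N s E)) m) = pts (tuple_space (2 * N) (tan_shift s) E m)"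
    by (auto simp: join_image_iff join_tuple_space pts_tangent_space mem_Times_iff)
  moreover have "nrm ((push join unjoin \<circ> tangent_space (tuple_space N s E)) m) = nrm (tuple_space (2 * N) (tan_shift s) E m)"
    by (rule ext) (simp add: nrm_tuple_space sum_lessThan_double tangent_space_def sc_sum_def direct_sum_def case_prod_beta)
  ultimately show "(push join unjoin \<circ> tangent_space (tuple_space N s E)) m = tuple_space (2 * N) (tan_shift s) E m"
    by simp
qed

lemma push_leaf_tuple_space: "push leaf unleaf \<circ> E = tuple_space 1 (\<lambda>_. 0) E"
proof
  fix m
  have "v \<in> leaf ` pts (E m) \<longleftrightarrow> v \<in> pts (tuple_space 1 (\<lambda>_. 0) E m)" for v
  proof
    assume "v \<in> pts (tuple_space 1 (\<lambda>_. 0) E m)"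
    then have "v 0 \<in> pts (E m)" "v = leaf (v 0)" by (auto simp: pts_tuple_space leaf_def fun_eq_iff)
    then show "v \<in> leaf ` pts (E m)" by blast
  qed (auto simp: pts_tuple_space leaf_def)
  then have "pts ((push leaf unleaf \<circ> E) m) = pts (tuple_space 1 (\<lambda>_. 0) E m)" by auto
  moreover have "nrm ((push leaf unleaf \<circ> E) m) = nrm (tuple_space 1 (\<lambda>_. 0) E m)"
    by (simp add: nrm_tuple_space fun_eq_iff unleaf_def)
  ultimately show "(push leaf unleaf \<circ> E) m = tuple_space 1 (\<lambda>_. 0) E m" by simp
qed

lemma join_tuple_set:
  assumes E: "nested E"
  shows "join ` tangent_set (tuple_space N s E) (tuple_set N s E U) = tuple_set (2 * N) (tan_shift s) E U"
proof (rule set_eqI)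
  fix v
  have "pts (tuple_space N s E 1) \<subseteq> pts (tuple_space N s E 0)"
    using nestedD(2)[OF nested_tuple_space[OF E], of N s 0] by simp
  then show "v \<in> join ` tangent_set (tuple_space N s E) (tuple_set N s E U) \<longleftrightarrow> v \<in> tuple_set (2 * N) (tan_shift s) E U"
    by (auto simp: join_image_iff tangent_set_def tuple_set_def mem_Times_iff join_tuple_space)
qed

lemma leaf_tuple_set:
  assumes U: "U \<subseteq> pts (E 0)" shows "leaf ` U = tuple_set 1 (\<lambda>_. 0) E U"
proof (rule set_eqI)
  fix v
  have "v \<in> pts (tuple_space 1 (\<lambda>_. 0) E 0) \<longleftrightarrow> v \<in> leaf ` pts (E 0)"
    unfolding push_leaf_tuple_space[symmetric] by simp
  then show "v \<in> leaf ` U \<longleftrightarrow> v \<in> tuple_set 1 (\<lambda>_. 0) E U"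
    using U by (auto simp: tuple_set_def leaf_def)
qed

lemma join_tuple_pts:
  assumes E: "nested E"
  shows "join ` tangent_set (tuple_space N s E) (pts (tuple_space N s E 0)) = pts (tuple_space (2 * N) (tan_shift s) E 0)"
proof (rule set_eqI)
  fix v
  have "pts (tuple_space N s E 1) \<subseteq> pts (tuple_space N s E 0)"
    using nestedD(2)[OF nested_tuple_space[OF E], of N s 0] by simp
  then show "v \<in> join ` tangent_set (tuple_space N s E) (pts (tuple_space N s E 0)) \<longleftrightarrow>
      v \<in> pts (tuple_space (2 * N) (tan_shift s) E 0)"
    by (auto simp: join_image_iff tangent_set_def mem_Times_iff join_tuple_space)
qed

text \<open>One constant serves all entries that lie at least on level \<open>b\<close>. Every estimate for a tuple is
  reduced by it to an estimate in the single Banach space \<open>E b\<close>.\<close>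

lemma tuple_space_component_bound:
  assumes E: "sc_banach E"
  shows "\<exists>c>0. \<forall>v\<in>pts (tuple_space N s E m). \<forall>i<N. b \<le> s i + m \<longrightarrow>
    v i \<in> pts (E b) \<and> nrm (E b) (v i) \<le> c * nrm (tuple_space N s E m) v"
proof -
  note nE = sc_banach_normed[OF E]
  have "\<forall>i. \<exists>c. b \<le> s i + m \<longrightarrow> 0 < c \<and> (\<forall>x\<in>pts (E (s i + m)). nrm (E b) x \<le> c * nrm (E (s i + m)) x)"
    using nrm_le_higher_level[OF E] by blast
  then obtain c where c: "\<And>i. b \<le> s i + m \<Longrightarrow> 0 < c i \<and> (\<forall>x\<in>pts (E (s i + m)). nrm (E b) x \<le> c i * nrm (E (s i + m)) x)"
    by metis
  define C where "C = 1 + (\<Sum>i<N. \<bar>c i\<bar>)"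
  have C: "\<bar>c i\<bar> \<le> C" if "i < N" for i
    using member_le_sum[of i "{..<N}" "\<lambda>i. \<bar>c i\<bar>"] that by (simp add: C_def)
  have "v i \<in> pts (E b) \<and> nrm (E b) (v i) \<le> C * nrm (tuple_space N s E m) v"
    if v: "v \<in> pts (tuple_space N s E m)" and i: "i < N" "b \<le> s i + m" for v i
  proof
    have vi: "v j \<in> pts (E (s j + m))" if "j < N" for j using v that by (simp add: pts_tuple_space)
    show "v i \<in> pts (E b)" using vi[OF i(1)] nested_mono[OF sc_banach_nested[OF E] i(2)] by blast
    have "nrm (E (s i + m)) (v i) \<le> nrm (tuple_space N s E m) v"
      unfolding nrm_tuple_space using i(1) vi normedD(2)[OF nE]
      by (intro member_le_sum[of i "{..<N}" "\<lambda>i. nrm (E (s i + m)) (v i)"]) auto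
    moreover have "nrm (E b) (v i) \<le> \<bar>c i\<bar> * nrm (E (s i + m)) (v i)" using c[OF i(2)] vi[OF i(1)] by auto
    moreover have "0 \<le> nrm (E (s i + m)) (v i)" using normedD(2)[OF nE vi[OF i(1)]] .
    ultimately show "nrm (E b) (v i) \<le> C * nrm (tuple_space N s E m) v"
      using C[OF i(1)] mult_mono[of "\<bar>c i\<bar>" C "nrm (E (s i + m)) (v i)" "nrm (tuple_space N s E m) v"] by linarith
  qed
  moreover have "C > 0" unfolding C_def by (simp add: sum_nonneg add_pos_nonneg)
  ultimately show ?thesis by blast
qed

section \<open>Neighbourhood filters\<close>

text \<open>With the neighbourhoods of a point as a filter, continuity and differentiability of sums follow
  from the rules for real limits and for Landau symbols, applied to the norms.\<close>

definition near :: "'a::real_vector nspace \<Rightarrow> 'a set \<Rightarrow> 'a \<Rightarrow> 'a filter" where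
  "near X S x = inf (filtercomap (\<lambda>y. nrm X (y - x)) (nhds 0)) (principal (S \<inter> pts X))"

lemma near_tendsto: "((\<lambda>y. nrm X (y - x)) \<longlongrightarrow> 0) (near X S x)"
  unfolding near_def by (rule filterlim_mono[OF filterlim_filtercomap order_refl inf_le1])

lemma near_in: "\<forall>\<^sub>F y in near X S x. y \<in> S \<inter> pts X"
  unfolding near_def eventually_inf_principal by simp

lemma eventually_near:
  assumes X: "normed X" and x: "x \<in> pts X"
  shows "eventually P (near X S x) \<longleftrightarrow> (\<exists>\<delta>>0. \<forall>y\<in>S \<inter> pts X. nrm X (y - x) < \<delta> \<longrightarrow> P y)"
proof -
  have n: "0 \<le> nrm X (y - x)" if "y \<in> S \<inter> pts X" for y
    using that x normedD(2)[OF X] normedD(9)[OF X] by blast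
  show ?thesis
  proof
    assume "eventually P (near X S x)"
    then obtain Q where Q: "eventually Q (nhds (0::real))" "\<And>y. Q (nrm X (y - x)) \<Longrightarrow> y \<in> S \<inter> pts X \<longrightarrow> P y"
      unfolding near_def eventually_inf_principal eventually_filtercomap by blast
    then obtain \<delta> where "\<delta> > 0" "\<And>r. \<bar>r\<bar> < \<delta> \<Longrightarrow> Q r" by (auto simp: eventually_nhds_metric dist_real_def)
    then show "\<exists>\<delta>>0. \<forall>y\<in>S \<inter> pts X. nrm X (y - x) < \<delta> \<longrightarrow> P y" using Q(2) n by fastforce
  next
    assume "\<exists>\<delta>>0. \<forall>y\<in>S \<inter> pts X. nrm X (y - x) < \<delta> \<longrightarrow> P y"
    then obtain \<delta> where d: "\<delta> > 0" "\<And>y. y \<in> S \<inter> pts X \<Longrightarrow> nrm X (y - x) < \<delta> \<Longrightarrow> P y" by blast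
    have "\<forall>\<^sub>F y in near X S x. nrm X (y - x) < \<delta>" by (rule order_tendstoD(2)[OF near_tendsto d(1)])
    then show "eventually P (near X S x)" using near_in by eventually_elim (rule d(2))
  qed
qed

lemma continuous_map_near:
  assumes X: "normed X" and Y: "normed Y" and f: "f ` (S \<inter> pts X) \<subseteq> V \<inter> pts Y"
    and lim: "\<And>x. x \<in> S \<inter> pts X \<Longrightarrow> ((\<lambda>y. nrm Y (f y - f x)) \<longlongrightarrow> 0) (near X S x)"
  shows "continuous_map (subtopology (ntop X) S) (subtopology (ntop Y) V) f"
  unfolding continuous_map_ntop[OF X Y]
proof (intro conjI f ballI allI impI)
  fix x and \<epsilon> :: real assume x: "x \<in> S \<inter> pts X" and e: "\<epsilon> > 0"
  show "\<exists>\<delta>>0. \<forall>y\<in>S \<inter> pts X. nrm X (y - x) < \<delta> \<longrightarrow> nrm Y (f y - f x) < \<epsilon>"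
    using order_tendstoD(2)[OF lim[OF x] e] x by (simp add: eventually_near[OF X])
qed

lemma has_fderiv_smallo:
  assumes X: "normed X" and o: "(\<lambda>h. nrm Y (f (x + h) - f x - A h)) \<in> o[near X {h. x + h \<in> S} 0](nrm X)"
  shows "has_fderiv X Y S f x A"
  unfolding has_fderiv_def
proof (intro allI impI)
  fix \<epsilon> :: real assume e: "\<epsilon> > 0"
  from landau_o.smallD[OF o, of "\<epsilon> / 2"] e
  obtain \<delta> where d: "\<delta> > 0" "\<And>h. h \<in> pts X \<Longrightarrow> x + h \<in> S \<Longrightarrow> nrm X h < \<delta> \<Longrightarrow>
      norm (nrm Y (f (x + h) - f x - A h)) \<le> \<epsilon> / 2 * norm (nrm X h)"
    by (auto simp: eventually_near[OF X normedD(6)[OF X]])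
  show "\<exists>\<delta>>0. \<forall>h\<in>pts X. 0 < nrm X h \<and> nrm X h < \<delta> \<and> x + h \<in> S \<longrightarrow>
      nrm Y (f (x + h) - f x - A h) / nrm X h < \<epsilon>"
  proof (intro exI conjI ballI impI)
    fix h assume h: "h \<in> pts X" "0 < nrm X h \<and> nrm X h < \<delta> \<and> x + h \<in> S"
    have "nrm Y (f (x + h) - f x - A h) \<le> \<epsilon> / 2 * nrm X h" using d(2)[of h] h by auto
    also have "\<dots> < \<epsilon> * nrm X h" using h e by simp
    finally show "nrm Y (f (x + h) - f x - A h) / nrm X h < \<epsilon>" using h by (simp add: divide_simps)
  qed (rule d(1))
qed

lemma nrm_sum_list_le:
  assumes Y: "normed Y" and "\<And>x. x \<in> set xs \<Longrightarrow> f x \<in> pts Y"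
  shows "(\<Sum>x\<leftarrow>xs. f x) \<in> pts Y \<and> nrm Y (\<Sum>x\<leftarrow>xs. f x) \<le> (\<Sum>x\<leftarrow>xs. nrm Y (f x))"
  using assms(2)
proof (induction xs)
  case Nil
  then show ?case using nrm_zero[OF Y] normedD(6)[OF Y] by simp
next
  case (Cons x xs)
  then have "f x \<in> pts Y" and IH: "(\<Sum>x\<leftarrow>xs. f x) \<in> pts Y" "nrm Y (\<Sum>x\<leftarrow>xs. f x) \<le> (\<Sum>x\<leftarrow>xs. nrm Y (f x))" by auto
  then show ?case using normedD(7)[OF Y] nrm_add_le[OF Y _ IH(1) order_refl IH(2)] by simp
qed

lemma tendsto_sum_list_zero:
  "(\<And>x. x \<in> set xs \<Longrightarrow> ((\<lambda>u. f x u :: real) \<longlongrightarrow> 0) G) \<Longrightarrow> ((\<lambda>u. \<Sum>x\<leftarrow>xs. f x u) \<longlongrightarrow> 0) G"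
  by (induction xs) (auto intro: tendsto_add_zero)

lemma smallo_sum_list:
  "(\<And>x. x \<in> set xs \<Longrightarrow> (\<lambda>u. f x u :: real) \<in> o[G](g)) \<Longrightarrow> (\<lambda>u. \<Sum>x\<leftarrow>xs. f x u) \<in> o[G](g)"
  by (induction xs) (auto intro: sum_in_smallo)

section \<open>Index lists for differentiated terms\<close>

text \<open>Indices after interleaving a base tuple with a direction: entry \<open>i\<close> of the base is at \<open>2 * i\<close>, that of
  the direction at \<open>2 * i + 1\<close>. The lists arise from \<open>ix\<close> by taking in turn each entry from the
  direction and all others from the base, as \<open>mderiv\<close> requires.\<close>

primrec slot_lists :: "nat list \<Rightarrow> nat list list" where
  "slot_lists [] = []"
| "slot_lists (i # ix) = (Suc (2 * i) # map ((*) 2) ix) # map ((#) (2 * i)) (slot_lists ix)"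

text \<open>The index lists of the tangent map. The leading index 1 refers to entry 0 of the direction, in
  which the point at which \<open>f\<close> is differentiated moves.\<close>

definition tangent_terms :: "(nat \<Rightarrow> nat list list) \<Rightarrow> nat \<Rightarrow> nat list list" where
  "tangent_terms L n = (if even n then map (map ((*) 2)) (L (n div 2))
     else concat (map (\<lambda>ix. (1 # map ((*) 2) ix) # slot_lists ix) (L (n div 2))))"

lemma map_join_double [simp]: "map (join (v, w)) (map ((*) 2) ix) = map v ix"
  by simp

lemma sum_slot_lists: "(\<Sum>jx\<leftarrow>slot_lists ix. B (map (join (v, w)) jx)) = mderiv B v w ix"
proof (induction ix arbitrary: B)
  case (Cons i ix)
  show ?case using Cons.IH[of "\<lambda>hs. B (v i # hs)"] by (simp add: o_def)
qed simp

lemma slot_lists_props: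
  "jx \<in> set (slot_lists ix) \<Longrightarrow> length jx = length ix \<and> (\<forall>i\<in>set jx. \<exists>q\<in>set ix. i = 2 * q \<or> i = Suc (2 * q))"
proof (induction ix arbitrary: jx)
  case (Cons i ix)
  from Cons.prems consider "jx = Suc (2 * i) # map ((*) 2) ix"
    | jx' where "jx = 2 * i # jx'" "jx' \<in> set (slot_lists ix)" by auto
  then show ?case
  proof cases
    case 2
    then show ?thesis using Cons.IH[OF 2(2)] by auto
  qed auto
qed simp

lemma sc_class_enc_imp_sc0: "sc_class_enc p G S H V g \<Longrightarrow> sc0 G S H V g"
  by (cases p) auto

section \<open>Maps whose components are sums of derivatives\<close>

text \<open>One system \<open>d\<close> of derivatives serves all pairs of levels, so that each value of \<open>d\<close> may be estimated
  on the pair that suits the arguments.\<close>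

locale coherent_jet =
  fixes E :: "'a::real_vector scspace" and F :: "'b::real_vector scspace" and U :: "'a set" and k :: nat
    and d :: "'a \<Rightarrow> 'a list \<Rightarrow> 'b"
  assumes E: "sc_banach E" and F: "sc_banach F"
    and jets: "\<And>m l. l \<le> k \<Longrightarrow> jet (E (m + l)) (F m) (U \<inter> pts (E (m + l))) (Suc l) d"
begin

lemmas normed_E = sc_banach_normed[OF E]
lemmas normed_F = sc_banach_normed[OF F]
lemmas normed_tuple_E = nestedD(1)[OF nested_tuple_space[OF sc_banach_nested[OF E]]]
lemmas normed_tuple_F = nestedD(1)[OF nested_tuple_space[OF sc_banach_nested[OF F]]]

text \<open>All arguments lie on level \<open>b = a + (j - 1)\<close>, and there \<open>f\<close> has \<open>j\<close>
  continuous derivatives with values in \<open>F a\<close>. Continuity in the base point is uniform in the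
  directions, and continuity in the directions is that of a bounded multilinear map.\<close>

lemma term_tendsto:
  assumes v: "v \<in> tuple_set N s E U \<inter> pts (tuple_space N s E m)" and N: "0 < N"
    and ix: "set ix \<subseteq> {..<N}" "length ix \<le> Suc k"
    and sh: "a + length ix \<le> s 0 + m" "\<And>i. i \<in> set ix \<Longrightarrow> a + length ix \<le> Suc (s i + m)"
  shows "d (v 0) (map v ix) \<in> pts (F a)"
    and "((\<lambda>u. nrm (F a) (d (u 0) (map u ix) - d (v 0) (map v ix))) \<longlongrightarrow> 0)
      (near (tuple_space N s E m) (tuple_set N s E U) v)"
proof -
  let ?T = "tuple_space N s E m" and ?G = "near (tuple_space N s E m) (tuple_set N s E U) v"
  define j where "j = length ix"
  define b where "b = a + (j - 1)"
  have j: "j \<le> Suc (j - 1)" "j - 1 \<le> k" using ix(2) by (auto simp: j_def)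
  have bs: "b \<le> s 0 + m" "\<And>i. i \<in> set ix \<Longrightarrow> b \<le> s i + m"
  proof -
    show "b \<le> s 0 + m" using sh(1) by (simp add: b_def j_def)
    show "b \<le> s i + m" if "i \<in> set ix" for i
      using sh(2)[OF that] that by (cases ix) (auto simp: b_def j_def)
  qed
  obtain c where c: "c > 0" "\<And>v i. v \<in> pts ?T \<Longrightarrow> i < N \<Longrightarrow> b \<le> s i + m \<Longrightarrow>
      v i \<in> pts (E b) \<and> nrm (E b) (v i) \<le> c * nrm ?T v"
    using tuple_space_component_bound[OF E, of N s m b] by blast
  have jet: "jet (E b) (F a) (U \<inter> pts (E b)) (Suc (j - 1)) d" using jets[OF j(2), of a] by (simp add: b_def)
  have comp: "u i \<in> pts (E b) \<and> nrm (E b) (u i) \<le> c * nrm ?T u" if "u \<in> pts ?T" "i \<in> set ix \<or> i = 0" for u i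
    using c(2)[OF that(1), of i] that(2) ix(1) N bs by auto
  have in_U: "u 0 \<in> U \<inter> pts (E b)" if "u \<in> tuple_set N s E U \<inter> pts ?T" for u
    using comp[of u 0] that by (auto simp: tuple_set_def)
  have ml: "multilin (E b) (F a) (length ix) (d (v 0))"
    using jetD(1)[OF jet in_U[OF v] j(1)] by (simp add: j_def)
  have in_F: "d (u 0) (map u' ix) \<in> pts (F a)"
    if "u \<in> tuple_set N s E U \<inter> pts ?T" "u' \<in> pts ?T" for u u'
    using multilin_in_pts[OF jetD(1)[OF jet in_U[OF that(1)] j(1)], of "map u' ix"] comp[OF that(2)]
    by (auto simp: j_def)
  show "d (v 0) (map v ix) \<in> pts (F a)" using in_F[OF v, of v] v by simp
  obtain \<beta> where \<beta>: "0 \<le> \<beta>" "mbound (E b) (F a) (length ix) \<beta> (d (v 0))"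
    using jetD(2)[OF jet in_U[OF v] j(1)] by (auto simp: j_def)
  define R where "R = c * (nrm ?T v + 1) + 1"
  have vT: "v \<in> pts ?T" using v by blast
  have R: "1 \<le> R" using c(1) normedD(2)[OF normed_tuple_E vT] by (simp add: R_def)
  have R0: "0 < R ^ length ix" using R by simp
  have vR: "v i \<in> pts (E b) \<and> nrm (E b) (v i) \<le> R" if "i \<in> set ix" for i
    using comp[OF vT, of i] that c(1) by (auto simp: R_def distrib_left)
  have w0: "((\<lambda>u. nrm ?T (u - v)) \<longlongrightarrow> 0) ?G" by (rule near_tendsto)
  show "((\<lambda>u. nrm (F a) (d (u 0) (map u ix) - d (v 0) (map v ix))) \<longlongrightarrow> 0) ?G"
  proof (rule order_tendstoI)
    fix e :: real assume e: "e < 0"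
    show "\<forall>\<^sub>F u in ?G. e < nrm (F a) (d (u 0) (map u ix) - d (v 0) (map v ix))"
      using near_in
    proof eventually_elim
      fix u assume u: "u \<in> tuple_set N s E U \<inter> pts ?T"
      then have "0 \<le> nrm (F a) (d (u 0) (map u ix) - d (v 0) (map v ix))"
        using v by (intro normedD(2)[OF normed_F] normedD(9)[OF normed_F] in_F) auto
      then show "e < nrm (F a) (d (u 0) (map u ix) - d (v 0) (map v ix))" using e by simp
    qed
  next
    fix e :: real assume e: "0 < e"
    \<comment> \<open>Half of \<open>e\<close> goes to the motion of the base point, half to that of the directions.\<close>
    define e1 where "e1 = e / (2 * R ^ length ix)"
    have e1: "0 < e1" "e1 * R ^ length ix = e / 2" using e R0 R by (auto simp: e1_def)
    obtain \<delta> where \<delta>: "\<delta> > 0" "\<And>y. y \<in> U \<inter> pts (E b) \<Longrightarrow> nrm (E b) (y - v 0) < \<delta> \<Longrightarrow>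
        mbound (E b) (F a) (length ix) e1 (\<lambda>hs. d y hs - d (v 0) hs)"
      using jetD(3)[OF jet in_U[OF v] j(1) e1(1)] by (auto simp: j_def)
    have "((\<lambda>u. c * nrm ?T (u - v)) \<longlongrightarrow> c * 0) ?G" by (intro tendsto_intros w0)
    then have 1: "\<forall>\<^sub>F u in ?G. c * nrm ?T (u - v) < \<delta>" by (rule order_tendstoD(2)) (use \<delta>(1) in simp)
    have 2: "\<forall>\<^sub>F u in ?G. nrm ?T (u - v) < 1" by (rule order_tendstoD(2)[OF w0]) simp
    have "((\<lambda>u. \<beta> * length ix * (c * nrm ?T (u - v)) * R ^ length ix) \<longlongrightarrow> \<beta> * length ix * (c * 0) * R ^ length ix) ?G"
      by (intro tendsto_intros w0)
    then have 3: "\<forall>\<^sub>F u in ?G. \<beta> * length ix * (c * nrm ?T (u - v)) * R ^ length ix < e / 2"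
      by (rule order_tendstoD(2)) (use e in simp)
    show "\<forall>\<^sub>F u in ?G. nrm (F a) (d (u 0) (map u ix) - d (v 0) (map v ix)) < e"
      using 1 2 3 near_in
    proof eventually_elim
      fix u assume u: "c * nrm ?T (u - v) < \<delta>" "nrm ?T (u - v) < 1"
        "\<beta> * length ix * (c * nrm ?T (u - v)) * R ^ length ix < e / 2" "u \<in> tuple_set N s E U \<inter> pts ?T"
      then have uT: "u \<in> pts ?T" by blast
      have w: "u - v \<in> pts ?T" using normedD(9)[OF normed_tuple_E uT vT] .
      note cw = comp[OF w]
      have uR: "u i \<in> pts (E b) \<and> nrm (E b) (u i) \<le> R" if "i \<in> set ix" for i
      proof -
        have "nrm ?T u \<le> nrm ?T (u - v) + nrm ?T v"
          using normedD(5)[OF normed_tuple_E w vT] by simp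
        then have "c * nrm ?T u \<le> c * (nrm ?T v + 1)" using u(2) c(1) by simp
        then show ?thesis using comp[OF uT, of i] that by (auto simp: R_def)
      qed
      have "nrm (F a) (d (u 0) (map u ix) - d (v 0) (map u ix)) \<le> e1 * R ^ length ix"
      proof (rule mbound_map_le[OF normed_E normed_F R, where B = "\<lambda>hs. d (u 0) hs - d (v 0) hs"])
        show "mbound (E b) (F a) (length ix) e1 (\<lambda>hs. d (u 0) hs - d (v 0) hs)"
          by (rule \<delta>(2)[OF in_U[OF u(4)]]) (use cw[of 0] u(1) in auto)
      qed (use e1(1) uR in auto)
      moreover have "nrm (F a) (d (v 0) (map (\<lambda>i. v i + (u - v) i) ix) - d (v 0) (map v ix))
          \<le> \<beta> * length ix * (c * nrm ?T (u - v)) * R ^ length ix"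
        using vR uR cw c(1) normedD(2)[OF normed_tuple_E w]
        by (intro multilin_increment_le[OF normed_E normed_F R _ ml \<beta>(2,1)]) auto
      moreover have "nrm (F a) (d (u 0) (map u ix) - d (v 0) (map v ix)) \<le>
          nrm (F a) (d (u 0) (map u ix) - d (v 0) (map u ix)) + nrm (F a) (d (v 0) (map u ix) - d (v 0) (map v ix))"
        using normedD(5)[OF normed_F normedD(9)[OF normed_F in_F[OF u(4) uT] in_F[OF v uT]]
            normedD(9)[OF normed_F in_F[OF v uT] in_F[OF v vT]]] by simp
      ultimately show "nrm (F a) (d (u 0) (map u ix) - d (v 0) (map v ix)) < e"
        using u(3) e1(2) by simp
    qed
  qed
qed

text \<open>A term \<open>D\<^sup>jf(v\<^sub>0)[v\<^sub>i\<^sub>1, \<dots>, v\<^sub>i\<^sub>j]\<close> is encoded by the list \<open>[i\<^sub>1, \<dots>, i\<^sub>j]\<close>, and \<open>L n\<close> is the list of the terms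
  of component \<open>n\<close>.\<close>

definition sum_of_terms :: "(nat \<Rightarrow> nat list list) \<Rightarrow> (nat \<Rightarrow> 'a) \<Rightarrow> nat \<Rightarrow> 'b" where
  "sum_of_terms L v n = (\<Sum>ix\<leftarrow>L n. d (v 0) (map v ix))"

text \<open>The condition under which a sum of terms is $\mathrm{sc}^p$. The number of
  differentiations used and still to come, \<open>length ix + p\<close>, may not exceed the order \<open>k + 1\<close>; the
  inequality for \<open>s i\<close> is the bound \<open>s n + j - 1 \<le> s i\<close> without truncated subtraction.\<close>

definition admissible :: "nat \<Rightarrow> nat \<Rightarrow> (nat \<Rightarrow> nat) \<Rightarrow> (nat \<Rightarrow> nat list list) \<Rightarrow> bool" where
  "admissible p N s L \<longleftrightarrow> 0 < N \<and> (\<forall>n\<ge>N. L n = []) \<and>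
     (\<forall>n<N. \<forall>ix\<in>set (L n). set ix \<subseteq> {..<N} \<and> length ix + p \<le> Suc k \<and> s n + length ix \<le> s 0 \<and>
        (\<forall>i\<in>set ix. s n + length ix \<le> Suc (s i)))"

lemma admissibleD:
  assumes "admissible p N s L"
  shows "0 < N" "n \<ge> N \<Longrightarrow> L n = []"
    "n < N \<Longrightarrow> ix \<in> set (L n) \<Longrightarrow> set ix \<subseteq> {..<N}" "n < N \<Longrightarrow> ix \<in> set (L n) \<Longrightarrow> length ix + p \<le> Suc k"
    "n < N \<Longrightarrow> ix \<in> set (L n) \<Longrightarrow> s n + length ix \<le> s 0"
    "n < N \<Longrightarrow> ix \<in> set (L n) \<Longrightarrow> i \<in> set ix \<Longrightarrow> s n + length ix \<le> Suc (s i)"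
  using assms unfolding admissible_def by blast+

lemma sc0_sum_of_terms:
  assumes L: "admissible p N s L"
  shows "sc0 (tuple_space N s E) (tuple_set N s E U) (tuple_space N s F) (pts (tuple_space N s F 0)) (sum_of_terms L)"
  unfolding sc0_def
proof
  fix m
  let ?T = "tuple_space N s E m" and ?S = "tuple_set N s E U"
  have t: "d (v 0) (map v ix) \<in> pts (F (s n + m)) \<and>
    ((\<lambda>u. nrm (F (s n + m)) (d (u 0) (map u ix) - d (v 0) (map v ix))) \<longlongrightarrow> 0) (near ?T ?S v)"
    if "v \<in> ?S \<inter> pts ?T" "n < N" "ix \<in> set (L n)" for v n ix
    using admissibleD(1,3-6)[OF L] that by (intro conjI term_tendsto[OF that(1)]) fastforce+
  have img: "sum_of_terms L v \<in> pts (tuple_space N s F m)" if v: "v \<in> ?S \<inter> pts ?T" for v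
    unfolding pts_tuple_space
  proof (intro conjI allI impI)
    show "sum_of_terms L v n \<in> pts (F (s n + m))" if "n < N" for n
      unfolding sum_of_terms_def by (rule nrm_sum_list_le[OF normed_F, THEN conjunct1]) (rule t[OF v that, THEN conjunct1])
  qed (simp add: sum_of_terms_def admissibleD(2)[OF L])
  show "continuous_map (subtopology (ntop ?T) ?S)
      (subtopology (ntop (tuple_space N s F m)) (pts (tuple_space N s F 0))) (sum_of_terms L)"
  proof (rule continuous_map_near[OF normed_tuple_E normed_tuple_F])
    have "pts (tuple_space N s F m) \<subseteq> pts (tuple_space N s F 0)"
      by (rule nested_mono[OF nested_tuple_space[OF sc_banach_nested[OF F]]]) simp
    then show "sum_of_terms L ` (?S \<inter> pts ?T) \<subseteq> pts (tuple_space N s F 0) \<inter> pts (tuple_space N s F m)"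
      using img by blast
    fix v assume v: "v \<in> ?S \<inter> pts ?T"
    show "((\<lambda>u. nrm (tuple_space N s F m) (sum_of_terms L u - sum_of_terms L v)) \<longlongrightarrow> 0) (near ?T ?S v)"
    proof (rule tendsto_sandwich[OF _ _ tendsto_const])
      show "\<forall>\<^sub>F u in near ?T ?S v. 0 \<le> nrm (tuple_space N s F m) (sum_of_terms L u - sum_of_terms L v)"
        using near_in
        by eventually_elim (intro normedD(2)[OF normed_tuple_F] normedD(9)[OF normed_tuple_F] img v)
      let ?b = "\<lambda>u. \<Sum>n<N. \<Sum>ix\<leftarrow>L n. nrm (F (s n + m)) (d (u 0) (map u ix) - d (v 0) (map v ix))"
      show "\<forall>\<^sub>F u in near ?T ?S v. nrm (tuple_space N s F m) (sum_of_terms L u - sum_of_terms L v) \<le> ?b u"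
        using near_in
      proof eventually_elim
        fix u assume u: "u \<in> ?S \<inter> pts ?T"
        show "nrm (tuple_space N s F m) (sum_of_terms L u - sum_of_terms L v) \<le> ?b u"
          unfolding nrm_tuple_space
        proof (rule sum_mono)
          fix n assume "n \<in> {..<N}"
          then have n: "n < N" by simp
          have "(sum_of_terms L u - sum_of_terms L v) n = (\<Sum>ix\<leftarrow>L n. d (u 0) (map u ix) - d (v 0) (map v ix))"
            by (simp add: sum_of_terms_def sum_list_subtractf)
          then show "nrm (F (s n + m)) ((sum_of_terms L u - sum_of_terms L v) n) \<le>
              (\<Sum>ix\<leftarrow>L n. nrm (F (s n + m)) (d (u 0) (map u ix) - d (v 0) (map v ix)))"
            using nrm_sum_list_le[OF normed_F, of "L n" "\<lambda>ix. d (u 0) (map u ix) - d (v 0) (map v ix)" "s n + m"]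
              t[OF u n] t[OF v n] normedD(9)[OF normed_F] by simp
        qed
      qed
      have "(?b \<longlongrightarrow> (\<Sum>n<N. 0)) (near ?T ?S v)"
        using t[OF v] by (intro tendsto_sum tendsto_sum_list_zero) auto
      then show "(?b \<longlongrightarrow> 0) (near ?T ?S v)" by simp
    qed
  qed
qed

section \<open>The derivative of a sum of derivatives\<close>

definition term_deriv :: "(nat \<Rightarrow> 'a) \<Rightarrow> (nat \<Rightarrow> 'a) \<Rightarrow> nat list \<Rightarrow> 'b" where
  "term_deriv v w ix = d (v 0) (w 0 # map v ix) + mderiv (d (v 0)) v w ix"

text \<open>Entry 0 of the direction lies on level \<open>b = a + j\<close>, like all entries of \<open>v\<close> involved, and there
  \<open>D\<^sup>j\<^sup>+\<^sup>1f\<close> is available. Every other entry of the direction lies on level \<open>b' = a + (j - 1)\<close> only, but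
  it is an argument of \<open>D\<^sup>jf\<close>, for which this level suffices.\<close>

lemma term_deriv_bounded_linear:
  assumes v: "v \<in> tuple_set N s E U \<inter> pts (tuple_space N s E 1)" and N: "0 < N"
    and ix: "set ix \<subseteq> {..<N}" "length ix \<le> k"
    and sh: "a + length ix \<le> s 0" "\<And>i. i \<in> set ix \<Longrightarrow> a + length ix \<le> Suc (s i)"
  shows "\<exists>K. \<forall>w\<in>pts (tuple_space N s E 0). term_deriv v w ix \<in> pts (F a) \<and>
      nrm (F a) (term_deriv v w ix) \<le> K * nrm (tuple_space N s E 0) w"
    and "w \<in> pts (tuple_space N s E 0) \<Longrightarrow> w' \<in> pts (tuple_space N s E 0) \<Longrightarrow>
      term_deriv v (w + w') ix = term_deriv v w ix + term_deriv v w' ix"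
    and "w \<in> pts (tuple_space N s E 0) \<Longrightarrow> term_deriv v (r *\<^sub>R w) ix = r *\<^sub>R term_deriv v w ix"
proof -
  let ?T = "tuple_space N s E 0" and ?j = "length ix"
  define b where "b = a + ?j"
  define b' where "b' = a + (?j - 1)"
  have bb: "b' \<le> b" by (simp add: b_def b'_def)
  have bs: "b \<le> s 0" "\<And>i. i \<in> set ix \<Longrightarrow> b \<le> s i + 1" "\<And>i. i \<in> set ix \<Longrightarrow> b' \<le> s i"
  proof -
    show "b \<le> s 0" "\<And>i. i \<in> set ix \<Longrightarrow> b \<le> s i + 1" using sh by (simp_all add: b_def)
    show "b' \<le> s i" if "i \<in> set ix" for i
      using sh(2)[OF that] that by (cases ix) (auto simp: b'_def)
  qed
  have vT: "v \<in> pts (tuple_space N s E 1)" using v by blast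
  have vb: "v i \<in> pts (E b)" if "i \<in> set ix \<or> i = 0" for i
  proof -
    have "v i \<in> pts (E (s i + 1))" using vT that ix(1) N by (auto simp: pts_tuple_space)
    moreover have "b \<le> s i + 1" using that bs by auto
    ultimately show ?thesis using nested_mono[OF sc_banach_nested[OF E]] by blast
  qed
  have vb': "v i \<in> pts (E b')" if "i \<in> set ix \<or> i = 0" for i
    using vb[OF that] nested_mono[OF sc_banach_nested[OF E] bb] by blast
  have v0: "v 0 \<in> U \<inter> pts (E b)" "v 0 \<in> U \<inter> pts (E b')" using v vb vb' by (auto simp: tuple_set_def)
  have jet: "jet (E b) (F a) (U \<inter> pts (E b)) (Suc ?j) d" using jets[OF ix(2), of a] by (simp add: b_def)
  have jet': "jet (E b') (F a) (U \<inter> pts (E b')) (Suc (?j - 1)) d" using jets[of "?j - 1" a] ix(2) by (simp add: b'_def)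
  have j: "?j \<le> Suc (?j - 1)" by simp
  note m = jetD(1)[OF jet v0(1) order_refl] and m' = jetD(1)[OF jet' v0(2) j]
  obtain \<beta> \<beta>' where \<beta>: "0 \<le> \<beta>" "mbound (E b) (F a) (Suc ?j) \<beta> (d (v 0))"
    and \<beta>': "0 \<le> \<beta>'" "mbound (E b') (F a) ?j \<beta>' (d (v 0))"
    using jetD(2)[OF jet v0(1) order_refl] jetD(2)[OF jet' v0(2) j] by blast
  obtain c where c: "c > 0" "\<And>w i. w \<in> pts ?T \<Longrightarrow> i < N \<Longrightarrow> b \<le> s i + 0 \<Longrightarrow>
      w i \<in> pts (E b) \<and> nrm (E b) (w i) \<le> c * nrm ?T w"
    using tuple_space_component_bound[OF E, of N s 0 b] by blast
  obtain c' where c': "c' > 0" "\<And>w i. w \<in> pts ?T \<Longrightarrow> i < N \<Longrightarrow> b' \<le> s i + 0 \<Longrightarrow>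
      w i \<in> pts (E b') \<and> nrm (E b') (w i) \<le> c' * nrm ?T w"
    using tuple_space_component_bound[OF E, of N s 0 b'] by blast
  have w0: "w 0 \<in> pts (E b)" "nrm (E b) (w 0) \<le> c * nrm ?T w" if "w \<in> pts ?T" for w
    using c(2)[OF that N] bs(1) by simp_all
  have wi: "w i \<in> pts (E b') \<and> nrm (E b') (w i) \<le> c' * nrm ?T w" if "w \<in> pts ?T" "i \<in> set ix" for w i
    using c'(2)[OF that(1), of i] that(2) ix(1) bs(3) by auto
  have vs: "set (map v ix) \<subseteq> pts (E b)" using vb by auto
  have head: "d (v 0) (w 0 # map v ix) \<in> pts (F a)" if "w \<in> pts ?T" for w
    using multilin_in_pts[OF m, of "w 0 # map v ix"] vs w0(1)[OF that] by simp
  define R where "R = 1 + (\<Sum>i\<in>set ix. nrm (E b) (v i)) + (\<Sum>i\<in>set ix. nrm (E b') (v i))"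
  have nn: "0 \<le> nrm (E b) (v i)" "0 \<le> nrm (E b') (v i)" if "i \<in> set ix" for i
    using that vb vb' normedD(2)[OF normed_E] by auto
  have R: "1 \<le> R" "\<And>i. i \<in> set ix \<Longrightarrow> nrm (E b) (v i) \<le> R" "\<And>i. i \<in> set ix \<Longrightarrow> nrm (E b') (v i) \<le> R"
  proof -
    have p: "0 \<le> (\<Sum>i\<in>set ix. nrm (E b) (v i))" "0 \<le> (\<Sum>i\<in>set ix. nrm (E b') (v i))"
      using nn by (auto intro: sum_nonneg)
    then show "1 \<le> R" by (simp add: R_def)
    fix i assume i: "i \<in> set ix"
    show "nrm (E b) (v i) \<le> R" "nrm (E b') (v i) \<le> R"
      using p member_le_sum[of i "set ix" "\<lambda>i. nrm (E b) (v i)"] member_le_sum[of i "set ix" "\<lambda>i. nrm (E b') (v i)"] i nn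
      by (auto simp: R_def)
  qed
  show "\<exists>K. \<forall>w\<in>pts ?T. term_deriv v w ix \<in> pts (F a) \<and> nrm (F a) (term_deriv v w ix) \<le> K * nrm ?T w"
  proof (intro exI ballI)
    fix w assume w: "w \<in> pts ?T"
    have nw: "0 \<le> nrm ?T w" by (rule normedD(2)[OF normed_tuple_E w])
    have 1: "nrm (F a) (d (v 0) (w 0 # map v ix)) \<le> \<beta> * nrm (E b) (w 0) * R ^ ?j"
      using vb R w0(1)[OF w] \<beta> normedD(2)[OF normed_E w0(1)[OF w]]
      by (intro mbound_map_le[OF normed_E normed_F R(1) mbound_Cons[OF \<beta>(2) w0(1)[OF w]]]) auto
    have "\<beta> * nrm (E b) (w 0) * R ^ ?j \<le> \<beta> * (c * nrm ?T w) * R ^ ?j"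
      using w0(2)[OF w] \<beta>(1) R(1) by (intro mult_right_mono mult_left_mono) auto
    with 1 have 1: "nrm (F a) (d (v 0) (w 0 # map v ix)) \<le> \<beta> * (c * nrm ?T w) * R ^ ?j" by linarith
    have 2: "mderiv (d (v 0)) v w ix \<in> pts (F a) \<and>
        nrm (F a) (mderiv (d (v 0)) v w ix) \<le> \<beta>' * ?j * (c' * nrm ?T w) * R ^ ?j"
      using vb' R wi[OF w] c'(1) nw by (intro mderiv_le[OF normed_E normed_F R(1) _ m' \<beta>'(2,1)]) auto
    show "term_deriv v w ix \<in> pts (F a) \<and>
        nrm (F a) (term_deriv v w ix) \<le> (\<beta> * c * R ^ ?j + \<beta>' * ?j * c' * R ^ ?j) * nrm ?T w"
      using nrm_add_le[OF normed_F head[OF w] conjunct1[OF 2] 1 conjunct2[OF 2]] normedD(7)[OF normed_F head[OF w] conjunct1[OF 2]]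
      by (simp add: term_deriv_def algebra_simps)
  qed
  have lin': "mderiv (d (v 0)) v (\<lambda>i. w i + w' i) ix = mderiv (d (v 0)) v w ix + mderiv (d (v 0)) v w' ix \<and>
    mderiv (d (v 0)) v (\<lambda>i. r *\<^sub>R w i) ix = r *\<^sub>R mderiv (d (v 0)) v w ix"
    if "w \<in> pts ?T" "w' \<in> pts ?T" for w w' r
    using multilin_mderiv_linear[OF normed_E m', of v w w' r] vb' wi that by blast
  have pf: "w + w' = (\<lambda>i. w i + w' i)" "r *\<^sub>R w = (\<lambda>i. r *\<^sub>R w i)" for w w' :: "nat \<Rightarrow> 'a" and r
    by (simp_all add: fun_eq_iff)
  show "term_deriv v (w + w') ix = term_deriv v w ix + term_deriv v w' ix" if "w \<in> pts ?T" "w' \<in> pts ?T"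
    using lin'[OF that] multilin_Cons(1)[OF m vs _ w0(1)[OF that(1)] w0(1)[OF that(2)]]
    by (simp add: term_deriv_def pf)
  show "term_deriv v (r *\<^sub>R w) ix = r *\<^sub>R term_deriv v w ix" if "w \<in> pts ?T"
    using lin'[OF that that, of r] multilin_Cons(2)[OF m vs _ w0(1)[OF that], of r]
    by (simp add: term_deriv_def pf scaleR_add_right)
qed

text \<open>With increments on level 1 all arguments lie on level \<open>b = a + j\<close>. The remainder is the
  sum of three parts: the remainder from moving the base point with the directions \<open>v + w\<close>
  fixed; the error from replacing these directions by \<open>v\<close> in \<open>D\<^sup>j\<^sup>+\<^sup>1f\<close>; and the Taylor remainder
  of the multilinear map \<open>D\<^sup>jf(v\<^sub>0)\<close>. The first is small by differentiability, the other two
  are of second order.\<close>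

lemma term_deriv_smallo:
  fixes a s
  defines "rem \<equiv> \<lambda>v w ix. d (v 0 + w 0) (map (\<lambda>i. v i + w i) ix) - d (v 0) (map v ix) - term_deriv v w ix"
  assumes v: "v \<in> tuple_set N s E U \<inter> pts (tuple_space N s E 1)" and N: "0 < N"
    and ix: "set ix \<subseteq> {..<N}" "length ix \<le> k"
    and sh: "a + length ix \<le> s 0" "\<And>i. i \<in> set ix \<Longrightarrow> a + length ix \<le> Suc (s i)"
  shows "w \<in> pts (tuple_space N s E 1) \<Longrightarrow> v + w \<in> tuple_set N s E U \<Longrightarrow> rem v w ix \<in> pts (F a)"
    and "(\<lambda>w. nrm (F a) (rem v w ix)) \<in>
      o[near (tuple_space N s E 1) {w. v + w \<in> tuple_set N s E U} 0](nrm (tuple_space N s E 1))"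
proof -
  let ?T = "tuple_space N s E 1" and ?j = "length ix"
  let ?G = "near ?T {w. v + w \<in> tuple_set N s E U} 0"
  define b where "b = a + ?j"
  have bs: "b \<le> s 0 + 1" "\<And>i. i \<in> set ix \<Longrightarrow> b \<le> s i + 1" using sh by (simp_all add: b_def)
  obtain c where c: "c > 0" "\<And>w i. w \<in> pts ?T \<Longrightarrow> i < N \<Longrightarrow> b \<le> s i + 1 \<Longrightarrow>
      w i \<in> pts (E b) \<and> nrm (E b) (w i) \<le> c * nrm ?T w"
    using tuple_space_component_bound[OF E, of N s 1 b] by blast
  have comp: "w i \<in> pts (E b) \<and> nrm (E b) (w i) \<le> c * nrm ?T w" if "w \<in> pts ?T" "i \<in> set ix \<or> i = 0" for w i
    using c(2)[OF that(1), of i] that(2) ix(1) N bs by auto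
  have vT: "v \<in> pts ?T" using v by blast
  have v0: "v 0 \<in> U \<inter> pts (E b)" using v comp[OF vT, of 0] by (auto simp: tuple_set_def)
  have jet: "jet (E b) (F a) (U \<inter> pts (E b)) (Suc ?j) d" using jets[OF ix(2), of a] by (simp add: b_def)
  have jj: "?j \<le> Suc ?j" by simp
  note m = jetD(1)[OF jet v0 jj] and m1 = jetD(1)[OF jet v0 order_refl]
  obtain \<beta> \<beta>1 where \<beta>: "0 \<le> \<beta>" "mbound (E b) (F a) ?j \<beta> (d (v 0))"
    and \<beta>1: "0 \<le> \<beta>1" "mbound (E b) (F a) (Suc ?j) \<beta>1 (d (v 0))"
    using jetD(2)[OF jet v0 jj] jetD(2)[OF jet v0 order_refl] by blast
  define R where "R = c * (nrm ?T v + 1) + 1"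
  have R: "1 \<le> R" using c(1) normedD(2)[OF normed_tuple_E vT] by (simp add: R_def)
  have R0: "0 < R ^ ?j" using R by simp
  have vR: "v i \<in> pts (E b) \<and> nrm (E b) (v i) \<le> R" if "i \<in> set ix" for i
    using comp[OF vT, of i] that c(1) by (auto simp: R_def distrib_left)
  have in_F1: "d x (map u ix) \<in> pts (F a)" if "x \<in> U \<inter> pts (E b)" "u \<in> pts ?T" for x u
    using multilin_in_pts[OF jetD(1)[OF jet that(1) jj], of "map u ix"] comp[OF that(2)] by auto
  have in_F2: "d (v 0) (w 0 # map u ix) \<in> pts (F a)" if "u \<in> pts ?T" "w \<in> pts ?T" for u w
    using multilin_in_pts[OF m1, of "w 0 # map u ix"] comp[OF that(1)] comp[OF that(2)] by auto
  have in_F3: "mderiv (d (v 0)) v w ix \<in> pts (F a)" if "w \<in> pts ?T" for w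
    using mderiv_le[OF normed_E normed_F R _ m \<beta>(2,1), of "c * nrm ?T w" v w] vR comp[OF that] c(1)
      normedD(2)[OF normed_tuple_E that] by auto
  note in_F = in_F1 in_F2 in_F3
  have plus: "(\<lambda>i. v i + w i) = v + w" for w by (simp add: fun_eq_iff)
  have inc: "v + w \<in> pts ?T" "v 0 + w 0 \<in> U \<inter> pts (E b)" if "w \<in> pts ?T" "v + w \<in> tuple_set N s E U" for w
  proof -
    show "v + w \<in> pts ?T" by (rule normedD(7)[OF normed_tuple_E vT that(1)])
    from comp[OF this, of 0] that(2) show "v 0 + w 0 \<in> U \<inter> pts (E b)" by (auto simp: tuple_set_def)
  qed
  show "rem v w ix \<in> pts (F a)" if "w \<in> pts ?T" "v + w \<in> tuple_set N s E U"
    unfolding rem_def term_deriv_def plus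
    by (intro normedD(7)[OF normed_F] normedD(9)[OF normed_F] in_F v0 vT that(1) inc[OF that])
  define M where "M = \<beta>1 * c * ?j * c * R ^ ?j + \<beta> * ?j\<^sup>2 * c\<^sup>2 * R ^ ?j"
  have M: "0 \<le> M" unfolding M_def using \<beta>(1) \<beta>1(1) c(1) R by simp
  have w0: "((\<lambda>w. nrm ?T w) \<longlongrightarrow> 0) ?G" using near_tendsto[of ?T 0] by simp
  show "(\<lambda>w. nrm (F a) (rem v w ix)) \<in> o[?G](nrm ?T)"
  proof (rule landau_o.smallI)
    fix e :: real assume e: "0 < e"
    \<comment> \<open>Half of \<open>e\<close> goes to the first part of the remainder; the second-order parts, at most \<open>M * t * t\<close>, get the other half.\<close>
    define e1 where "e1 = e / (2 * c * R ^ ?j)"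
    have e1: "0 < e1" "e1 * c * R ^ ?j = e / 2" using e c(1) R0 R by (auto simp: e1_def)
    obtain \<delta> where \<delta>: "\<delta> > 0" "\<And>h. h \<in> pts (E b) \<Longrightarrow> nrm (E b) h < \<delta> \<Longrightarrow> v 0 + h \<in> U \<inter> pts (E b) \<Longrightarrow>
        mbound (E b) (F a) ?j (e1 * nrm (E b) h) (\<lambda>hs. d (v 0 + h) hs - d (v 0) hs - d (v 0) (h # hs))"
      using jetD(4)[OF jet v0 lessI e1(1)] by blast
    have 1: "\<forall>\<^sub>F w in ?G. nrm ?T w < \<delta> / c" by (rule order_tendstoD(2)[OF w0]) (use \<delta>(1) c(1) in simp)
    have 2: "\<forall>\<^sub>F w in ?G. nrm ?T w < 1" by (rule order_tendstoD(2)[OF w0]) simp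
    have 3: "\<forall>\<^sub>F w in ?G. nrm ?T w < e / (2 * (M + 1))" by (rule order_tendstoD(2)[OF w0]) (use e M in simp)
    show "\<forall>\<^sub>F w in ?G. norm (nrm (F a) (rem v w ix)) \<le> e * norm (nrm ?T w)"
      using 1 2 3 near_in
    proof eventually_elim
      fix w assume w: "nrm ?T w < \<delta> / c" "nrm ?T w < 1" "nrm ?T w < e / (2 * (M + 1))"
        and "w \<in> {w. v + w \<in> tuple_set N s E U} \<inter> pts ?T"
      then have wT: "w \<in> pts ?T" and vw: "v + w \<in> tuple_set N s E U" by auto
      note inc = inc[OF wT vw]
      define t where "t = nrm ?T w"
      have t: "0 \<le> t" "c * t < \<delta>" "t < 1" "(M + 1) * t \<le> e / 2"
        using normedD(2)[OF normed_tuple_E wT] w c(1) M by (auto simp: t_def field_simps)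
      have cw: "w i \<in> pts (E b) \<and> nrm (E b) (w i) \<le> c * t" if "i \<in> set ix \<or> i = 0" for i
        using comp[OF wT that] by (simp add: t_def)
      have uR: "(v + w) i \<in> pts (E b) \<and> nrm (E b) ((v + w) i) \<le> R" if "i \<in> set ix" for i
      proof -
        have "nrm ?T (v + w) \<le> nrm ?T v + 1"
          using normedD(5)[OF normed_tuple_E vT wT] t(3) by (simp add: t_def)
        then have "c * nrm ?T (v + w) \<le> c * (nrm ?T v + 1)" using c(1) by simp
        then show ?thesis using comp[OF inc(1), of i] that by (auto simp: R_def)
      qed
      have nw: "0 \<le> nrm (E b) (w 0)" using normedD(2)[OF normed_E] cw by blast
      let ?x = "v 0 + w 0"
      let ?A1 = "d ?x (map (v + w) ix) - d (v 0) (map (v + w) ix) - d (v 0) (w 0 # map (v + w) ix)"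
      let ?A2 = "d (v 0) (w 0 # map (v + w) ix) - d (v 0) (w 0 # map v ix)"
      let ?A3 = "d (v 0) (map (v + w) ix) - d (v 0) (map v ix) - mderiv (d (v 0)) v w ix"
      have A: "?A1 \<in> pts (F a)" "?A2 \<in> pts (F a)" "?A3 \<in> pts (F a)"
        by (intro normedD(9)[OF normed_F] in_F v0 vT wT inc)+
      have "nrm (F a) ?A1 \<le> e1 * nrm (E b) (w 0) * R ^ ?j"
      proof (rule mbound_map_le[OF normed_E normed_F R, where B = "\<lambda>hs. d ?x hs - d (v 0) hs - d (v 0) (w 0 # hs)"])
        show "mbound (E b) (F a) ?j (e1 * nrm (E b) (w 0)) (\<lambda>hs. d ?x hs - d (v 0) hs - d (v 0) (w 0 # hs))"
          by (rule \<delta>(2)[OF _ _ inc(2)]) (use cw[of 0] t(2) in auto)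
      qed (use e1(1) nw uR in auto)
      also have "\<dots> \<le> e1 * (c * t) * R ^ ?j"
        using cw[of 0] e1(1) R0 by (intro mult_right_mono mult_left_mono) auto
      also have "\<dots> = e / 2 * t" using e1(2) by (simp add: ac_simps)
      finally have B1: "nrm (F a) ?A1 \<le> e / 2 * t" .
      have "nrm (F a) ?A2 \<le> \<beta>1 * nrm (E b) (w 0) * ?j * (c * t) * R ^ ?j"
        unfolding plus[symmetric]
        using vR uR cw c(1) t(1) nw \<beta>1(1) m1
        by (intro multilin_increment_le[OF normed_E normed_F R _ _ mbound_Cons[OF \<beta>1(2) cw[of 0, THEN conjunct1]]]) auto
      also have "\<dots> \<le> \<beta>1 * (c * t) * ?j * (c * t) * R ^ ?j"
        using cw[of 0] \<beta>1(1) R0 c(1) t(1) by (intro mult_right_mono mult_left_mono) auto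
      finally have B2: "nrm (F a) ?A2 \<le> \<beta>1 * (c * t) * ?j * (c * t) * R ^ ?j" .
      have B3: "nrm (F a) ?A3 \<le> \<beta> * ?j\<^sup>2 * (c * t)\<^sup>2 * R ^ ?j"
        unfolding plus[symmetric]
        using vR uR cw c(1) t(1) by (intro multilin_remainder_le[OF normed_E normed_F R _ m \<beta>(2,1)]) auto
      have rem_eq: "rem v w ix = ?A1 + (?A2 + ?A3)" by (simp add: rem_def term_deriv_def plus)
      have "nrm (F a) (?A1 + (?A2 + ?A3)) \<le>
          e / 2 * t + (\<beta>1 * (c * t) * ?j * (c * t) * R ^ ?j + \<beta> * ?j\<^sup>2 * (c * t)\<^sup>2 * R ^ ?j)"
        by (intro nrm_add_le[OF normed_F] A normedD(7)[OF normed_F] B1 B2 B3)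
      moreover have "\<beta>1 * (c * t) * ?j * (c * t) * R ^ ?j + \<beta> * ?j\<^sup>2 * (c * t)\<^sup>2 * R ^ ?j = M * t * t"
        by (simp add: M_def algebra_simps power2_eq_square)
      moreover have "M * t * t \<le> e / 2 * t" using t(1,4) by (intro mult_right_mono) (auto simp: algebra_simps)
      ultimately have "nrm (F a) (rem v w ix) \<le> e / 2 * t + e / 2 * t" unfolding rem_eq by linarith
      then have "nrm (F a) (rem v w ix) \<le> e * t" by simp
      moreover have "0 \<le> nrm (F a) (rem v w ix)"
        unfolding rem_eq by (intro normedD(2)[OF normed_F] A normedD(7)[OF normed_F])
      ultimately show "norm (nrm (F a) (rem v w ix)) \<le> e * norm (nrm ?T w)" using t(1) by (simp add: t_def)
    qed
  qed
qed

lemma sc_derivative_sum_of_terms: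
  assumes L: "admissible (Suc p) N s L"
  shows "sc_derivative (tuple_space N s E) (tuple_set N s E U) (tuple_space N s F) (sum_of_terms L)
    (\<lambda>v w n. \<Sum>ix\<leftarrow>L n. term_deriv v w ix)"
  unfolding sc_derivative_def
proof (intro ballI conjI)
  let ?T = "tuple_space N s E" and ?S = "tuple_set N s E U" and ?F = "tuple_space N s F"
  let ?D = "\<lambda>v w n. \<Sum>ix\<leftarrow>L n. term_deriv v w ix"
  note A = admissibleD[OF L]
  fix v assume v: "v \<in> ?S \<inter> pts (?T 1)"
  have ad: "set ix \<subseteq> {..<N}" "length ix \<le> k" "s n + length ix \<le> s 0"
    "\<And>i. i \<in> set ix \<Longrightarrow> s n + length ix \<le> Suc (s i)" if "n < N" "ix \<in> set (L n)" for n ix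
    using A(3-6)[OF that] by simp_all
  have ex: "\<exists>K. \<forall>w\<in>pts (?T 0). term_deriv v w ix \<in> pts (F (s n)) \<and>
      nrm (F (s n)) (term_deriv v w ix) \<le> K * nrm (?T 0) w" if n: "n < N" "ix \<in> set (L n)" for n ix
    by (rule term_deriv_bounded_linear(1)[OF v A(1) ad(1-3)[OF n]]) (rule ad(4)[OF n])
  define K where "K n ix = (SOME K. \<forall>w\<in>pts (?T 0). term_deriv v w ix \<in> pts (F (s n)) \<and>
      nrm (F (s n)) (term_deriv v w ix) \<le> K * nrm (?T 0) w)" for n ix
  have K: "term_deriv v w ix \<in> pts (F (s n)) \<and> nrm (F (s n)) (term_deriv v w ix) \<le> K n ix * nrm (?T 0) w"
    if n: "n < N" "ix \<in> set (L n)" and w: "w \<in> pts (?T 0)" for n ix w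
    using someI_ex[OF ex[OF n], folded K_def] w by blast
  have add: "term_deriv v (w + w') ix = term_deriv v w ix + term_deriv v w' ix"
    if n: "n < N" "ix \<in> set (L n)" and w: "w \<in> pts (?T 0)" "w' \<in> pts (?T 0)" for n ix w w'
    by (rule term_deriv_bounded_linear(2)[OF v A(1) ad(1-3)[OF n] ad(4)[OF n] w])
  have scale: "term_deriv v (r *\<^sub>R w) ix = r *\<^sub>R term_deriv v w ix"
    if n: "n < N" "ix \<in> set (L n)" and w: "w \<in> pts (?T 0)" for n ix w r
    by (rule term_deriv_bounded_linear(3)[OF v A(1) ad(1-3)[OF n] ad(4)[OF n] w])
  have D: "?D v w \<in> pts (?F 0)" if w: "w \<in> pts (?T 0)" for w
    unfolding pts_tuple_space
  proof (intro conjI allI impI)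
    show "?D v w n \<in> pts (F (s n + 0))" if "n < N" for n
      using nrm_sum_list_le[OF normed_F, THEN conjunct1, of "L n" "term_deriv v w" "s n"] K[OF that _ w] by simp
  qed (simp add: A(2))
  show "bounded_op (?T 0) (?F 0) (?D v)"
    unfolding bounded_op_def linear_op_def
  proof (intro conjI ballI allI)
    show "?D v ` pts (?T 0) \<subseteq> pts (?F 0)" using D by blast
    fix w assume w: "w \<in> pts (?T 0)"
    show "?D v (w + w') = ?D v w + ?D v w'" if w': "w' \<in> pts (?T 0)" for w'
    proof
      fix n
      show "?D v (w + w') n = (?D v w + ?D v w') n"
      proof (cases "n < N")
        case True
        have "map (term_deriv v (w + w')) (L n) = map (\<lambda>ix. term_deriv v w ix + term_deriv v w' ix) (L n)"
          using add[OF True _ w w'] by simp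
        then show ?thesis by (simp only: sum_list_addf plus_fun_apply)
      qed (simp add: A(2))
    qed
    show "?D v (r *\<^sub>R w) = r *\<^sub>R ?D v w" for r
    proof
      fix n
      have sc: "r *\<^sub>R sum_list xs = sum_list (map ((*\<^sub>R) r) xs)" for xs :: "'b list"
        by (induction xs) (simp_all add: scaleR_add_right)
      show "?D v (r *\<^sub>R w) n = (r *\<^sub>R ?D v w) n"
      proof (cases "n < N")
        case True
        have "map (term_deriv v (r *\<^sub>R w)) (L n) = map (\<lambda>ix. r *\<^sub>R term_deriv v w ix) (L n)"
          using scale[OF True _ w] by simp
        then show ?thesis by (simp only: sc scaleR_fun_apply map_map o_def)
      qed (simp add: A(2))
    qed
  next
    have "nrm (?F 0) (?D v w) \<le> (\<Sum>n<N. \<Sum>ix\<leftarrow>L n. K n ix) * nrm (?T 0) w" if w: "w \<in> pts (?T 0)" for w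
      unfolding nrm_tuple_space[of N s F] sum_distrib_right
    proof (rule sum_mono)
      fix n assume "n \<in> {..<N}"
      then have n: "n < N" by simp
      have "nrm (F (s n)) (?D v w n) \<le> (\<Sum>ix\<leftarrow>L n. nrm (F (s n)) (term_deriv v w ix))"
        by (rule nrm_sum_list_le[OF normed_F, THEN conjunct2]) (rule K[OF n _ w, THEN conjunct1])
      also have "\<dots> \<le> (\<Sum>ix\<leftarrow>L n. K n ix * nrm (?T 0) w)" using K[OF n _ w] by (intro sum_list_mono) blast
      finally show "nrm (F (s n + 0)) (?D v w n) \<le> (\<Sum>ix\<leftarrow>L n. K n ix) * nrm (?T 0) w"
        by (simp add: sum_list_mult_const)
    qed
    then show "\<exists>B. \<forall>w\<in>pts (?T 0). nrm (?F 0) (?D v w) \<le> B * nrm (?T 0) w" by blast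
  qed
  show "has_fderiv (?T 1) (?F 0) ?S (sum_of_terms L) v (?D v)"
  proof (rule has_fderiv_smallo[OF normed_tuple_E])
    let ?G = "near (?T 1) {w. v + w \<in> ?S} 0"
    let ?r = "\<lambda>w ix. d (v 0 + w 0) (map (\<lambda>i. v i + w i) ix) - d (v 0) (map v ix) - term_deriv v w ix"
    let ?b = "\<lambda>w. \<Sum>n<N. \<Sum>ix\<leftarrow>L n. nrm (F (s n)) (?r w ix)"
    have r: "?r w ix \<in> pts (F (s n))" if "n < N" "ix \<in> set (L n)" "w \<in> pts (?T 1)" "v + w \<in> ?S" for n ix w
      by (rule term_deriv_smallo(1)[OF v A(1) ad(1-3)[OF that(1,2)] _ that(3,4)]) (rule ad(4)[OF that(1,2)])
    have o: "?b \<in> o[?G](nrm (?T 1))"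
    proof (rule big_sum_in_smallo, rule smallo_sum_list)
      fix n ix assume "n \<in> {..<N}" and ix: "ix \<in> set (L n)"
      then have n: "n < N" by simp
      show "(\<lambda>w. nrm (F (s n)) (?r w ix)) \<in> o[?G](nrm (?T 1))" 
        by (rule term_deriv_smallo(2)[OF v A(1) ad(1-3)[OF n ix]]) (rule ad(4)[OF n ix])
    qed
    have diff: "(sum_of_terms L (v + w) - sum_of_terms L v - ?D v w) n = (\<Sum>ix\<leftarrow>L n. ?r w ix)" for w n
    proof -
      have "(\<lambda>i. v i + w i) = v + w" by (simp add: fun_eq_iff)
      then show ?thesis by (simp add: sum_of_terms_def sum_list_subtractf)
    qed
    have in_F: "sum_of_terms L (v + w) - sum_of_terms L v - ?D v w \<in> pts (?F 0)"
      if "w \<in> pts (?T 1)" "v + w \<in> ?S" for w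
      unfolding pts_tuple_space diff
    proof (intro conjI allI impI)
      show "(\<Sum>ix\<leftarrow>L n. ?r w ix) \<in> pts (F (s n + 0))" if "n < N" for n
        using nrm_sum_list_le[OF normed_F, THEN conjunct1, of "L n" "?r w" "s n"] r[OF that _ \<open>w \<in> _\<close> \<open>v + w \<in> _\<close>] by simp
    qed (simp add: A(2))
    have le: "nrm (?F 0) (sum_of_terms L (v + w) - sum_of_terms L v - ?D v w) \<le> ?b w"
      if w: "w \<in> pts (?T 1)" "v + w \<in> ?S" for w
      unfolding nrm_tuple_space diff
    proof (rule sum_mono)
      fix n assume "n \<in> {..<N}"
      then show "nrm (F (s n + 0)) (\<Sum>ix\<leftarrow>L n. ?r w ix) \<le> (\<Sum>ix\<leftarrow>L n. nrm (F (s n)) (?r w ix))"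
        using nrm_sum_list_le[OF normed_F, THEN conjunct2, of "L n" "?r w" "s n"] r[OF _ _ w] by simp
    qed
    have "(\<lambda>w. nrm (?F 0) (sum_of_terms L (v + w) - sum_of_terms L v - ?D v w)) \<in> O[?G](?b)"
    proof (rule landau_o.big_mono)
      show "\<forall>\<^sub>F w in ?G. norm (nrm (?F 0) (sum_of_terms L (v + w) - sum_of_terms L v - ?D v w)) \<le> norm (?b w)"
        using near_in
      proof eventually_elim
        fix w assume "w \<in> {w. v + w \<in> ?S} \<inter> pts (?T 1)"
        then have w: "w \<in> pts (?T 1)" "v + w \<in> ?S" by auto
        show "norm (nrm (?F 0) (sum_of_terms L (v + w) - sum_of_terms L v - ?D v w)) \<le> norm (?b w)"
          using le[OF w] normedD(2)[OF normed_tuple_F in_F[OF w]] unfolding real_norm_def by linarith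
      qed
    qed
    then show "(\<lambda>w. nrm (?F 0) (sum_of_terms L (v + w) - sum_of_terms L v - ?D v w)) \<in> o[?G](nrm (?T 1))"
      by (rule landau_o.big_small_trans[OF _ o])
  qed
qed

lemma sum_of_tangent_terms:
  "sum_of_terms (tangent_terms L) (join (v, w)) = join (sum_of_terms L v, \<lambda>n. \<Sum>ix\<leftarrow>L n. term_deriv v w ix)"
proof
  fix n
  have head: "join (v, w) (Suc 0) = w 0" using join_simps(2)[of v w 0] by simp
  have odd: "(\<Sum>jx\<leftarrow>concat (map (\<lambda>ix. (1 # map ((*) 2) ix) # slot_lists ix) xs). d (v 0) (map (join (v, w)) jx)) =
      (\<Sum>ix\<leftarrow>xs. term_deriv v w ix)" for xs
    by (induction xs) (simp_all add: sum_slot_lists term_deriv_def o_def head add.assoc)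
  show "sum_of_terms (tangent_terms L) (join (v, w)) n = join (sum_of_terms L v, \<lambda>n. \<Sum>ix\<leftarrow>L n. term_deriv v w ix) n"
  proof (cases "even n")
    case True
    then show ?thesis by (auto elim!: evenE simp: sum_of_terms_def tangent_terms_def o_def)
  next
    case False
    then obtain q where "n = Suc (2 * q)" by (auto elim: oddE)
    then show ?thesis using odd[of "L q"] by (simp add: sum_of_terms_def tangent_terms_def)
  qed
qed

text \<open>In a term with \<open>j + 1\<close> arguments the arguments from the base and the base point itself have gained
  one level, and the new argument, entry 0 of the direction, has the shift \<open>s 0\<close>, for which
  admissibility demands one level more than for the other entries. In the remaining terms only
  the replaced argument keeps its old shift, and the number of arguments is unchanged.\<close>

lemma admissible_tangent_terms:
  assumes L: "admissible (Suc p) N s L"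
  shows "admissible p (2 * N) (tan_shift s) (tangent_terms L)"
proof -
  note A = admissibleD[OF L]
  have s01: "tan_shift s 0 = Suc (s 0)" "tan_shift s (Suc 0) = s 0"
    using tan_shift_simps[of s 0] by simp_all
  have ok: "set jx \<subseteq> {..<2 * N} \<and> length jx + p \<le> Suc k \<and> tan_shift s n + length jx \<le> tan_shift s 0 \<and>
      (\<forall>i\<in>set jx. tan_shift s n + length jx \<le> Suc (tan_shift s i))"
    if n: "n < 2 * N" and jx: "jx \<in> set (tangent_terms L n)" for n jx
  proof (cases "even n")
    case True
    then obtain q where q: "n = 2 * q" "q < N" using n by auto
    with jx obtain ix where ix: "ix \<in> set (L q)" "jx = map ((*) 2) ix" by (auto simp: tangent_terms_def)
    show ?thesis
      using A(3-5)[OF q(2) ix(1)] A(6)[OF q(2) ix(1)] by (auto simp: q ix s01)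
  next
    case False
    then obtain q where q: "n = Suc (2 * q)" "q < N" using n by (auto elim!: oddE)
    with jx obtain ix where ix: "ix \<in> set (L q)" and "jx = 1 # map ((*) 2) ix \<or> jx \<in> set (slot_lists ix)"
      by (auto simp: tangent_terms_def)
    then consider "jx = 1 # map ((*) 2) ix" | "jx \<in> set (slot_lists ix)" by blast
    then show ?thesis
    proof cases
      case 1
      show ?thesis using A(1) A(3-5)[OF q(2) ix(1)] A(6)[OF q(2) ix(1)] by (auto simp: q 1 s01)
    next
      case 2
      from slot_lists_props[OF 2] have l: "length jx = length ix"
        and i: "\<And>i. i \<in> set jx \<Longrightarrow> \<exists>q\<in>set ix. i = 2 * q \<or> i = Suc (2 * q)" by auto
      have "i < 2 * N \<and> s q + length ix \<le> Suc (tan_shift s i)" if "i \<in> set jx" for i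
      proof -
        from i[OF that] obtain q' where q': "q' \<in> set ix" "i = 2 * q' \<or> i = Suc (2 * q')" by blast
        then have "q' < N" using A(3)[OF q(2) ix(1)] by auto
        then show ?thesis using q' A(6)[OF q(2) ix(1) q'(1)] by auto
      qed
      then show ?thesis using A(4,5)[OF q(2) ix(1)] by (auto simp: q l s01)
    qed
  qed
  have "tangent_terms L n = []" if "2 * N \<le> n" for n
    using A(2)[of "n div 2"] that by (auto simp: tangent_terms_def)
  then show ?thesis unfolding admissible_def using A(1) ok by simp
qed

text \<open>The induction is over tuples of varying length and shape, because the tangent map has twice as many
  components. Continuity of the tangent map is contained in the statement for the new terms.\<close>

lemma sc_class_sum_of_terms:
  assumes "admissible p N s L"
  shows "sc_class_enc p (tuple_space N s E) (tuple_set N s E U) (tuple_space N s F) (pts (tuple_space N s F 0)) (sum_of_terms L)"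
  using assms
proof (induction p arbitrary: N s L)
  case 0
  then show ?case using sc0_sum_of_terms by simp
next
  case (Suc p)
  let ?D = "\<lambda>v w n. \<Sum>ix\<leftarrow>L n. term_deriv v w ix"
  let ?tE = "tangent_space (tuple_space N s E)" and ?tF = "tangent_space (tuple_space N s F)"
  let ?tU = "tangent_set (tuple_space N s E) (tuple_set N s E U)"
  let ?tV = "tangent_set (tuple_space N s F) (pts (tuple_space N s F 0))"
  note nstE = nested_tuple_space[OF sc_banach_nested[OF E]] and nstF = nested_tuple_space[OF sc_banach_nested[OF F]]
  have T: "join \<circ> tangent_map (sum_of_terms L) ?D \<circ> unjoin = sum_of_terms (tangent_terms L)"
  proof
    fix u :: "nat \<Rightarrow> 'a"
    obtain v w where "unjoin u = (v, w)" by (cases "unjoin u")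
    moreover from this have "u = join (v, w)" by (metis join_unjoin)
    ultimately show "(join \<circ> tangent_map (sum_of_terms L) ?D \<circ> unjoin) u = sum_of_terms (tangent_terms L) u"
      by (simp add: tangent_map_def sum_of_tangent_terms)
  qed
  have step: "sc_class_enc p (push join unjoin \<circ> ?tE) (join ` ?tU) (push join unjoin \<circ> ?tF) (join ` ?tV)
      (join \<circ> tangent_map (sum_of_terms L) ?D \<circ> unjoin)"
    unfolding T push_join_tuple_space join_tuple_set[OF sc_banach_nested[OF E]] join_tuple_pts[OF sc_banach_nested[OF F]]
    by (rule Suc.IH[OF admissible_tangent_terms[OF Suc.prems]])
  have "sc0 ?tE ?tU ?tF ?tV (tangent_map (sum_of_terms L) ?D)"
    using sc_class_enc_imp_sc0[OF step]
    by (simp only: sc0_push[OF embedding_join embedding_join nested_tangent_space[OF nstE] nested_tangent_space[OF nstF]])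
  moreover have "sc0 (tuple_space N s E) (tuple_set N s E U) (tuple_space N s F) (pts (tuple_space N s F 0)) (sum_of_terms L)"
    using sc0_sum_of_terms[OF Suc.prems] .
  ultimately show ?case
    unfolding sc_class_enc.simps using sc_derivative_sum_of_terms[OF Suc.prems] step by blast
qed

end

theorem proposition1p9:
  fixes E :: "'a::real_vector scspace" and F :: "'b::real_vector scspace"
    and C U :: "'a set" and f :: "'a \<Rightarrow> 'b" and k :: nat
  assumes "sc_banach E" and "sc_banach F"
    and "partial_quadrant TYPE('w::real_vector) E C"
    and "openin (subtopology (ntop (E 0)) C) U"
    and "sc0 E U F (pts (F 0)) f"
    and "\<And>l m. l \<le> k \<Longrightarrow> C_class (l + 1) (E (m + l)) (U \<inter> pts (E (m + l))) (F m) f"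
  shows "sc_class (k + 1) E U F (pts (F 0)) f"
proof -
  obtain d where df: "\<And>x. d x [] = f x"
    and jets: "\<And>m l. l \<le> k \<Longrightarrow> jet (E (m + l)) (F m) (U \<inter> pts (E (m + l))) (Suc l) d"
    using ex_coherent_jet[OF assms(1-4,6)] by blast
  interpret coherent_jet E F U k d using assms(1,2) jets by unfold_locales
  \<comment> \<open>The map \<open>f\<close> itself is the single term without directions.\<close>
  define L where "L n = (if n = 0 then [[] :: nat list] else [])" for n :: nat
  have U: "U \<subseteq> pts (E 0)"
    using openin_subset[OF assms(4)] sc_banach_normed[OF assms(1)] by simp
  have leaf_U: "leaf ` U = tuple_set 1 (\<lambda>_. 0) E U" by (rule leaf_tuple_set) (rule U)
  have "admissible (k + 1) 1 (\<lambda>_. 0) L" by (simp add: admissible_def L_def)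
  moreover have "leaf \<circ> f \<circ> unleaf = sum_of_terms L"
    by (auto simp: fun_eq_iff sum_of_terms_def L_def leaf_def unleaf_def df)
  moreover have "leaf ` pts (F 0) = pts (tuple_space 1 (\<lambda>_. 0) F 0)"
    unfolding push_leaf_tuple_space[symmetric] by simp
  ultimately show ?thesis
    unfolding sc_class_def push_leaf_tuple_space leaf_U by (simp only: sc_class_sum_of_terms)
qed

end
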